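(* Let $\{A_i\}$ be an inverse system of abelian groups indexed by $\mathbb{N}$ such that all the maps $A_{i+1} \to A_i$ are epimorphisms. Then: (1) The cokernel of the natural map $H_2(\varprojlim A_i) \to \varprojlim H_2(A_i)$ is a cotorsion group. (2) Suppose, additionally, that for every $i$ the torsion subgroup of $A_i$ is a group of bounded exponent. Then the cokernel of the natural map $H_3(\varprojlim A_i) \to \varprojlim H_3(A_i)$ is a cotorsion group. In particular, this holds if all $A_i$ are finitely generated.
   Context: $H_n(G) = H_n(G,\mathbb{Z})$ denotes the $n$-th group homology with integer coefficients. An abelian group $A$ is called a cotorsion group if $A \cong {\varprojlim}^1 B_i$ for some tower (inverse system indexed by $\mathbb{N}$) of abelian groups $B_i$; equivalently, if $\mathrm{Ext}(C,A)=0$ for every torsion-free abelian group $C$. *)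

theory Defs
  imports "HOL-Algebra.Free_Abelian_Groups"
begin

section \<open>Towers of abelian groups\<close>

definition abelian_tower :: "(nat \<Rightarrow> 'a monoid) \<Rightarrow> (nat \<Rightarrow> 'a \<Rightarrow> 'a) \<Rightarrow> bool" where
  "abelian_tower A p \<longleftrightarrow>
     (\<forall>i. comm_group (A i)) \<and> (\<forall>i. p i \<in> hom (A (Suc i)) (A i))"

definition inv_limit :: "(nat \<Rightarrow> 'a monoid) \<Rightarrow> (nat \<Rightarrow> 'a \<Rightarrow> 'a) \<Rightarrow> (nat \<Rightarrow> 'a) monoid" where
  "inv_limit A p =
     (product_group UNIV A)
       \<lparr>carrier := {x \<in> carrier (product_group UNIV A). \<forall>i. p i (x (Suc i)) = x i}\<rparr>"

definition cokernel :: "'a monoid \<Rightarrow> 'b monoid \<Rightarrow> ('a \<Rightarrow> 'b) \<Rightarrow> 'b set monoid" where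
  "cokernel G H h = H Mod (h ` carrier G)"

definition lim1 :: "(nat \<Rightarrow> 'a monoid) \<Rightarrow> (nat \<Rightarrow> 'a \<Rightarrow> 'a) \<Rightarrow> (nat \<Rightarrow> 'a) set monoid" where
  "lim1 A p =
     cokernel (product_group UNIV A) (product_group UNIV A)
       (\<lambda>x i. x i \<otimes>\<^bsub>A i\<^esub> inv\<^bsub>A i\<^esub> (p i (x (Suc i))))"

text \<open>
  An abelian group is cotorsion if it is isomorphic to the first derived limit of some tower.
  HOL cannot quantify over the type of the groups in the tower inside a definition; the fixed
  type used here is large enough that nothing is lost, as \<open>cotorsion_groupI\<close> below shows:
  towers over an arbitrary type give the same notion.
\<close>

definition cotorsion_group :: "'a monoid \<Rightarrow> bool" where
  "cotorsion_group A \<longleftrightarrow>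
     comm_group A \<and>
     (\<exists>(B :: nat \<Rightarrow> (nat \<Rightarrow> 'a \<Rightarrow>\<^sub>0 int) monoid) q. abelian_tower B q \<and> A \<cong> lim1 B q)"

lemma comm_group_product_group:
  assumes "\<And>i. i \<in> I \<Longrightarrow> comm_group (G i)"
  shows "comm_group (product_group I G)"
proof (rule group.group_comm_groupI)
  show "group (product_group I G)"
    using assms by (simp add: comm_group_def)
  show "x \<otimes>\<^bsub>product_group I G\<^esub> y = y \<otimes>\<^bsub>product_group I G\<^esub> x"
    if "x \<in> carrier (product_group I G)" "y \<in> carrier (product_group I G)" for x y
    using that assms by (auto simp: PiE_iff comm_groupE(4) intro!: restrict_ext)
qed

lemma comm_group_subgroup:
  assumes "comm_group G" "subgroup H G"
  shows "comm_group (G\<lparr>carrier := H\<rparr>)"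
  by (rule group.group_comm_groupI) (use assms in \<open>auto simp: comm_group_def group.subgroup_imp_group comm_groupE(4) subgroup.mem_carrier\<close>)

text \<open>
  If \<open>A\<close> is the first derived limit of the tower \<open>B\<close> and \<open>F\<close> is the free abelian group on \<open>A\<close>,
  then the sum map \<open>F \<oplus> F \<oplus> \<dots> \<rightarrow> A\<close> extends to a map \<open>T\<close> on the countable power \<open>Q\<close> of \<open>F\<close>.
  Every tail of \<open>Q\<close> maps onto \<open>A\<close>, so \<open>A\<close> is the first derived limit of the kernels of \<open>T\<close> on
  the tails of \<open>Q\<close>.
\<close>

lemma cotorsion_groupI:
  fixes A :: "'a monoid" and B :: "nat \<Rightarrow> 'b monoid"
  assumes A: "comm_group A" and B: "abelian_tower B f" and iso: "A \<cong> lim1 B f"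
  shows "cotorsion_group A"
proof -
  define P where "P = product_group UNIV B"
  define D where "D = (\<lambda>x i. x i \<otimes>\<^bsub>B i\<^esub> inv\<^bsub>B i\<^esub> (f i (x (Suc i))))"
  define R where "R = D ` carrier P"
  have cB: "comm_group (B i)" and gB: "group (B i)" and fB: "f i \<in> hom (B (Suc i)) (B i)" for i
    using B by (auto simp: abelian_tower_def comm_group_def)
  have fc: "x \<in> carrier (B (Suc i)) \<Longrightarrow> f i x \<in> carrier (B i)" for i x
    using fB by (meson hom_carrier image_subset_iff)
  have cP: "comm_group P"
    unfolding P_def by (rule comm_group_product_group) (rule cB)
  then have gP: "group P" by (simp add: comm_group_def)
  have memP: "x \<in> carrier P \<longleftrightarrow> (\<forall>i. x i \<in> carrier (B i))" for x
    by (auto simp: P_def)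
  have multP: "x \<otimes>\<^bsub>P\<^esub> y = (\<lambda>i. x i \<otimes>\<^bsub>B i\<^esub> y i)" for x y
    by (simp add: P_def restrict_UNIV)
  have oneP: "\<one>\<^bsub>P\<^esub> = (\<lambda>i. \<one>\<^bsub>B i\<^esub>)"
    by (simp add: P_def restrict_UNIV)
  have invP: "x \<in> carrier P \<Longrightarrow> inv\<^bsub>P\<^esub> x = (\<lambda>i. inv\<^bsub>B i\<^esub> x i)" for x
    using gB by (simp add: P_def restrict_UNIV)
  have Dhom: "D \<in> hom P P"
  proof (rule homI)
    show "D x \<in> carrier P" if "x \<in> carrier P" for x
      using that gB fc by (auto simp: memP D_def group.is_monoid monoid.m_closed)
    show "D (x \<otimes>\<^bsub>P\<^esub> y) = D x \<otimes>\<^bsub>P\<^esub> D y" if xy: "x \<in> carrier P" "y \<in> carrier P" for x y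
    proof
      fix i
      interpret comm_group "B i" by (rule cB)
      have "x i \<in> carrier (B i)" "y i \<in> carrier (B i)"
        "f i (x (Suc i)) \<in> carrier (B i)" "f i (y (Suc i)) \<in> carrier (B i)"
        "f i (x (Suc i) \<otimes>\<^bsub>B (Suc i)\<^esub> y (Suc i)) = f i (x (Suc i)) \<otimes>\<^bsub>B i\<^esub> f i (y (Suc i))"
        using xy fc fB by (auto simp: memP hom_mult)
      then show "D (x \<otimes>\<^bsub>P\<^esub> y) i = (D x \<otimes>\<^bsub>P\<^esub> D y) i"
        by (simp add: D_def multP inv_mult m_ac)
    qed
  qed
  interpret D: group_hom P P D
    using gP Dhom by (simp add: group_hom_def group_hom_axioms_def)
  have sR: "subgroup R P"
    unfolding R_def by (rule D.img_is_subgroup)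
  have nR: "R \<lhd> P"
    using cP sR by (rule comm_group.subgroup_imp_normal)
  define M where "M = P Mod R"
  have gM: "group M"
    unfolding M_def using nR by (rule normal.factorgroup_is_group)
  have lim: "lim1 B f = M"
    by (simp add: lim1_def cokernel_def M_def R_def P_def D_def)
  have qhom: "(\<lambda>x. R #>\<^bsub>P\<^esub> x) \<in> hom P M"
    unfolding M_def using nR by (rule normal.r_coset_hom_Mod)
  have carM: "carrier M = (\<lambda>x. R #>\<^bsub>P\<^esub> x) ` carrier P"
    by (simp add: M_def carrier_FactGroup)
  obtain \<phi> where \<phi>: "\<phi> \<in> iso A M"
    using iso lim by (auto simp: is_iso_def)
  have \<phi>im: "\<phi> ` carrier A = carrier M"
    using \<phi> by (auto simp: iso_def bij_betw_def)
  have "\<exists>\<sigma>. \<forall>a\<in>carrier A. \<sigma> a \<in> carrier P \<and> R #>\<^bsub>P\<^esub> \<sigma> a = \<phi> a"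
    using \<phi>im carM by (intro bchoice ballI) (metis imageE image_eqI)
  then obtain \<sigma> where \<sigma>: "\<And>a. a \<in> carrier A \<Longrightarrow> \<sigma> a \<in> carrier P \<and> R #>\<^bsub>P\<^esub> \<sigma> a = \<phi> a"
    by blast
  define F where "F = free_Abelian_group (carrier A)"
  obtain h where h: "h \<in> hom F P" and h_of: "\<And>a. a \<in> carrier A \<Longrightarrow> h (frag_of a) = \<sigma> a"
    using comm_group.free_Abelian_group_universal [OF cP, of \<sigma> "carrier A"] \<sigma>
    unfolding F_def by (metis image_subsetI)
  define Q where "Q = product_group UNIV (\<lambda>_::nat. F)"
  have cF: "comm_group F" and gF: "group F"
    by (auto simp: F_def abelian_free_Abelian_group)
  have cQ: "comm_group Q"
    unfolding Q_def by (rule comm_group_product_group) (rule cF)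
  then have gQ: "group Q" by (simp add: comm_group_def)
  have memQ: "x \<in> carrier Q \<longleftrightarrow> (\<forall>i. x i \<in> carrier F)" for x
    by (auto simp: Q_def)
  have multQ: "x \<otimes>\<^bsub>Q\<^esub> y = (\<lambda>i. x i + y i)" for x y
    by (simp add: Q_def restrict_UNIV F_def)
  have oneQ: "\<one>\<^bsub>Q\<^esub> = (\<lambda>i. 0)"
    by (simp add: Q_def restrict_UNIV F_def)
  have invQ: "x \<in> carrier Q \<Longrightarrow> inv\<^bsub>Q\<^esub> x = (\<lambda>i. - x i)" for x
    by (auto simp: Q_def F_def restrict_UNIV PiE_iff fun_eq_iff)
  have Fadd: "u \<in> carrier F \<Longrightarrow> v \<in> carrier F \<Longrightarrow> u + v \<in> carrier F" for u v
    using group.is_monoid [OF gF] by (metis F_def monoid.m_closed mult_free_Abelian_group)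
  have Fneg: "u \<in> carrier F \<Longrightarrow> - u \<in> carrier F" for u
    by (simp add: F_def)
  have Fdiff: "u \<in> carrier F \<Longrightarrow> v \<in> carrier F \<Longrightarrow> u - v \<in> carrier F" for u v
    using Fadd Fneg by (metis diff_conv_add_uminus)
  have F0: "0 \<in> carrier F"
    by (simp add: F_def)
  have Fsum: "(\<And>i. i \<in> I \<Longrightarrow> u i \<in> carrier F) \<Longrightarrow> sum u I \<in> carrier F" for u :: "nat \<Rightarrow> 'a \<Rightarrow>\<^sub>0 int" and I
    unfolding F_def by (rule sum_closed_free_Abelian_group)
  have hP: "u \<in> carrier F \<Longrightarrow> h u \<in> carrier P" for u
    using h by (meson hom_carrier image_subset_iff)
  have hB: "u \<in> carrier F \<Longrightarrow> h u i \<in> carrier (B i)" for u i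
    using hP memP by blast
  have h_add: "h (u + v) i = h u i \<otimes>\<^bsub>B i\<^esub> h v i" if "u \<in> carrier F" "v \<in> carrier F" for u v i
    using hom_mult [OF h that] by (simp add: multP F_def)
  have h0: "h 0 i = \<one>\<^bsub>B i\<^esub>" for i
    using hom_one [OF h gF gP] by (simp add: oneP F_def)
  define t where "t = (\<lambda>x k. finprod (B k) (\<lambda>j. h (x j) k) {..k})"
  have tP: "t x \<in> carrier P" if "x \<in> carrier Q" for x
    using that hB cB
    by (auto simp: memP memQ t_def Pi_iff comm_group.axioms(1) intro!: comm_monoid.finprod_closed)
  have thom: "t \<in> hom Q P"
  proof (rule homI)
    show "t (x \<otimes>\<^bsub>Q\<^esub> y) = t x \<otimes>\<^bsub>P\<^esub> t y" if xy: "x \<in> carrier Q" "y \<in> carrier Q" for x y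
    proof
      fix k
      interpret comm_group "B k" by (rule cB)
      have "finprod (B k) (\<lambda>j. h (x j + y j) k) {..k} =
            finprod (B k) (\<lambda>j. h (x j) k \<otimes>\<^bsub>B k\<^esub> h (y j) k) {..k}"
        using xy hB by (intro finprod_cong) (auto simp: h_add memQ)
      also have "\<dots> = t x k \<otimes>\<^bsub>B k\<^esub> t y k"
        unfolding t_def using xy hB by (intro finprod_multf) (auto simp: memQ)
      finally show "t (x \<otimes>\<^bsub>Q\<^esub> y) k = (t x \<otimes>\<^bsub>P\<^esub> t y) k"
        by (simp add: multQ multP t_def)
    qed
  qed (rule tP)
  define s where "s = (\<lambda>(j::nat) u (i::nat). if i = j then u else (0::'a \<Rightarrow>\<^sub>0 int))"
  have sQ: "u \<in> carrier F \<Longrightarrow> s j u \<in> carrier Q" for j u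
    by (auto simp: s_def memQ F0)
  have t_s: "t (s j u) = (\<lambda>k. if j \<le> k then h u k else \<one>\<^bsub>B k\<^esub>)" if u: "u \<in> carrier F" for j u
  proof
    fix k
    interpret comm_group "B k" by (rule cB)
    have "t (s j u) k = finprod (B k) (\<lambda>i. if j = i then h u k else \<one>\<^bsub>B k\<^esub>) {..k}"
      unfolding t_def s_def using u hB by (intro finprod_cong) (auto simp: h0 simp_implies_def)
    also have "\<dots> = (if j \<le> k then h u k else \<one>\<^bsub>B k\<^esub>)"
    proof (cases "j \<le> k")
      case True
      then show ?thesis
        using finprod_singleton [of j "{..k}" "\<lambda>_. h u k"] u hB by simp
    next
      case False
      then have "finprod (B k) (\<lambda>i. if j = i then h u k else \<one>\<^bsub>B k\<^esub>) {..k} = finprod (B k) (\<lambda>i. \<one>\<^bsub>B k\<^esub>) {..k}"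
        by (intro finprod_cong) auto
      then show ?thesis using False by simp
    qed
    finally show "t (s j u) k = (if j \<le> k then h u k else \<one>\<^bsub>B k\<^esub>)" .
  qed
  have shift: "t (s j u) \<otimes>\<^bsub>P\<^esub> inv\<^bsub>P\<^esub> (t (s (Suc j) u)) \<in> R" if u: "u \<in> carrier F" for j u
  proof -
    \<comment> \<open>the element concentrated in coordinate \<open>j\<close> is a coboundary\<close>
    define e where "e = (\<lambda>k. if k = j then h u j else \<one>\<^bsub>B k\<^esub>)"
    have e: "t (s j u) \<otimes>\<^bsub>P\<^esub> inv\<^bsub>P\<^esub> (t (s (Suc j) u)) = e"
    proof
      fix k
      interpret comm_group "B k" by (rule cB)
      show "(t (s j u) \<otimes>\<^bsub>P\<^esub> inv\<^bsub>P\<^esub> (t (s (Suc j) u))) k = e k"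
        unfolding multP
        unfolding invP [OF tP [OF sQ [OF u]]]
        unfolding t_s [OF u] e_def using hB [OF u] by (cases "k = j") (use inv_one r_one in auto)
    qed
    define g where "g = rec_nat (h u j) (\<lambda>n v. f (j - Suc n) v)"
    have g: "n \<le> j \<Longrightarrow> g n \<in> carrier (B (j - n))" for n
    proof (induction n)
      case (Suc n)
      then have "g n \<in> carrier (B (Suc (j - Suc n)))"
        by (metis Suc_diff_le Suc_leD diff_Suc_Suc)
      then show ?case by (simp add: g_def fc)
    qed (simp add: g_def hB u)
    define c where "c = (\<lambda>k. if k \<le> j then g (j - k) else \<one>\<^bsub>B k\<^esub>)"
    have c: "c \<in> carrier P"
      using g gB by (auto simp: memP c_def group.is_monoid) (metis diff_diff_cancel diff_le_self)
    have "D c k = e k" for k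
    proof -
      interpret comm_group "B k" by (rule cB)
      have f1: "f k \<one>\<^bsub>B (Suc k)\<^esub> = \<one>\<^bsub>B k\<^esub>"
        using fB gB by (simp add: hom_one)
      consider "k < j" | "k = j" | "k > j" by linarith
      then show ?thesis
      proof cases
        case 1
        then have "j - k = Suc (j - Suc k)" and "j - Suc (j - Suc k) = k"
          by auto
        then have "g (j - k) = f k (g (j - Suc k))"
          by (simp add: g_def)
        moreover have "g (j - k) \<in> carrier (B k)"
          using c 1 by (metis c_def less_imp_le_nat memP)
        ultimately show ?thesis
          using 1 by (simp add: D_def c_def e_def)
      next
        case 2
        have "D c k = h u j \<otimes>\<^bsub>B k\<^esub> inv\<^bsub>B k\<^esub> (f k \<one>\<^bsub>B (Suc k)\<^esub>)" and "h u j \<in> carrier (B k)"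
          using 2 hB [OF u] by (simp_all add: D_def c_def g_def)
        then have "D c k = h u j" by (simp add: f1)
        then show ?thesis using 2 by (simp add: e_def)
      next
        case 3
        then show ?thesis by (simp add: D_def c_def e_def f1)
      qed
    qed
    then have "e = D c" by auto
    then show ?thesis
      using e c by (auto simp: R_def)
  qed
  define T where "T = (\<lambda>x. R #>\<^bsub>P\<^esub> t x)"
  have Thom: "T \<in> hom Q M"
    using hom_compose [OF thom qhom] by (simp add: T_def o_def)
  interpret T: group_hom Q M T
    using gQ gM Thom by (simp add: group_hom_def group_hom_axioms_def)
  define N where "N = (\<lambda>i::nat. {x \<in> kernel Q M T. \<forall>j<i. x j = 0})"
  have kerQ: "x \<in> kernel Q M T \<Longrightarrow> x \<in> carrier Q" for x
    by (simp add: kernel_def)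
  have ker_add: "x \<in> kernel Q M T \<Longrightarrow> y \<in> kernel Q M T \<Longrightarrow> (\<lambda>i. x i + y i) \<in> kernel Q M T" for x y
    using subgroup.m_closed [OF T.subgroup_kernel, of x y] by (simp only: multQ)
  have ker_neg: "x \<in> kernel Q M T \<Longrightarrow> (\<lambda>i. - x i) \<in> kernel Q M T" for x
    using subgroup.m_inv_closed [OF T.subgroup_kernel, of x] invQ [OF kerQ, of x] by simp
  have ker0: "(\<lambda>i. 0) \<in> kernel Q M T"
    using subgroup.one_closed [OF T.subgroup_kernel] by (simp add: oneQ)
  have ker_diff: "(\<lambda>i. x i - y i) \<in> kernel Q M T"
    if "x \<in> kernel Q M T" "y \<in> kernel Q M T" for x y
    using ker_add [OF that(1) ker_neg [OF that(2)]] by simp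
  have sN: "subgroup (N i) Q" for i
  proof (rule group.subgroupI [OF gQ])
    show "N i \<subseteq> carrier Q" by (auto simp: N_def kerQ)
    show "N i \<noteq> {}" using ker0 by (auto simp: N_def)
    show "inv\<^bsub>Q\<^esub> x \<in> N i" if "x \<in> N i" for x
      using that by (auto simp: N_def invQ kerQ ker_neg)
    show "x \<otimes>\<^bsub>Q\<^esub> y \<in> N i" if "x \<in> N i" "y \<in> N i" for x y
      using that by (auto simp: N_def multQ ker_add)
  qed
  define C where "C = (\<lambda>i. Q\<lparr>carrier := N i\<rparr>)"
  have cC: "comm_group (C i)" and gC: "group (C i)" for i
    using comm_group_subgroup [OF cQ sN] by (auto simp: C_def comm_group_def)
  have multC: "x \<otimes>\<^bsub>C i\<^esub> y = (\<lambda>j. x j + y j)" for x y i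
    by (simp add: C_def multQ)
  have carC: "carrier (C i) = N i" for i
    by (simp add: C_def)
  have invC: "x \<in> N i \<Longrightarrow> inv\<^bsub>C i\<^esub> x = (\<lambda>j. - x j)" for x i
    using group.m_inv_consistent [OF gQ sN] by (auto simp: C_def invQ N_def kerQ)
  have NS: "N (Suc i) \<subseteq> N i" for i
    by (auto simp: N_def)
  have tower: "abelian_tower C (\<lambda>_ x. x)"
    using cC NS by (auto simp: abelian_tower_def hom_def carC multC)
  define PC where "PC = product_group UNIV C"
  have memPC: "y \<in> carrier PC \<longleftrightarrow> (\<forall>i. y i \<in> N i)" for y
    by (auto simp: PC_def carC)
  have multPC: "y \<otimes>\<^bsub>PC\<^esub> z = (\<lambda>i j. y i j + z i j)" for y z
    by (simp add: PC_def restrict_UNIV multC)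
  have gPC: "group PC"
    unfolding PC_def using gC by simp
  define S where "S = (\<lambda>(y :: nat \<Rightarrow> nat \<Rightarrow> 'a \<Rightarrow>\<^sub>0 int) j. \<Sum>i\<le>j. y i j)"
  have NF: "x \<in> N i \<Longrightarrow> x j \<in> carrier F" for x i j
    using kerQ memQ by (auto simp: N_def)
  have SQ: "S y \<in> carrier Q" if "y \<in> carrier PC" for y
    using that NF by (auto simp: memQ S_def memPC intro!: Fsum)
  have "S \<in> hom PC Q"
    using SQ by (auto simp: hom_def multPC multQ S_def sum.distrib)
  then have psi: "(\<lambda>y. T (S y)) \<in> hom PC M"
    using hom_compose [OF _ Thom] by (fastforce simp: o_def)
  interpret psi: group_hom PC M "\<lambda>y. T (S y)"
    using gPC gM psi by (simp add: group_hom_def group_hom_axioms_def)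
  have S_tele: "S (\<lambda>i j. z i j - z (Suc i) j) = z 0" if "\<And>i j. j < i \<Longrightarrow> z i j = 0" for z
  proof
    fix j
    have "(\<Sum>i\<le>j. z i j - z (Suc i) j) = z 0 j - z (Suc j) j"
      using sum_telescope [of "\<lambda>i. z i j"] by simp
    then show "S (\<lambda>i j. z i j - z (Suc i) j) j = z 0 j"
      using that by (simp add: S_def)
  qed
  have surj: "(\<lambda>y. T (S y)) ` carrier PC = carrier M"
  proof
    show "(\<lambda>y. T (S y)) ` carrier PC \<subseteq> carrier M"
      using psi by (rule hom_carrier)
    show "carrier M \<subseteq> (\<lambda>y. T (S y)) ` carrier PC"
    proof
      fix m assume "m \<in> carrier M"
      then obtain a where a: "a \<in> carrier A" "m = \<phi> a"
        using \<phi>im by blast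
      define u where "u = frag_of a"
      have u: "u \<in> carrier F" using a by (simp add: u_def F_def)
      define y where "y = (\<lambda>i j. s i u j - s (Suc i) u j)"
      have "y i \<in> N i" for i
      proof -
        have yi: "y i = s i u \<otimes>\<^bsub>Q\<^esub> inv\<^bsub>Q\<^esub> (s (Suc i) u)"
          by (simp add: y_def multQ invQ sQ u)
        interpret t: group_hom Q P t
          using gQ gP thom by (simp add: group_hom_def group_hom_axioms_def)
        have "t (y i) = t (s i u) \<otimes>\<^bsub>P\<^esub> inv\<^bsub>P\<^esub> (t (s (Suc i) u))"
          by (simp add: yi sQ u)
        then have "t (y i) \<in> R" using shift [OF u] by simp
        then have "T (y i) = R"
          unfolding T_def using group.coset_join2 [OF gP _ sR] tP sR
          by (meson subgroup.mem_carrier)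
        then have "T (y i) = \<one>\<^bsub>M\<^esub>" by (simp add: M_def FactGroup_def)
        moreover have "y i \<in> carrier Q"
          unfolding yi by (simp add: sQ u)
        ultimately show ?thesis
          by (auto simp: N_def kernel_def y_def s_def)
      qed
      then have "y \<in> carrier PC" by (simp add: memPC)
      moreover have "S y = s 0 u"
        unfolding y_def by (rule S_tele) (auto simp: s_def)
      moreover have "T (s 0 u) = m"
        using a \<sigma> h_of by (simp add: T_def t_s u) (simp add: u_def)
      ultimately show "m \<in> (\<lambda>y. T (S y)) ` carrier PC"
        by (auto intro!: image_eqI [of _ _ y])
    qed
  qed
  have ker: "kernel PC M (\<lambda>y. T (S y)) =
     (\<lambda>x i. x i \<otimes>\<^bsub>C i\<^esub> inv\<^bsub>C i\<^esub> (x (Suc i))) ` carrier PC" (is "?K = ?E ` _")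
  proof -
    have E: "?E z = (\<lambda>i j. z i j - z (Suc i) j)" if "z \<in> carrier PC" for z
    proof -
      have "z (Suc i) \<in> N i" for i
        using that NS by (auto simp: memPC)
      then show ?thesis
        by (simp add: multC invC)
    qed
    show ?thesis
    proof (intro equalityI subsetI)
      fix y assume y: "y \<in> ?K"
      then have yN: "\<And>i. y i \<in> N i" and yPC: "y \<in> carrier PC" and Sy: "S y \<in> kernel Q M T"
        using SQ by (auto simp: kernel_def memPC)
      define z where "z = (\<lambda>i j. S y j - (\<Sum>k<i. y k j))"
      have part: "(\<lambda>j. \<Sum>k<i. y k j) \<in> kernel Q M T" for i
      proof (induction i)
        case (Suc i)
        then show ?case
          using ker_add [OF Suc.IH, of "y i"] yN by (auto simp: N_def)
      qed (simp add: ker0)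
      have tail: "z i j = 0" if "j < i" for i j
      proof -
        have "(\<Sum>k<i. y k j) = (\<Sum>k\<le>j. y k j)"
          using that yN by (intro sum.mono_neutral_right) (auto simp: N_def)
        then show ?thesis by (simp add: z_def S_def)
      qed
      have "z i \<in> N i" for i
        using ker_diff [OF Sy part] tail by (auto simp: N_def z_def)
      then have zPC: "z \<in> carrier PC" by (simp add: memPC)
      have "?E z = y"
        unfolding E [OF zPC] by (simp add: z_def fun_eq_iff)
      then show "y \<in> ?E ` carrier PC" using zPC by blast
    next
      fix y assume "y \<in> ?E ` carrier PC"
      then obtain z where z: "z \<in> carrier PC" "y = (\<lambda>i j. z i j - z (Suc i) j)"
        using E by auto
      have zN: "\<And>i. z i \<in> N i" using z by (simp add: memPC)
      have "S y = z 0"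
        unfolding z(2) by (rule S_tele) (use zN in \<open>auto simp: N_def\<close>)
      then have "T (S y) = \<one>\<^bsub>M\<^esub>"
        using zN [of 0] by (simp add: N_def kernel_def)
      moreover have "y i \<in> N i" for i
        using zN [of i] zN [of "Suc i"] ker_diff by (auto simp: N_def z(2))
      ultimately show "y \<in> ?K"
        by (simp add: kernel_def memPC)
    qed
  qed
  have "lim1 C (\<lambda>_ x. x) \<cong> M"
    using psi.FactGroup_iso [OF surj] unfolding ker by (simp add: lim1_def cokernel_def PC_def)
  moreover have "group (lim1 C (\<lambda>_ x. x))"
    using normal.factorgroup_is_group [OF psi.normal_kernel] unfolding ker
    by (simp add: lim1_def cokernel_def PC_def)
  ultimately have "M \<cong> lim1 C (\<lambda>_ x. x)"
    by (simp add: group.iso_sym)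
  then have "A \<cong> lim1 C (\<lambda>_ x. x)"
    using iso lim iso_trans by metis
  then show ?thesis
    using A tower by (auto simp: cotorsion_group_def)
qed


section \<open>Integral group homology\<close>

text \<open>
  The homology of a group with trivial integer coefficients is the homology of the (unnormalised)
  bar complex: in degree \<open>n\<close> the free abelian group on the symbols $[g_1|\dots|g_n]$,
  represented by lists of length \<open>n\<close>, with
  $d[g_1|\dots|g_n] = [g_2|\dots|g_n] + \sum_{0<i<n} (-1)^i [g_1|\dots|g_i g_{i+1}|\dots|g_n]
  + (-1)^n [g_1|\dots|g_{n-1}]$.
\<close>

definition bar_chains :: "nat \<Rightarrow> 'a monoid \<Rightarrow> ('a list \<Rightarrow>\<^sub>0 int) monoid" where
  "bar_chains n G = free_Abelian_group {xs. length xs = n \<and> set xs \<subseteq> carrier G}"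

definition bar_face :: "'a monoid \<Rightarrow> nat \<Rightarrow> 'a list \<Rightarrow> 'a list" where
  "bar_face G i xs =
     (if i = 0 then tl xs
      else if i = length xs then butlast xs
      else take (i - 1) xs @ (xs ! (i - 1) \<otimes>\<^bsub>G\<^esub> xs ! i) # drop (i + 1) xs)"

definition bar_boundary :: "nat \<Rightarrow> 'a monoid \<Rightarrow> ('a list \<Rightarrow>\<^sub>0 int) \<Rightarrow> ('a list \<Rightarrow>\<^sub>0 int)" where
  "bar_boundary n G c =
     (if n = 0 then 0
      else frag_extend (\<lambda>xs. \<Sum>i\<le>n. frag_cmul ((-1) ^ i) (frag_of (bar_face G i xs))) c)"

definition bar_cycles :: "nat \<Rightarrow> 'a monoid \<Rightarrow> ('a list \<Rightarrow>\<^sub>0 int) monoid" where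
  "bar_cycles n G =
     (bar_chains n G)\<lparr>carrier := {c \<in> carrier (bar_chains n G). bar_boundary n G c = 0}\<rparr>"

definition bar_boundaries :: "nat \<Rightarrow> 'a monoid \<Rightarrow> ('a list \<Rightarrow>\<^sub>0 int) set" where
  "bar_boundaries n G = bar_boundary (Suc n) G ` carrier (bar_chains (Suc n) G)"

definition group_homology :: "nat \<Rightarrow> 'a monoid \<Rightarrow> ('a list \<Rightarrow>\<^sub>0 int) set monoid" where
  "group_homology n G = bar_cycles n G Mod bar_boundaries n G"

definition bar_map :: "('a \<Rightarrow> 'b) \<Rightarrow> ('a list \<Rightarrow>\<^sub>0 int) \<Rightarrow> ('b list \<Rightarrow>\<^sub>0 int)" where
  "bar_map h = frag_extend (\<lambda>xs. frag_of (map h xs))"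

text \<open>
  The induced map sends the class of a cycle \<open>c\<close> to the class of \<open>bar_map h c\<close>; for a homomorphism
  \<open>h\<close> all cosets in the union below coincide.
\<close>

definition homology_map ::
  "nat \<Rightarrow> 'b monoid \<Rightarrow> ('a \<Rightarrow> 'b) \<Rightarrow> ('a list \<Rightarrow>\<^sub>0 int) set \<Rightarrow> ('b list \<Rightarrow>\<^sub>0 int) set" where
  "homology_map n H h X = (\<Union>c\<in>X. bar_boundaries n H #>\<^bsub>bar_cycles n H\<^esub> bar_map h c)"

definition homology_limit ::
  "nat \<Rightarrow> (nat \<Rightarrow> 'a monoid) \<Rightarrow> (nat \<Rightarrow> 'a \<Rightarrow> 'a) \<Rightarrow> (nat \<Rightarrow> ('a list \<Rightarrow>\<^sub>0 int) set) monoid" where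
  "homology_limit n A p =
     inv_limit (\<lambda>i. group_homology n (A i)) (\<lambda>i. homology_map n (A i) (p i))"

definition homology_limit_map ::
  "nat \<Rightarrow> (nat \<Rightarrow> 'a monoid) \<Rightarrow> ((nat \<Rightarrow> 'a) list \<Rightarrow>\<^sub>0 int) set \<Rightarrow> nat \<Rightarrow> ('a list \<Rightarrow>\<^sub>0 int) set" where
  "homology_limit_map n A X = (\<lambda>i. homology_map n (A i) (\<lambda>x. x i) X)"


section \<open>Finiteness conditions\<close>

definition torsion_subgroup :: "'a monoid \<Rightarrow> 'a monoid" where
  "torsion_subgroup G =
     G\<lparr>carrier := {x \<in> carrier G. \<exists>k::nat. k > 0 \<and> x [^]\<^bsub>G\<^esub> k = \<one>\<^bsub>G\<^esub>}\<rparr>"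

definition bounded_exponent :: "'a monoid \<Rightarrow> bool" where
  "bounded_exponent G \<longleftrightarrow> (\<exists>m::nat. m > 0 \<and> (\<forall>x\<in>carrier G. x [^]\<^bsub>G\<^esub> m = \<one>\<^bsub>G\<^esub>))"

definition finitely_generated_group :: "'a monoid \<Rightarrow> bool" where
  "finitely_generated_group G \<longleftrightarrow>
     (\<exists>S. finite S \<and> S \<subseteq> carrier G \<and> generate G S = carrier G)"

end

theory Submission
  imports Complex_Main "HOL-Library.Function_Algebras" "HOL-Computational_Algebra.Group_Closure" Defs
begin

text \<open>
  Let \<open>L\<close> be the limit of the tower. If for each \<open>i\<close> some positive multiple of \<open>H\<^sub>n(A\<^sub>i)\<close> lies in
  the image of \<open>H\<^sub>n(L)\<close>, then infinite systems \<open>x\<^sub>k = g\<^sub>k + e\<^sub>k x\<^sub>k\<^sub>+\<^sub>1\<close> with suitable \<open>e\<^sub>k\<close> are solvable in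
  the cokernel \<open>G\<close> of \<open>H\<^sub>n(L) \<rightarrow> lim H\<^sub>n(A\<^sub>i)\<close> by convergent series. This means that \<open>Ext(\<rat>, G) = 0\<close>,
  and such groups are first derived limits.

  For \<open>n = 2\<close> the map \<open>H\<^sub>2(L) \<rightarrow> H\<^sub>2(A\<^sub>i)\<close> is onto because \<open>H\<^sub>2\<close> of an abelian group is generated by the
  commutator cycles \<open>[a|b] - [b|a]\<close>.

  For general \<open>n\<close>, multiplication by \<open>k\<close> on \<open>A\<^sub>i\<close> acts on \<open>H\<^sub>n(A\<^sub>i)\<close> as a polynomial in \<open>k\<close> of degree at
  most \<open>n\<close>. If \<open>m\<close> kills the torsion of \<open>A\<^sub>i\<close>, then \<open>m\<close> times a finitely generated subgroup is free
  and lifts to \<open>L\<close>, so that multiplication by each multiple of \<open>m\<close> maps \<open>H\<^sub>n(A\<^sub>i)\<close> into the image of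
  \<open>H\<^sub>n(L)\<close>; by polynomiality the same holds for some fixed multiple of the identity.
\<close>

section \<open>Additive subgroups\<close>

definition add_subgroup :: "'a::ab_group_add set \<Rightarrow> bool" where
  "add_subgroup S \<longleftrightarrow> 0 \<in> S \<and> (\<forall>x\<in>S. \<forall>y\<in>S. x - y \<in> S)"

lemma add_subgroupI:
  assumes "0 \<in> S" "\<And>x y. x \<in> S \<Longrightarrow> y \<in> S \<Longrightarrow> x - y \<in> S"
  shows "add_subgroup S"
  using assms by (simp add: add_subgroup_def)

lemma add_subgroup_zero: "add_subgroup S \<Longrightarrow> 0 \<in> S"
  by (simp add: add_subgroup_def)

lemma add_subgroup_diff: "add_subgroup S \<Longrightarrow> x \<in> S \<Longrightarrow> y \<in> S \<Longrightarrow> x - y \<in> S"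
  by (simp add: add_subgroup_def)

lemma add_subgroup_uminus: "add_subgroup S \<Longrightarrow> x \<in> S \<Longrightarrow> - x \<in> S"
  using add_subgroup_diff [of S 0 x] add_subgroup_zero by auto

lemma add_subgroup_add: "add_subgroup S \<Longrightarrow> x \<in> S \<Longrightarrow> y \<in> S \<Longrightarrow> x + y \<in> S"
  using add_subgroup_diff [of S x "- y"] add_subgroup_uminus by auto

lemma add_subgroup_sum: "add_subgroup S \<Longrightarrow> (\<And>i. i \<in> I \<Longrightarrow> f i \<in> S) \<Longrightarrow> sum f I \<in> S"
  by (induction I rule: infinite_finite_induct) (auto simp: add_subgroup_zero add_subgroup_add)

lemma add_subgroup_Int: "add_subgroup S \<Longrightarrow> add_subgroup T \<Longrightarrow> add_subgroup (S \<inter> T)"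
  by (simp add: add_subgroup_def)

lemma add_subgroup_UNIV: "add_subgroup UNIV"
  by (simp add: add_subgroup_def)

lemma add_subgroup_Union_chain:
  assumes "\<C> \<noteq> {}" "subset.chain \<A> \<C>" "\<And>S. S \<in> \<A> \<Longrightarrow> add_subgroup S"
  shows "add_subgroup (\<Union>\<C>)"
proof (rule add_subgroupI)
  have sub: "S \<in> \<C> \<Longrightarrow> add_subgroup S" for S
    using assms by (auto simp: subset.chain_def)
  show "0 \<in> \<Union>\<C>"
    using assms(1) sub add_subgroup_zero by blast
  fix x y assume "x \<in> \<Union>\<C>" "y \<in> \<Union>\<C>"
  then obtain S T where "S \<in> \<C>" "T \<in> \<C>" "x \<in> S" "y \<in> T" by blast
  moreover have "S \<subseteq> T \<or> T \<subseteq> S"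
    using assms(2) calculation by (auto simp: subset_chain_def)
  ultimately show "x - y \<in> \<Union>\<C>"
    using sub add_subgroup_diff by blast
qed

definition additive_monoid :: "'a::ab_group_add set \<Rightarrow> 'a monoid" where
  "additive_monoid S = \<lparr>carrier = S, monoid.mult = (+), one = 0\<rparr>"

lemma additive_monoid_simps [simp]:
  "carrier (additive_monoid S) = S" "x \<otimes>\<^bsub>additive_monoid S\<^esub> y = x + y" "\<one>\<^bsub>additive_monoid S\<^esub> = 0"
  by (simp_all add: additive_monoid_def)

lemma comm_group_additive_monoid:
  assumes "add_subgroup S"
  shows "comm_group (additive_monoid S)"
proof (rule comm_groupI)
  show "\<exists>y\<in>carrier (additive_monoid S). y \<otimes>\<^bsub>additive_monoid S\<^esub> x = \<one>\<^bsub>additive_monoid S\<^esub>"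
    if "x \<in> carrier (additive_monoid S)" for x
    using that add_subgroup_uminus [OF assms] by (auto intro!: bexI [of _ "- x"])
qed (auto simp: add_ac add_subgroup_zero [OF assms] add_subgroup_add [OF assms])

lemma inv_additive_monoid:
  assumes "add_subgroup S" "x \<in> S"
  shows "inv\<^bsub>additive_monoid S\<^esub> x = - x"
proof -
  interpret comm_group "additive_monoid S" by (rule comm_group_additive_monoid [OF assms(1)])
  show ?thesis
    by (rule inv_equality) (use assms add_subgroup_uminus in auto)
qed

lemma subgroup_additive_monoid:
  assumes "add_subgroup S" "add_subgroup T" "S \<subseteq> T"
  shows "subgroup S (additive_monoid T)"
proof -
  interpret comm_group "additive_monoid T" by (rule comm_group_additive_monoid [OF assms(2)])
  show ?thesis
    by (rule subgroupI)
      (use assms add_subgroup_zero add_subgroup_uminus add_subgroup_add in \<open>auto simp: inv_additive_monoid subset_iff\<close>)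
qed

locale additive_hom = group G for S :: "'v::ab_group_add set" and G :: "('g, 'h) monoid_scheme" (structure) +
  fixes f :: "'v \<Rightarrow> 'g"
  assumes add_subgroup: "add_subgroup S" and hom: "f \<in> hom (additive_monoid S) G"
begin

sublocale additive: group_hom "additive_monoid S" G f
  using comm_group_additive_monoid [OF add_subgroup] hom is_group
  by (simp add: comm_group_def group_hom_def group_hom_axioms_def)

lemma closed: "x \<in> S \<Longrightarrow> f x \<in> carrier G"
  using additive.hom_closed by simp

lemma zero: "f 0 = \<one>"
  using additive.hom_one by simp

lemma add: "x \<in> S \<Longrightarrow> y \<in> S \<Longrightarrow> f (x + y) = f x \<otimes> f y"
  using additive.hom_mult [of x y] by simp

lemma uminus: "x \<in> S \<Longrightarrow> f (- x) = inv (f x)"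
  using additive.hom_inv [of x] by (simp add: inv_additive_monoid add_subgroup)

lemma diff: "x \<in> S \<Longrightarrow> y \<in> S \<Longrightarrow> f (x - y) = f x \<otimes> inv (f y)"
  using add [of x "- y"] by (simp add: uminus add_subgroup_uminus [OF add_subgroup])

lemma subset: "add_subgroup R \<Longrightarrow> R \<subseteq> S \<Longrightarrow> additive_hom R G f"
  by (intro additive_hom.intro additive_hom_axioms.intro is_group) (auto intro!: homI simp: add closed subsetD)

lemma compose:
  assumes "group_hom G H h"
  shows "additive_hom S H (\<lambda>x. h (f x))"
proof -
  interpret h: group_hom G H h by (rule assms)
  show ?thesis
    by (intro additive_hom.intro additive_hom_axioms.intro h.H.is_group add_subgroup)
      (auto intro!: homI simp: add closed)
qed

end

lemma additive_homI:
  assumes "group G" "add_subgroup S" "\<And>x. x \<in> S \<Longrightarrow> f x \<in> carrier G"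
    and "\<And>x y. x \<in> S \<Longrightarrow> y \<in> S \<Longrightarrow> f (x + y) = f x \<otimes>\<^bsub>G\<^esub> f y"
  shows "additive_hom S G f"
  using assms by (auto simp: additive_hom_def additive_hom_axioms_def intro!: homI)

section \<open>Chains\<close>

type_synonym 'a chain = "'a list \<Rightarrow>\<^sub>0 int"

abbreviation supp :: "('a \<Rightarrow>\<^sub>0 int) \<Rightarrow> 'a set" where
  "supp \<equiv> Poly_Mapping.keys"

definition supported_on :: "'a set \<Rightarrow> ('a \<Rightarrow>\<^sub>0 int) set" where
  "supported_on A = {c. supp c \<subseteq> A}"

lemma free_Abelian_group_supported_on: "free_Abelian_group A = additive_monoid (supported_on A)"
  by (simp add: free_Abelian_group_def additive_monoid_def supported_on_def)

lemma supported_on_supp: "c \<in> supported_on (supp c)"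
  by (simp add: supported_on_def)

lemma supported_onD: "c \<in> supported_on A \<Longrightarrow> x \<in> supp c \<Longrightarrow> x \<in> A"
  by (auto simp: supported_on_def)

lemma frag_of_supported_on [simp]: "frag_of x \<in> supported_on A \<longleftrightarrow> x \<in> A"
  by (simp add: supported_on_def)

lemma supported_on_weaken: "c \<in> supported_on A \<Longrightarrow> (\<And>x. x \<in> A \<Longrightarrow> x \<in> B) \<Longrightarrow> c \<in> supported_on B"
  by (auto simp: supported_on_def)

lemma add_subgroup_supported_on: "add_subgroup (supported_on A)"
proof (rule add_subgroupI)
  show "x - y \<in> supported_on A" if "x \<in> supported_on A" "y \<in> supported_on A" for x y
    using that keys_diff [of x y] by (auto simp: supported_on_def)
qed (simp add: supported_on_def)

lemma supported_on_induct [consumes 1, case_names zero one diff]: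
  assumes "c \<in> supported_on A" "P 0" "\<And>x. x \<in> A \<Longrightarrow> P (frag_of x)"
    and "\<And>a b. a \<in> supported_on A \<Longrightarrow> b \<in> supported_on A \<Longrightarrow> P a \<Longrightarrow> P b \<Longrightarrow> P (a - b)"
  shows "P c"
  by (rule free_Abelian_group_induct [of c A]) (use assms in \<open>auto simp: supported_on_def\<close>)

lemma frag_induct [case_names zero one diff]:
  assumes "P 0" "\<And>x. x \<in> supp c \<Longrightarrow> P (frag_of x)" "\<And>a b. P a \<Longrightarrow> P b \<Longrightarrow> P (a - b)"
  shows "P c"
  using frag_induction [of c "supp c" P] assms by auto

lemma frag_extend_in_add_subgroup:
  assumes "add_subgroup S" "\<And>x. x \<in> supp c \<Longrightarrow> f x \<in> S"
  shows "frag_extend f c \<in> S"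
  by (induction c rule: frag_induct)
    (auto simp: assms add_subgroup_zero add_subgroup_diff frag_extend_diff)

lemma frag_extend_supported_on:
  assumes "c \<in> supported_on A" "\<And>x. x \<in> A \<Longrightarrow> f x \<in> supported_on B"
  shows "frag_extend f c \<in> supported_on B"
  by (rule frag_extend_in_add_subgroup [OF add_subgroup_supported_on], rule assms(2) [OF supported_onD [OF assms(1)]])

lemma frag_cmul_diff: "frag_cmul k (a - b) = frag_cmul k a - frag_cmul k b"
  using frag_cmul_distrib2 [of k "a - b" b] by simp

lemma frag_cmul_Suc: "frag_cmul (int (Suc n)) c = frag_cmul (int n) c + c"
  using frag_cmul_distrib [of "int n" 1 c] by (simp add: add.commute)

lemma add_subgroup_frag_cmul:
  assumes "add_subgroup S" "x \<in> S"
  shows "frag_cmul k x \<in> S"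
proof -
  have "frag_cmul (int n) x \<in> S" for n
    by (induction n) (auto simp: assms add_subgroup_zero add_subgroup_add frag_cmul_distrib)
  then show ?thesis
    using add_subgroup_uminus [OF assms(1)]
    by (cases k rule: int_cases2) (auto simp: minus_frag_cmul [symmetric] simp del: minus_frag_cmul)
qed

lemma bar_map_of [simp]: "bar_map f (frag_of xs) = frag_of (map f xs)"
  and bar_map_0 [simp]: "bar_map f 0 = 0"
  and bar_map_diff: "bar_map f (a - b) = bar_map f a - bar_map f b"
  and bar_map_add: "bar_map f (a + b) = bar_map f a + bar_map f b"
  by (simp_all add: bar_map_def frag_extend_diff frag_extend_add)

lemma bar_map_bar_map: "bar_map f (bar_map g c) = bar_map (\<lambda>x. f (g x)) c"
  by (induction c rule: frag_induct) (auto simp: bar_map_diff comp_def)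

lemma bar_map_cong:
  "(\<And>xs. xs \<in> supp c \<Longrightarrow> map f xs = map g xs) \<Longrightarrow> bar_map f c = bar_map g c"
  unfolding bar_map_def by (rule frag_extend_eq) metis

lemma bar_map_ident:
  assumes "\<And>xs. xs \<in> supp c \<Longrightarrow> map f xs = xs"
  shows "bar_map f c = c"
  using frag_extend_eq [of c "\<lambda>xs. frag_of (map f xs)" frag_of] assms
  by (simp add: bar_map_def frag_expansion [symmetric])

lemma bar_map_supported_on:
  "c \<in> supported_on A \<Longrightarrow> (\<And>xs. xs \<in> A \<Longrightarrow> map f xs \<in> B) \<Longrightarrow> bar_map f c \<in> supported_on B"
  unfolding bar_map_def by (rule frag_extend_supported_on) auto

section \<open>Evaluation of integral linear combinations\<close>

definition frag_eval :: "('g, 'h) monoid_scheme \<Rightarrow> ('i \<Rightarrow> 'g) \<Rightarrow> ('i \<Rightarrow>\<^sub>0 int) \<Rightarrow> 'g" where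
  "frag_eval G a c = finprod G (\<lambda>i. a i [^]\<^bsub>G\<^esub> Poly_Mapping.lookup c i) (supp c)"

context comm_group
begin

lemma frag_eval_superset:
  assumes "finite J" "supp c \<subseteq> J" "a \<in> J \<rightarrow> carrier G"
  shows "frag_eval G a c = finprod G (\<lambda>i. a i [^] Poly_Mapping.lookup c i) J"
  unfolding frag_eval_def
  by (rule finprod_mono_neutral_cong_left) (use assms in \<open>auto simp: in_keys_iff int_pow_0\<close>)

lemma frag_eval_additive_hom:
  assumes a: "a \<in> I \<rightarrow> carrier G"
  shows "additive_hom (supported_on I) G (frag_eval G a)"
proof (rule additive_homI [OF is_group add_subgroup_supported_on])
  show "frag_eval G a c \<in> carrier G" if "c \<in> supported_on I" for c
    unfolding frag_eval_def using that a by (intro finprod_closed) (auto simp: supported_on_def)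
  fix c d assume "c \<in> supported_on I" "d \<in> supported_on I"
  define J where "J = supp c \<union> supp d"
  have J: "finite J" "a \<in> J \<rightarrow> carrier G"
    using a \<open>c \<in> _\<close> \<open>d \<in> _\<close> by (auto simp: J_def supported_on_def)
  note eval = frag_eval_superset [OF J(1) _ J(2)]
  have "frag_eval G a (c + d) = finprod G (\<lambda>i. a i [^] Poly_Mapping.lookup (c + d) i) J"
    using keys_add [of c d] by (intro eval) (auto simp: J_def)
  also have "\<dots> = finprod G (\<lambda>i. a i [^] Poly_Mapping.lookup c i \<otimes> a i [^] Poly_Mapping.lookup d i) J"
    using J(2) by (intro finprod_cong) (auto simp: Poly_Mapping.lookup_add int_pow_mult Pi_iff simp_implies_def)
  also have "\<dots> = finprod G (\<lambda>i. a i [^] Poly_Mapping.lookup c i) J \<otimes> finprod G (\<lambda>i. a i [^] Poly_Mapping.lookup d i) J"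
    using J(2) by (intro finprod_multf) (auto simp: Pi_iff)
  also have "\<dots> = frag_eval G a c \<otimes> frag_eval G a d"
    using eval [of c] eval [of d] by (simp add: J_def)
  finally show "frag_eval G a (c + d) = frag_eval G a c \<otimes> frag_eval G a d" .
qed

lemma frag_eval_of: "a i \<in> carrier G \<Longrightarrow> frag_eval G a (frag_of i) = a i"
  by (simp add: frag_eval_def int_pow_1)

end

lemma additive_hom_eq_on_supported_on:
  assumes "additive_hom (supported_on A) G f" "additive_hom (supported_on A) G g"
    and "\<And>x. x \<in> A \<Longrightarrow> f (frag_of x) = g (frag_of x)" "c \<in> supported_on A"
  shows "f c = g c"
proof -
  interpret f: additive_hom "supported_on A" G f by (rule assms(1))
  interpret g: additive_hom "supported_on A" G g by (rule assms(2))
  show ?thesis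
    using assms(4) by (induction rule: supported_on_induct) (simp_all add: assms(3) f.zero g.zero f.diff g.diff)
qed

section \<open>Extending homomorphisms along divisible quotients\<close>

locale rat_vector_space = vector_space scale
  for scale :: "rat \<Rightarrow> 'v::ab_group_add \<Rightarrow> 'v"  (infixr \<open>*s\<close> 75)
begin

lemma add_subgroup_subspace: "subspace W \<Longrightarrow> add_subgroup W"
  by (intro add_subgroupI) (auto simp: subspace_0 subspace_diff)

lemma add_subgroup_scale_of_nat:
  assumes S: "add_subgroup S" and x: "x \<in> S"
  shows "of_nat n *s x \<in> S"
  by (induction n) (auto simp: x scale_left_distrib add_subgroup_zero [OF S] add_subgroup_add [OF S])

lemma add_subgroup_scale_of_int:
  assumes S: "add_subgroup S" and x: "x \<in> S"
  shows "of_int k *s x \<in> S"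
  using add_subgroup_scale_of_nat [OF assms] add_subgroup_uminus [OF S add_subgroup_scale_of_nat [OF assms]]
  by (cases k rule: int_cases2) auto

end

lemma Gcd_in_add_subgroup:
  fixes J :: "int set"
  assumes "add_subgroup J"
  shows "Gcd J \<in> J"
proof -
  have "x \<in> J" if "x \<in> group_closure J" for x
    using that assms by induction (auto simp: add_subgroup_def)
  then show ?thesis
    using Gcd_in_group_closure by blast
qed

lemma maximal_add_subgroup:
  assumes "add_subgroup D"
  obtains M where "add_subgroup M" "D \<subseteq> M" "M \<inter> W \<subseteq> D"
    "\<And>N. add_subgroup N \<Longrightarrow> M \<subseteq> N \<Longrightarrow> N \<inter> W \<subseteq> M \<Longrightarrow> N = M"
proof -
  define \<A> where "\<A> = {Z. add_subgroup Z \<and> D \<subseteq> Z \<and> Z \<inter> W \<subseteq> D}"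
  have "\<exists>M\<in>\<A>. \<forall>X\<in>\<A>. M \<subseteq> X \<longrightarrow> X = M"
  proof (rule subset_Zorn_nonempty)
    show "\<A> \<noteq> {}"
      using assms by (auto simp: \<A>_def)
    fix \<C> assume chain: "\<C> \<noteq> {}" "subset.chain \<A> \<C>"
    then have "add_subgroup (\<Union>\<C>)"
      by (rule add_subgroup_Union_chain) (simp add: \<A>_def)
    moreover have "\<C> \<subseteq> \<A>"
      using chain by (simp add: subset_chain_def)
    ultimately show "\<Union>\<C> \<in> \<A>"
      using chain(1) by (auto simp: \<A>_def)
  qed
  then obtain M where "M \<in> \<A>" and max: "\<And>X. X \<in> \<A> \<Longrightarrow> M \<subseteq> X \<Longrightarrow> X = M"
    by auto
  then show thesis
    by (intro that [of M] max) (auto simp: \<A>_def)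
qed

context rat_vector_space
begin

lemma add_subgroup_multiples_modulo:
  assumes "add_subgroup M" "subspace W"
  shows "add_subgroup {b :: int. \<exists>z\<in>M. of_int b *s x - z \<in> W}"
proof (rule add_subgroupI)
  show "0 \<in> {b :: int. \<exists>z\<in>M. of_int b *s x - z \<in> W}"
    using add_subgroup_zero [OF assms(1)] subspace_0 [OF assms(2)] by (auto intro!: bexI [of _ 0])
  fix b c assume "b \<in> {b :: int. \<exists>z\<in>M. of_int b *s x - z \<in> W}" "c \<in> {b :: int. \<exists>z\<in>M. of_int b *s x - z \<in> W}"
  then obtain z w where "z \<in> M" "w \<in> M" "of_int b *s x - z \<in> W" "of_int c *s x - w \<in> W"
    by auto
  then have "z - w \<in> M" "(of_int b *s x - z) - (of_int c *s x - w) \<in> W"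
    using add_subgroup_diff assms(1) subspace_diff [OF assms(2)] by blast+
  then show "b - c \<in> {b :: int. \<exists>z\<in>M. of_int b *s x - z \<in> W}"
    by (auto intro!: bexI [of _ "z - w"] simp: scale_left_diff_distrib algebra_simps)
qed

lemma add_subgroup_adjoin:
  assumes "add_subgroup M"
  shows "add_subgroup {z + of_int b *s x | z b. z \<in> M}"
proof (rule add_subgroupI)
  show "0 \<in> {z + of_int b *s x | z b. z \<in> M}"
    using add_subgroup_zero [OF assms] by (auto intro!: exI [of _ 0] exI [of _ "0::int"])
  fix u v assume "u \<in> {z + of_int b *s x | z b. z \<in> M}" "v \<in> {z + of_int b *s x | z b. z \<in> M}"
  then obtain z b w c where "z \<in> M" "w \<in> M" "u = z + of_int b *s x" "v = w + of_int c *s x"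
    by auto
  then have "u - v = (z - w) + of_int (b - c) *s x" "z - w \<in> M"
    using add_subgroup_diff [OF assms] by (auto simp: scale_left_diff_distrib)
  then show "u - v \<in> {z + of_int b *s x | z b. z \<in> M}" by blast
qed

lemma maximal_add_subgroup_covers:
  assumes M: "add_subgroup M" and W: "subspace W"
    and max: "\<And>N. add_subgroup N \<Longrightarrow> M \<subseteq> N \<Longrightarrow> N \<inter> W \<subseteq> M \<Longrightarrow> N = M"
  obtains z where "z \<in> M" "x - z \<in> W"
proof -
  define J where "J = {b :: int. \<exists>z\<in>M. of_int b *s x - z \<in> W}"
  define a where "a = Gcd J"
  have "a \<in> J"
    unfolding a_def J_def by (rule Gcd_in_add_subgroup [OF add_subgroup_multiples_modulo [OF M W]])
  then obtain z where z: "z \<in> M" "of_int a *s x - z \<in> W"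
    by (auto simp: J_def)
  define x' where "x' = x - (1 / of_int a) *s (of_int a *s x - z)"
  have xx': "x - x' \<in> W"
    using subspace_scale [OF W z(2)] by (simp add: x'_def)
  have ax': "of_int a *s x' \<in> M"
    using z(1) add_subgroup_zero [OF M] by (cases "a = 0") (simp_all add: x'_def scale_right_diff_distrib)
  define N where "N = {z + of_int b *s x' | z b. z \<in> M}"
  have "N \<inter> W \<subseteq> M"
  proof
    fix u assume u: "u \<in> N \<inter> W"
    then obtain z b where zb: "z \<in> M" "u = z + of_int b *s x'"
      by (auto simp: N_def)
    have "of_int b *s x - (- z) = u + of_int b *s (x - x')"
      by (simp add: zb scale_right_diff_distrib)
    also have "\<dots> \<in> W"
      using subspace_add [OF W _ subspace_scale [OF W xx']] u by simp
    finally have "b \<in> J"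
      using add_subgroup_uminus [OF M zb(1)] unfolding J_def by blast
    then obtain c where "b = a * c"
      unfolding a_def by (meson Gcd_dvd dvdE)
    then have "of_int b *s x' = of_int c *s of_int a *s x'"
      by (simp add: mult.commute)
    then show "u \<in> M"
      unfolding zb(2) using add_subgroup_add [OF M zb(1)] add_subgroup_scale_of_int [OF M ax'] by metis
  qed
  moreover have "M \<subseteq> N"
    by (auto simp: N_def intro!: exI [of _ "0::int"])
  ultimately have "N = M"
    using add_subgroup_adjoin [OF M, of x'] by (intro max) (simp_all add: N_def)
  moreover have "x' \<in> N"
    using add_subgroup_zero [OF M] unfolding N_def by (auto intro!: exI [of _ 0] exI [of _ "1::int"])
  ultimately show thesis
    using xx' that by blast
qed

text \<open>
  As \<open>D / (D \<inter> W)\<close> embeds into the rational vector space \<open>V / W\<close>, this enlarges \<open>D\<close> so that the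
  quotient becomes all of \<open>V / W\<close>.
\<close>

lemma add_subgroup_divisible_extension:
  assumes "add_subgroup D" "subspace W"
  obtains Z where "add_subgroup Z" "D \<subseteq> Z" "Z \<inter> W = D \<inter> W"
    "\<And>z n. z \<in> Z \<Longrightarrow> 0 < n \<Longrightarrow> \<exists>w\<in>Z. z - of_nat n *s w \<in> W"
proof -
  obtain Z where Z: "add_subgroup Z" "D \<subseteq> Z" "Z \<inter> W \<subseteq> D"
    and max: "\<And>N. add_subgroup N \<Longrightarrow> Z \<subseteq> N \<Longrightarrow> N \<inter> W \<subseteq> Z \<Longrightarrow> N = Z"
    using maximal_add_subgroup [OF assms(1)] by blast
  show thesis
  proof (rule that [OF Z(1,2)])
    show "Z \<inter> W = D \<inter> W"
      using Z by blast
    fix z and n :: nat assume "z \<in> Z" "0 < n"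
    obtain w where w: "w \<in> Z" "(1 / of_nat n) *s z - w \<in> W"
      using maximal_add_subgroup_covers [OF Z(1) assms(2) max] by metis
    have "of_nat n *s ((1 / of_nat n) *s z - w) = z - of_nat n *s w"
      using \<open>0 < n\<close> by (simp add: scale_right_diff_distrib)
    then show "\<exists>w\<in>Z. z - of_nat n *s w \<in> W"
      using subspace_scale [OF assms(2) w(2), of "of_nat n"] w(1) by auto
  qed
qed

lemma basis_modulo_subspace:
  assumes "subspace W"
  obtains S where "S \<subseteq> Z" "independent S" "span S \<inter> W = {0}" "\<And>z. z \<in> Z \<Longrightarrow> \<exists>u\<in>span S. z - u \<in> W"
proof -
  obtain B where B: "B \<subseteq> W" "independent B" "W \<subseteq> span B"
    by (rule maximal_independent_subset)
  obtain C where C: "B \<subseteq> C" "C \<subseteq> B \<union> Z" "independent C" "B \<union> Z \<subseteq> span C"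
    by (rule maximal_independent_subset_extend [OF Un_upper1 B(2)])
  define S where "S = C - B"
  have span_B: "span B = W"
    using span_subspace [OF B(1,3) assms] .
  have "independent S"
    using C(3) independent_mono by (auto simp: S_def)
  show thesis
  proof (rule that [OF _ \<open>independent S\<close>])
    show "S \<subseteq> Z"
      using C(2) by (auto simp: S_def)
    have "x = 0" if "x \<in> span S" "x \<in> span B" for x
    proof -
      have "representation C x = representation S x" "representation C x = representation B x"
        using C(1) by (auto simp: S_def intro!: representation_extend [OF C(3)] that [unfolded S_def])
      then have "representation S x s = 0" for s
        using representation_ne_zero [of S x s] representation_ne_zero [of B x s] by (auto simp: S_def)
      then show ?thesis
        using sum_nonzero_representation_eq [OF \<open>independent S\<close> that(1)] by simp
    qed
    then show "span S \<inter> W = {0}"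
      using span_zero span_B by blast
    fix z assume "z \<in> Z"
    then have "z \<in> span (B \<union> S)"
      using C(1,4) by (auto simp: S_def Un_absorb1)
    then obtain b u where "b \<in> span B" "u \<in> span S" "z = b + u"
      by (auto simp: span_Un)
    then show "\<exists>u\<in>span S. z - u \<in> W"
      using span_B by (intro bexI [of _ u]) auto
  qed
qed

end

text \<open>
  This says that \<open>Ext(\<rat>, G) = 0\<close>, where \<open>\<rat>\<close> is the colimit of copies of \<open>\<int>\<close> under multiplication
  by \<open>e n\<close>; the divisibility ensures that the colimit is all of \<open>\<rat>\<close>.
\<close>

definition solvable_towers :: "('a, 'b) monoid_scheme \<Rightarrow> bool" where
  "solvable_towers G \<longleftrightarrow>
     (\<exists>e. (\<forall>n. 0 < e n \<and> Suc n dvd e n) \<and>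
        (\<forall>g. (\<forall>n::nat. g n \<in> carrier G) \<longrightarrow>
           (\<exists>x. (\<forall>n. x n \<in> carrier G) \<and> (\<forall>n. x n = g n \<otimes>\<^bsub>G\<^esub> x (Suc n) [^]\<^bsub>G\<^esub> (e n :: nat)))))"

definition (in rat_vector_space) int_comb :: "('s \<Rightarrow> 'v) \<Rightarrow> ('s \<Rightarrow>\<^sub>0 int) \<Rightarrow> 'v" where
  "int_comb y c = (\<Sum>s\<in>supp c. of_int (Poly_Mapping.lookup c s) *s y s)"

context rat_vector_space
begin

lemma int_comb_superset:
  "finite A \<Longrightarrow> supp c \<subseteq> A \<Longrightarrow> int_comb y c = (\<Sum>s\<in>A. of_int (Poly_Mapping.lookup c s) *s y s)"
  unfolding int_comb_def by (rule sum.mono_neutral_left) (auto simp: in_keys_iff)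

lemma int_comb_diff: "int_comb y (c - d) = int_comb y c - int_comb y d"
proof -
  define A where "A = supp c \<union> supp d"
  have "int_comb y (c - d) = (\<Sum>s\<in>A. of_int (Poly_Mapping.lookup (c - d) s) *s y s)"
    using keys_diff [of c d] by (intro int_comb_superset) (auto simp: A_def)
  also have "\<dots> = (\<Sum>s\<in>A. of_int (Poly_Mapping.lookup c s) *s y s) - (\<Sum>s\<in>A. of_int (Poly_Mapping.lookup d s) *s y s)"
    by (simp add: Poly_Mapping.lookup_minus scale_left_diff_distrib sum_subtractf)
  also have "\<dots> = int_comb y c - int_comb y d"
    using int_comb_superset [of A c y] int_comb_superset [of A d y] by (simp add: A_def)
  finally show ?thesis .
qed

lemma int_comb_zero [simp]: "int_comb y 0 = 0"
  and int_comb_of [simp]: "int_comb y (frag_of s) = y s"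
  by (simp_all add: int_comb_def)

lemma int_comb_in_add_subgroup:
  "add_subgroup Z \<Longrightarrow> (\<And>s. s \<in> supp c \<Longrightarrow> y s \<in> Z) \<Longrightarrow> int_comb y c \<in> Z"
  unfolding int_comb_def by (intro add_subgroup_sum add_subgroup_scale_of_int)

lemma independent_int_comb_eq_0:
  assumes "independent S" "c \<in> supported_on S" "int_comb (\<lambda>s. s) c = 0"
  shows "c = 0"
proof (rule poly_mapping_eqI)
  fix s
  have "of_int (Poly_Mapping.lookup c s) = (0::rat)" if "s \<in> supp c"
    using assms that unfolding int_comb_def supported_on_def by (intro independentD [OF assms(1)]) auto
  then show "Poly_Mapping.lookup c s = Poly_Mapping.lookup 0 s"
    by (auto simp: in_keys_iff)
qed

lemma divisible_sequence:
  assumes "z \<in> Z" "\<And>z n. z \<in> Z \<Longrightarrow> 0 < n \<Longrightarrow> \<exists>w\<in>Z. z - of_nat n *s w \<in> W" "\<And>n. 0 < (e n :: nat)"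
  obtains y where "y 0 = z" "\<And>n. y n \<in> Z" "\<And>n. y n - of_nat (e n) *s y (Suc n) \<in> W"
proof -
  have "\<exists>y. \<forall>n. (y n \<in> Z \<and> (n = 0 \<longrightarrow> y n = z)) \<and> y n - of_nat (e n) *s y (Suc n) \<in> W"
  proof (rule dependent_nat_choice)
    show "\<exists>w. (w \<in> Z \<and> (Suc n = 0 \<longrightarrow> w = z)) \<and> v - of_nat (e n) *s w \<in> W"
      if "v \<in> Z \<and> (n = 0 \<longrightarrow> v = z)" for v n
      using assms(2) [of v "e n"] assms(3) that by auto
  qed (use assms(1) in auto)
  then show thesis
    using that by metis
qed

end

text \<open>
  The elements \<open>y s n\<close> are \<open>s\<close> divided by \<open>e 0 \<dots> e (n - 1)\<close> modulo \<open>W\<close>, so that \<open>Z\<close> is generated by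
  them and \<open>Z \<inter> W\<close>; their relations \<open>y s n - e n y s (n + 1) \<in> Z \<inter> W\<close> are respected by \<open>X\<close>.
\<close>

locale divisible_generators = rat_vector_space scale + comm_group G
  for scale :: "rat \<Rightarrow> 'v::ab_group_add \<Rightarrow> 'v"  (infixr \<open>*s\<close> 75) and G :: "('g, 'h) monoid_scheme" (structure) +
  fixes Z W :: "'v set" and f :: "'v \<Rightarrow> 'g" and e :: "nat \<Rightarrow> nat"
    and S :: "'v set" and y :: "'v \<Rightarrow> nat \<Rightarrow> 'v" and X :: "'v \<Rightarrow> nat \<Rightarrow> 'g"
  assumes add_subgroup_Z: "add_subgroup Z" and subspace_W: "subspace W"
    and f_hom: "additive_hom (Z \<inter> W) G f"
    and e_pos: "0 < e n" and e_dvd: "Suc n dvd e n"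
    and independent_S: "independent S" and span_S_Int_W: "span S \<inter> W = {0}"
    and Z_cover: "z \<in> Z \<Longrightarrow> \<exists>u\<in>span S. z - u \<in> W"
    and y_zero: "s \<in> S \<Longrightarrow> y s 0 = s" and y_in_Z: "s \<in> S \<Longrightarrow> y s n \<in> Z"
    and y_step: "s \<in> S \<Longrightarrow> y s n - of_nat (e n) *s y s (Suc n) \<in> W"
    and X_closed: "s \<in> S \<Longrightarrow> X s n \<in> carrier G"
    and X_step: "s \<in> S \<Longrightarrow> X s n = f (y s n - of_nat (e n) *s y s (Suc n)) \<otimes> X s (Suc n) [^] e n"
begin

definition lift_at :: "nat \<Rightarrow> 'v \<Rightarrow> 'g \<Rightarrow> bool" where
  "lift_at n z t \<longleftrightarrow> (\<exists>b c. b \<in> Z \<inter> W \<and> c \<in> supported_on S \<and>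
     z = b + int_comb (\<lambda>s. y s n) c \<and> t = f b \<otimes> frag_eval G (\<lambda>s. X s n) c)"

definition e_prod :: "nat \<Rightarrow> nat" where
  "e_prod n = (\<Prod>i<n. e i)"

sublocale f: additive_hom "Z \<inter> W" G f
  by (rule f_hom)

lemma eval_hom: "additive_hom (supported_on S) G (frag_eval G (\<lambda>s. X s n))"
  by (rule frag_eval_additive_hom) (simp add: X_closed)

lemma lift_at_closed:
  assumes "lift_at n z t"
  shows "z \<in> Z" "t \<in> carrier G"
proof -
  obtain b c where bc: "b \<in> Z \<inter> W" "c \<in> supported_on S"
    "z = b + int_comb (\<lambda>s. y s n) c" "t = f b \<otimes> frag_eval G (\<lambda>s. X s n) c"
    using assms by (auto simp: lift_at_def)
  have "int_comb (\<lambda>s. y s n) c \<in> Z"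
    using supported_onD [OF bc(2)] by (intro int_comb_in_add_subgroup [OF add_subgroup_Z] y_in_Z) auto
  then show "z \<in> Z" "t \<in> carrier G"
    using bc add_subgroup_add [OF add_subgroup_Z] f.closed additive_hom.closed [OF eval_hom] by auto
qed

lemma lift_at_comb:
  assumes "c \<in> supported_on S"
  shows "lift_at n (int_comb (\<lambda>s. y s n) c) (frag_eval G (\<lambda>s. X s n) c)"
  unfolding lift_at_def
  using assms additive_hom.closed [OF eval_hom assms] add_subgroup_zero [OF f.add_subgroup] f.zero
  by (intro exI [of _ 0] exI [of _ c]) auto

lemma lift_at_base:
  assumes "b \<in> Z \<inter> W"
  shows "lift_at n b (f b)"
  unfolding lift_at_def
  using assms f.closed [OF assms] add_subgroup_zero [OF add_subgroup_supported_on]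
    additive_hom.zero [OF eval_hom, of n]
  by (intro exI [of _ b] exI [of _ 0]) auto

lemma lift_at_diff:
  assumes "lift_at n z t" "lift_at n w u"
  shows "lift_at n (z - w) (t \<otimes> inv u)"
proof -
  interpret X: additive_hom "supported_on S" G "frag_eval G (\<lambda>s. X s n)"
    by (rule eval_hom)
  obtain b c where z: "b \<in> Z \<inter> W" "c \<in> supported_on S"
    "z = b + int_comb (\<lambda>s. y s n) c" "t = f b \<otimes> frag_eval G (\<lambda>s. X s n) c"
    using assms(1) by (auto simp: lift_at_def)
  obtain b' c' where w: "b' \<in> Z \<inter> W" "c' \<in> supported_on S"
    "w = b' + int_comb (\<lambda>s. y s n) c'" "u = f b' \<otimes> frag_eval G (\<lambda>s. X s n) c'"
    using assms(2) by (auto simp: lift_at_def)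
  have "z - w = (b - b') + int_comb (\<lambda>s. y s n) (c - c')"
    by (simp add: z w int_comb_diff)
  moreover have "t \<otimes> inv u = f (b - b') \<otimes> frag_eval G (\<lambda>s. X s n) (c - c')"
    using z(1,2) w(1,2) f.closed X.closed
    unfolding z(4) w(4) by (simp add: f.diff X.diff inv_mult m_ac)
  moreover have "b - b' \<in> Z \<inter> W" "c - c' \<in> supported_on S"
    using z w add_subgroup_diff f.add_subgroup X.add_subgroup by metis+
  ultimately show ?thesis
    unfolding lift_at_def by blast
qed

lemma lift_at_zero_one: "lift_at n 0 \<one>"
  using lift_at_base [of 0 n] add_subgroup_zero [OF f.add_subgroup] f.zero by simp

lemma lift_at_add:
  assumes "lift_at n z t" "lift_at n w u"
  shows "lift_at n (z + w) (t \<otimes> u)"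
  using lift_at_diff [OF assms(1) lift_at_diff [OF lift_at_zero_one assms(2)]]
    lift_at_closed [OF assms(2)] by simp

lemma lift_at_pow:
  assumes "lift_at n z t"
  shows "lift_at n (of_nat k *s z) (t [^] k)"
proof (induction k)
  case (Suc k)
  then show ?case
    using lift_at_add [OF Suc assms] by (simp add: scale_left_distrib add.commute)
qed (simp add: lift_at_zero_one)

lemma lift_at_Suc:
  assumes "lift_at n z t"
  shows "lift_at (Suc n) z t"
proof -
  obtain b c where bc: "b \<in> Z \<inter> W" "c \<in> supported_on S"
    "z = b + int_comb (\<lambda>s. y s n) c" "t = f b \<otimes> frag_eval G (\<lambda>s. X s n) c"
    using assms by (auto simp: lift_at_def)
  have "lift_at (Suc n) (int_comb (\<lambda>s. y s n) c) (frag_eval G (\<lambda>s. X s n) c)"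
    using bc(2)
  proof (induction rule: supported_on_induct)
    case zero
    then show ?case
      using lift_at_zero_one additive_hom.zero [OF eval_hom] by simp
  next
    case (one s)
    define b where "b = y s n - of_nat (e n) *s y s (Suc n)"
    have "b \<in> Z"
      unfolding b_def using y_in_Z [OF one]
      by (intro add_subgroup_diff [OF add_subgroup_Z] add_subgroup_scale_of_nat [OF add_subgroup_Z])
    then have "lift_at (Suc n) b (f b)"
      using y_step [OF one] by (intro lift_at_base) (simp add: b_def)
    moreover have "lift_at (Suc n) (y s (Suc n)) (X s (Suc n))"
      using lift_at_comb [of "frag_of s" "Suc n"] one X_closed by (simp add: frag_eval_of)
    ultimately have "lift_at (Suc n) (b + of_nat (e n) *s y s (Suc n)) (f b \<otimes> X s (Suc n) [^] e n)"
      by (intro lift_at_add lift_at_pow)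
    moreover have "frag_eval G (\<lambda>s. X s n) (frag_of s) = f b \<otimes> X s (Suc n) [^] e n"
      unfolding b_def X_step [OF one, symmetric] by (rule frag_eval_of) (rule X_closed [OF one])
    ultimately show ?case
      by (simp add: b_def)
  next
    case (diff c d)
    then show ?case
      using lift_at_diff [OF diff(3,4)] additive_hom.diff [OF eval_hom diff(1,2)] by (simp add: int_comb_diff)
  qed
  then show ?thesis
    unfolding bc(3,4) by (intro lift_at_add lift_at_base bc(1))
qed

lemma lift_at_mono:
  assumes "lift_at n z t" "n \<le> m"
  shows "lift_at m z t"
  using assms(2) by (induction rule: dec_induct) (auto intro: lift_at_Suc assms(1))

lemma divided_generator_mod_W:
  assumes "s \<in> S"
  shows "s - of_nat (e_prod n) *s y s n \<in> W"
proof (induction n)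
  case (Suc n)
  have "s - of_nat (e_prod (Suc n)) *s y s (Suc n) =
      (s - of_nat (e_prod n) *s y s n) + of_nat (e_prod n) *s (y s n - of_nat (e n) *s y s (Suc n))"
    by (simp add: e_prod_def scale_right_diff_distrib del: of_nat_prod)
  also have "\<dots> \<in> W"
    using Suc y_step [OF assms] by (intro subspace_add subspace_scale subspace_W)
  finally show ?case .
qed (simp add: e_prod_def y_zero assms subspace_0 subspace_W)

lemma lift_at_zero_unique:
  assumes "lift_at n 0 t"
  shows "t = \<one>"
proof -
  obtain b c where bc: "b \<in> Z \<inter> W" "c \<in> supported_on S"
    "0 = b + int_comb (\<lambda>s. y s n) c" "t = f b \<otimes> frag_eval G (\<lambda>s. X s n) c"
    using assms by (auto simp: lift_at_def)
  let ?E = "of_nat (e_prod n)"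
  have "int_comb (\<lambda>s. s) c - ?E *s int_comb (\<lambda>s. y s n) c \<in> W"
    using bc(2)
  proof (induction rule: supported_on_induct)
    case (diff c d)
    have "int_comb (\<lambda>s. s) (c - d) - ?E *s int_comb (\<lambda>s. y s n) (c - d) =
        (int_comb (\<lambda>s. s) c - ?E *s int_comb (\<lambda>s. y s n) c) - (int_comb (\<lambda>s. s) d - ?E *s int_comb (\<lambda>s. y s n) d)"
      by (simp add: int_comb_diff scale_right_diff_distrib)
    then show ?case
      using subspace_diff [OF subspace_W diff(3,4)] by simp
  qed (simp_all add: divided_generator_mod_W subspace_0 subspace_W)
  moreover have "int_comb (\<lambda>s. y s n) c = - b"
    using bc(3) by (simp add: eq_neg_iff_add_eq_0 add.commute)
  moreover have "?E *s b \<in> W"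
    using bc(1) by (simp add: subspace_scale subspace_W)
  ultimately have "int_comb (\<lambda>s. s) c \<in> W"
    using subspace_diff [OF subspace_W, of "int_comb (\<lambda>s. s) c + ?E *s b" "?E *s b"]
    by simp
  moreover have "int_comb (\<lambda>s. s) c \<in> span S"
    by (rule int_comb_in_add_subgroup [OF add_subgroup_subspace [OF subspace_span]])
      (use supported_onD [OF bc(2)] in \<open>auto intro: span_base\<close>)
  ultimately have "c = 0"
    using span_S_Int_W by (intro independent_int_comb_eq_0 [OF independent_S bc(2)]) blast
  then show ?thesis
    using bc f.zero additive_hom.zero [OF eval_hom, of n] by simp
qed

lemma lift_at_unique:
  assumes "lift_at n z t" "lift_at m z u"
  shows "t = u"
proof -
  have "lift_at (n + m) (z - z) (t \<otimes> inv u)"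
    using assms by (intro lift_at_diff) (auto elim: lift_at_mono)
  then have "t \<otimes> inv u = \<one>"
    using lift_at_zero_unique by simp
  then show ?thesis
    using lift_at_closed(2) [OF assms(1)] lift_at_closed(2) [OF assms(2)] inv_solve_right' by fastforce
qed

lemma lift_at_scaled_generator:
  assumes "s \<in> S"
  obtains n r t where "lift_at n r t" "q *s s - r \<in> W"
proof -
  obtain a b where q: "q = of_int a / of_int b" "0 < b"
    by (metis quotient_of_div quotient_of_denom_pos surj_pair)
  have "nat b dvd e (nat b - 1)"
    using e_dvd [of "nat b - 1"] q(2) by simp
  moreover have "e (nat b - 1) dvd e_prod (nat b)"
    unfolding e_prod_def using q(2) by (intro dvd_prodI) auto
  ultimately obtain k where k: "e_prod (nat b) = nat b * k"
    by (meson dvdE dvd_trans)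
  define r where "r = of_int (a * int k) *s y s (nat b)"
  have "r = int_comb (\<lambda>s. y s (nat b)) (frag_cmul (a * int k) (frag_of s))"
    using int_comb_superset [of "{s}" "frag_cmul (a * int k) (frag_of s)" "\<lambda>s. y s (nat b)"]
      keys_cmul [of "a * int k" "frag_of s"]
    by (simp add: r_def)
  then obtain t where "lift_at (nat b) r t"
    using lift_at_comb [OF add_subgroup_frag_cmul [OF add_subgroup_supported_on], of "frag_of s"] assms by auto
  moreover have "q * of_nat (e_prod (nat b)) = of_int (a * int k)"
    using q k by simp
  then have "q *s s - r = q *s (s - of_nat (e_prod (nat b)) *s y s (nat b))"
    by (simp add: r_def scale_right_diff_distrib)
  then have "q *s s - r \<in> W"
    using subspace_scale [OF subspace_W divided_generator_mod_W [OF assms]] by simp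
  ultimately show thesis
    by (rule that)
qed

lemma lift_at_span:
  assumes "u \<in> span S"
  shows "\<exists>n z t. lift_at n z t \<and> u - z \<in> W"
  using assms
proof (induction rule: span_induct_alt)
  case base
  then show ?case
    using lift_at_zero_one subspace_0 [OF subspace_W] by (intro exI [of _ 0]) auto
next
  case (step q s v)
  obtain n z t where v: "lift_at n z t" "v - z \<in> W"
    using step.IH by blast
  obtain m r t' where s: "lift_at m r t'" "q *s s - r \<in> W"
    using lift_at_scaled_generator [OF step.hyps(1)] .
  have "lift_at (m + n) (r + z) (t' \<otimes> t)"
    using lift_at_mono [OF s(1)] lift_at_mono [OF v(1)] by (intro lift_at_add) auto
  moreover have "(q *s s + v) - (r + z) \<in> W"
    using subspace_add [OF subspace_W s(2) v(2)] by (simp add: algebra_simps)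
  ultimately show ?case
    by blast
qed

lemma lift_at_total:
  assumes "z \<in> Z"
  obtains n t where "lift_at n z t"
proof -
  obtain u where u: "u \<in> span S" "z - u \<in> W"
    using Z_cover [OF assms] by blast
  obtain n w t where w: "lift_at n w t" "u - w \<in> W"
    using lift_at_span [OF u(1)] by blast
  have "z - w = (z - u) + (u - w)"
    by simp
  then have "z - w \<in> W"
    using subspace_add [OF subspace_W u(2) w(2)] by metis
  then have "lift_at n (z - w) (f (z - w))"
    using add_subgroup_diff [OF add_subgroup_Z assms lift_at_closed(1) [OF w(1)]] by (intro lift_at_base) auto
  from lift_at_add [OF this w(1)] show thesis
    using that by simp
qed

lemma extension_exists:
  obtains T where "additive_hom Z G T" "\<And>b. b \<in> Z \<inter> W \<Longrightarrow> T b = f b"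
proof -
  define T where "T z = (THE t. \<exists>n. lift_at n z t)" for z
  have T_eq: "T z = t" if "lift_at n z t" for n z t
    unfolding T_def using that lift_at_unique by blast
  show thesis
  proof (rule that [OF additive_homI [OF is_group add_subgroup_Z]])
    show "T z \<in> carrier G" if "z \<in> Z" for z
      using lift_at_total [OF that] T_eq lift_at_closed(2) by metis
    fix z w assume "z \<in> Z" "w \<in> Z"
    then obtain n t m u where "lift_at n z t" "lift_at m w u"
      using lift_at_total by metis
    then have "lift_at (n + m) z t" "lift_at (n + m) w u"
      by (auto elim: lift_at_mono)
    then show "T (z + w) = T z \<otimes> T w"
      using T_eq lift_at_add by metis
  next
    show "T b = f b" if "b \<in> Z \<inter> W" for b
      using T_eq lift_at_base [OF that] by blast
  qed
qed

end

lemma (in rat_vector_space) extend_along_divisible_quotient: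
  fixes G :: "('g, 'h) monoid_scheme" (structure)
  assumes G: "comm_group G" "solvable_towers G"
    and Z: "add_subgroup Z" and W: "subspace W" and f: "additive_hom (Z \<inter> W) G f"
    and div: "\<And>z n. z \<in> Z \<Longrightarrow> 0 < n \<Longrightarrow> \<exists>w\<in>Z. z - of_nat n *s w \<in> W"
  obtains T where "additive_hom Z G T" "\<And>b. b \<in> Z \<inter> W \<Longrightarrow> T b = f b"
proof -
  obtain e where e: "\<And>n. 0 < e n" "\<And>n. Suc n dvd e n"
    and solve: "\<And>g. \<forall>n::nat. g n \<in> carrier G \<Longrightarrow>
      \<exists>x. (\<forall>n. x n \<in> carrier G) \<and> (\<forall>n. x n = g n \<otimes> x (Suc n) [^] e n)"
    using G(2) unfolding solvable_towers_def by auto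
  obtain S where S: "S \<subseteq> Z" "independent S" "span S \<inter> W = {0}" "\<And>z. z \<in> Z \<Longrightarrow> \<exists>u\<in>span S. z - u \<in> W"
    using basis_modulo_subspace [OF W] by blast
  have "\<exists>y. y 0 = s \<and> (\<forall>n. y n \<in> Z) \<and> (\<forall>n. y n - of_nat (e n) *s y (Suc n) \<in> W)" if "s \<in> S" for s
    using divisible_sequence [of s Z W e] S(1) that div e(1) by blast
  then obtain y where y: "\<And>s. s \<in> S \<Longrightarrow> y s 0 = s" "\<And>s n. s \<in> S \<Longrightarrow> y s n \<in> Z"
    "\<And>s n. s \<in> S \<Longrightarrow> y s n - of_nat (e n) *s y s (Suc n) \<in> W"
    by metis
  have "y s n - of_nat (e n) *s y s (Suc n) \<in> Z" if "s \<in> S" for s n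
    using y(2) [OF that] by (intro add_subgroup_diff [OF Z] add_subgroup_scale_of_nat [OF Z])
  then have "\<exists>X. (\<forall>n. X n \<in> carrier G) \<and>
      (\<forall>n. X n = f (y s n - of_nat (e n) *s y s (Suc n)) \<otimes> X (Suc n) [^] e n)" if "s \<in> S" for s
    using additive_hom.closed [OF f] y(3) that by (intro solve) auto
  then obtain X where X: "\<And>s n. s \<in> S \<Longrightarrow> X s n \<in> carrier G"
    "\<And>s n. s \<in> S \<Longrightarrow> X s n = f (y s n - of_nat (e n) *s y s (Suc n)) \<otimes> X s (Suc n) [^] e n"
    by metis
  interpret divisible_generators scale G Z W f e S y X
    by (intro divisible_generators.intro divisible_generators_axioms.intro rat_vector_space_axioms G(1))
      (fact Z W f e S y X)+
  show thesis
    using extension_exists that by blast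
qed

section \<open>A criterion for cotorsion groups\<close>

text \<open>
  Every tail of the product \<open>V\<^sup>\<nat>\<close> is mapped onto \<open>G\<close>. As the limit and the derived limit of the tails
  vanish, \<open>G\<close> is the first derived limit of the kernels on the tails.
\<close>

locale tail_surjection = comm_group G + additive_hom UNIV G T
  for G :: "'g monoid" (structure) and T :: "(nat \<Rightarrow> 'v::ab_group_add) \<Rightarrow> 'g" +
  assumes tail_onto: "g \<in> carrier G \<Longrightarrow> \<exists>f. (\<forall>j<i. f j = 0) \<and> T f = g"
begin

definition tail_kernel :: "nat \<Rightarrow> (nat \<Rightarrow> 'v) set" where
  "tail_kernel i = {f. T f = \<one> \<and> (\<forall>j<i. f j = 0)}"

definition tail_sum :: "(nat \<Rightarrow> nat \<Rightarrow> 'v) \<Rightarrow> nat \<Rightarrow> 'v" where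
  "tail_sum y j = (\<Sum>i\<le>j. y i j)"

abbreviation kernel_tower :: "nat \<Rightarrow> (nat \<Rightarrow> 'v) monoid" where
  "kernel_tower \<equiv> \<lambda>i. additive_monoid (tail_kernel i)"

abbreviation kernel_product :: "(nat \<Rightarrow> nat \<Rightarrow> 'v) monoid" where
  "kernel_product \<equiv> product_group UNIV kernel_tower"

lemma add_subgroup_tail_kernel: "add_subgroup (tail_kernel i)"
  by (rule add_subgroupI) (auto simp: tail_kernel_def zero diff)

lemma tail_kernel_Suc: "tail_kernel (Suc i) \<subseteq> tail_kernel i"
  by (auto simp: tail_kernel_def)

lemma tail_kernel_vanishes: "f \<in> tail_kernel i \<Longrightarrow> j < i \<Longrightarrow> f j = 0"
  by (simp add: tail_kernel_def)

lemma group_kernel_product: "group kernel_product"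
  using comm_group_additive_monoid [OF add_subgroup_tail_kernel] by (simp add: comm_group_def)

lemma tail_sum_telescope:
  assumes "\<And>i j. j < i \<Longrightarrow> z i j = 0"
  shows "tail_sum (\<lambda>i. z i - z (Suc i)) = z 0"
proof
  fix j
  have "tail_sum (\<lambda>i. z i - z (Suc i)) j = z 0 j - z (Suc j) j"
    using sum_telescope [of "\<lambda>i. z i j"] by (simp add: tail_sum_def)
  then show "tail_sum (\<lambda>i. z i - z (Suc i)) j = z 0 j"
    using assms by simp
qed

lemma tail_sum_hom: "group_hom kernel_product G (\<lambda>y. T (tail_sum y))"
proof -
  have "tail_sum (\<lambda>i. y i + z i) = tail_sum y + tail_sum z" for y z
    by (rule ext) (simp add: tail_sum_def sum.distrib)
  then have "(\<lambda>y. T (tail_sum y)) \<in> hom kernel_product G"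
    by (intro homI) (auto simp: closed add restrict_UNIV)
  then show ?thesis
    by (intro group_hom.intro group_hom_axioms.intro group_kernel_product is_group)
qed

lemma tail_sum_surj: "(\<lambda>y. T (tail_sum y)) ` carrier kernel_product = carrier G"
proof (intro equalityI subsetI)
  fix g assume "g \<in> carrier G"
  then obtain d where d: "\<And>i j. j < i \<Longrightarrow> d i j = 0" "\<And>i. T (d i) = g"
    using tail_onto by metis
  define y where "y i = d i - d (Suc i)" for i
  have "y i \<in> tail_kernel i" for i
    using d \<open>g \<in> carrier G\<close> by (auto simp: y_def tail_kernel_def diff)
  moreover have "tail_sum y = d 0"
    unfolding y_def by (rule tail_sum_telescope) (rule d(1))
  ultimately show "g \<in> (\<lambda>y. T (tail_sum y)) ` carrier kernel_product"
    using d(2) by (intro image_eqI [of _ _ y]) auto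
qed (auto simp: closed)

lemma tail_sum_kernel:
  "kernel kernel_product G (\<lambda>y. T (tail_sum y)) = (\<lambda>z i. z i - z (Suc i)) ` carrier kernel_product"
proof (intro equalityI subsetI)
  fix y assume "y \<in> kernel kernel_product G (\<lambda>y. T (tail_sum y))"
  then have y: "\<And>i. y i \<in> tail_kernel i" and "T (tail_sum y) = \<one>"
    by (auto simp: kernel_def)
  define z where "z i = tail_sum y - (\<Sum>k<i. y k)" for i
  have sum_apply: "(\<Sum>k<i. y k) j = (\<Sum>k<i. y k j)" for i j
    by (induction i) auto
  have "z i j = 0" if "j < i" for i j
  proof -
    have "(\<Sum>k<i. y k j) = (\<Sum>k\<le>j. y k j)"
      using that by (intro sum.mono_neutral_right) (auto simp: tail_kernel_vanishes [OF y])
    then show ?thesis by (simp add: z_def tail_sum_def sum_apply)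
  qed
  moreover have "z i \<in> tail_kernel 0" for i
    unfolding z_def using y \<open>T (tail_sum y) = \<one>\<close>
    by (intro add_subgroup_diff add_subgroup_sum add_subgroup_tail_kernel) (auto simp: tail_kernel_def)
  ultimately have "z i \<in> tail_kernel i" for i
    by (simp add: tail_kernel_def)
  moreover have "y = (\<lambda>i. z i - z (Suc i))"
    by (simp add: z_def fun_eq_iff)
  ultimately show "y \<in> (\<lambda>z i. z i - z (Suc i)) ` carrier kernel_product"
    by auto
next
  fix y assume "y \<in> (\<lambda>z i. z i - z (Suc i)) ` carrier kernel_product"
  then obtain z where z: "\<And>i. z i \<in> tail_kernel i" "y = (\<lambda>i. z i - z (Suc i))"
    by auto
  have "tail_sum y = z 0"
    unfolding z(2) by (rule tail_sum_telescope) (rule tail_kernel_vanishes [OF z(1)])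
  moreover have "y i \<in> tail_kernel i" for i
    unfolding z(2) using z(1) tail_kernel_Suc by (intro add_subgroup_diff add_subgroup_tail_kernel) blast+
  ultimately show "y \<in> kernel kernel_product G (\<lambda>y. T (tail_sum y))"
    using z(1) [of 0] by (auto simp: kernel_def tail_kernel_def)
qed

theorem cotorsion: "cotorsion_group G"
proof -
  have tower: "abelian_tower kernel_tower (\<lambda>_ f. f)"
    using comm_group_additive_monoid [OF add_subgroup_tail_kernel] tail_kernel_Suc
    by (auto simp: abelian_tower_def hom_def)
  interpret S: group_hom kernel_product G "\<lambda>y. T (tail_sum y)"
    by (rule tail_sum_hom)
  have "inv\<^bsub>kernel_tower i\<^esub> (z (Suc i)) = - z (Suc i)" if "z \<in> carrier kernel_product" for z i
    using that tail_kernel_Suc [of i]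
    by (intro inv_additive_monoid add_subgroup_tail_kernel) auto
  then have "(\<lambda>z i. z i \<otimes>\<^bsub>kernel_tower i\<^esub> inv\<^bsub>kernel_tower i\<^esub> (z (Suc i))) ` carrier kernel_product =
      kernel kernel_product G (\<lambda>y. T (tail_sum y))"
    unfolding tail_sum_kernel by (intro image_cong refl) simp
  then have lim: "lim1 kernel_tower (\<lambda>_ f. f) = kernel_product Mod kernel kernel_product G (\<lambda>y. T (tail_sum y))"
    by (simp add: lim1_def cokernel_def)
  have "group (lim1 kernel_tower (\<lambda>_ f. f))"
    unfolding lim by (rule normal.factorgroup_is_group [OF S.normal_kernel])
  moreover have "lim1 kernel_tower (\<lambda>_ f. f) \<cong> G"
    unfolding lim by (rule S.FactGroup_iso [OF tail_sum_surj])
  ultimately show ?thesis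
    using group.iso_sym by (intro cotorsion_groupI [OF comm_group_axioms tower]) blast
qed

end

definition rat_scale :: "rat \<Rightarrow> ('s \<Rightarrow> rat) \<Rightarrow> 's \<Rightarrow> rat" where
  "rat_scale q f = (\<lambda>s. q * f s)"

interpretation rat_funs: rat_vector_space rat_scale
  by unfold_locales (auto simp: rat_scale_def fun_eq_iff algebra_simps)

definition integral_funs :: "('s \<Rightarrow> rat) set" where
  "integral_funs = {f. \<forall>s. f s \<in> \<int>}"

definition finite_funs :: "('s \<Rightarrow> rat) set" where
  "finite_funs = {f. finite {s. f s \<noteq> 0}}"

lemma add_subgroup_integral_funs: "add_subgroup integral_funs"
  by (rule add_subgroupI) (auto simp: integral_funs_def)

lemma subspace_finite_funs: "rat_funs.subspace finite_funs"
proof (rule rat_funs.subspaceI)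
  fix f g :: "'s \<Rightarrow> rat" assume "f \<in> finite_funs" "g \<in> finite_funs"
  then have "finite ({s. f s \<noteq> 0} \<union> {s. g s \<noteq> 0})"
    by (simp add: finite_funs_def)
  moreover have "{s. (f + g) s \<noteq> 0} \<subseteq> {s. f s \<noteq> 0} \<union> {s. g s \<noteq> 0}" by auto
  ultimately show "f + g \<in> finite_funs"
    unfolding finite_funs_def using finite_subset by blast
qed (auto simp: finite_funs_def rat_scale_def elim!: rev_finite_subset)

definition frag_of_fun :: "('s \<Rightarrow> rat) \<Rightarrow> 's \<Rightarrow>\<^sub>0 int" where
  "frag_of_fun f = Abs_poly_mapping (\<lambda>s. \<lfloor>f s\<rfloor>)"

lemma lookup_frag_of_fun:
  assumes "f \<in> finite_funs"
  shows "Poly_Mapping.lookup (frag_of_fun f) s = \<lfloor>f s\<rfloor>"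
proof -
  have "finite {s. \<lfloor>f s\<rfloor> \<noteq> 0}"
    using assms by (auto simp: finite_funs_def elim!: rev_finite_subset)
  then show ?thesis
    by (simp add: frag_of_fun_def)
qed

lemma frag_of_fun_add:
  assumes "f \<in> integral_funs \<inter> finite_funs" "g \<in> integral_funs \<inter> finite_funs"
  shows "frag_of_fun (f + g) = frag_of_fun f + frag_of_fun g"
proof (rule poly_mapping_eqI)
  fix s
  have "f s \<in> \<int>"
    using assms(1) by (simp add: integral_funs_def)
  then show "Poly_Mapping.lookup (frag_of_fun (f + g)) s = Poly_Mapping.lookup (frag_of_fun f + frag_of_fun g) s"
    using assms rat_funs.subspace_add [OF subspace_finite_funs, of f g]
    by (auto simp: lookup_frag_of_fun Poly_Mapping.lookup_add elim!: Ints_cases)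
qed

lemma frag_of_fun_single: "frag_of_fun (\<lambda>s. if s = t then 1 else 0) = frag_of t"
  by (rule poly_mapping_eqI) (simp add: lookup_frag_of_fun finite_funs_def Poly_Mapping.lookup_single when_def)

lemma (in comm_group) frag_eval_extends_to_integral_funs:
  fixes a :: "'i \<Rightarrow> 'a"
  assumes "solvable_towers G" "a \<in> UNIV \<rightarrow> carrier G"
  obtains T where "additive_hom integral_funs G T"
    "\<And>b. b \<in> integral_funs \<inter> finite_funs \<Longrightarrow> T b = frag_eval G a (frag_of_fun b)"
proof -
  interpret eval: additive_hom "supported_on UNIV" G "frag_eval G a"
    by (rule frag_eval_additive_hom [OF assms(2)])
  have "add_subgroup (integral_funs \<inter> finite_funs)"
    by (intro add_subgroup_Int add_subgroup_integral_funs rat_funs.add_subgroup_subspace subspace_finite_funs)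
  then have hom: "additive_hom (integral_funs \<inter> finite_funs) G (\<lambda>b. frag_eval G a (frag_of_fun b))"
    by (rule additive_homI [OF is_group]) (auto simp: frag_of_fun_add supported_on_def intro: eval.closed eval.add)
  obtain Z :: "('i \<Rightarrow> rat) set" where Z: "add_subgroup Z" "integral_funs \<subseteq> Z" "Z \<inter> finite_funs = integral_funs \<inter> finite_funs"
    "\<And>z n. z \<in> Z \<Longrightarrow> 0 < n \<Longrightarrow> \<exists>w\<in>Z. z - rat_scale (of_nat n) w \<in> finite_funs"
    using rat_funs.add_subgroup_divisible_extension [OF add_subgroup_integral_funs subspace_finite_funs] by blast
  then obtain T where T: "additive_hom Z G T"
    "\<And>b. b \<in> integral_funs \<inter> finite_funs \<Longrightarrow> T b = frag_eval G a (frag_of_fun b)"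
    using rat_funs.extend_along_divisible_quotient [OF comm_group_axioms assms(1) Z(1) subspace_finite_funs,
        of "\<lambda>b. frag_eval G a (frag_of_fun b)"] hom by metis
  show thesis
    by (rule that [OF additive_hom.subset [OF T(1) add_subgroup_integral_funs Z(2)] T(2)])
qed

theorem cotorsion_group_if_solvable_towers:
  fixes G :: "'g monoid" (structure)
  assumes "comm_group G" "solvable_towers G"
  shows "cotorsion_group G"
proof -
  interpret comm_group G by (rule assms(1))
  define \<gamma> where "\<gamma> s = (if snd s \<in> carrier G then snd s else \<one>)" for s :: "nat \<times> 'g"
  obtain T where "additive_hom integral_funs G T"
    and T_finite: "\<And>b. b \<in> integral_funs \<inter> finite_funs \<Longrightarrow> T b = frag_eval G \<gamma> (frag_of_fun b)"
    by (rule frag_eval_extends_to_integral_funs [OF assms(2), of \<gamma>]) (auto simp: \<gamma>_def)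
  then interpret T: additive_hom integral_funs G T
    by simp
  define \<iota> where "\<iota> h = (\<lambda>s. of_int (h (fst s) (snd s)) :: rat)" for h :: "nat \<Rightarrow> 'g \<Rightarrow> int"
  have \<iota>: "\<iota> h \<in> integral_funs" for h
    by (simp add: \<iota>_def integral_funs_def)
  have \<iota>_add: "\<iota> (h + k) = \<iota> h + \<iota> k" for h k
    by (simp add: \<iota>_def fun_eq_iff)
  interpret tail_surjection G "\<lambda>h. T (\<iota> h)"
  proof (intro tail_surjection.intro tail_surjection_axioms.intro comm_group_axioms)
    show "additive_hom UNIV G (\<lambda>h. T (\<iota> h))"
      by (rule additive_homI [OF is_group add_subgroup_UNIV]) (auto simp: \<iota> \<iota>_add T.add intro: T.closed)
    fix g and i :: nat assume g: "g \<in> carrier G"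
    define h where "h = (\<lambda>j x. if (j, x) = (i, g) then 1 else 0 :: int)"
    have "\<iota> h = (\<lambda>s. if s = (i, g) then 1 else 0)"
      by (auto simp: \<iota>_def h_def fun_eq_iff)
    moreover have "\<iota> h \<in> finite_funs"
      by (simp add: calculation finite_funs_def)
    ultimately have "T (\<iota> h) = g"
      using T_finite [of "\<iota> h"] \<iota> [of h] g by (simp add: frag_of_fun_single frag_eval_of \<gamma>_def)
    then show "\<exists>h. (\<forall>j<i. h j = 0) \<and> T (\<iota> h) = g"
      by (intro exI [of _ h]) (auto simp: h_def fun_eq_iff)
  qed
  show ?thesis
    by (rule cotorsion)
qed

section \<open>Cokernels of maps into inverse limits\<close>

context comm_group
begin

lemma coset_map_hom:
  assumes "subgroup H G"
  shows "group_hom G (G Mod H) ((#>) H)"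
  using normal.r_coset_hom_Mod [OF subgroup_imp_normal [OF assms]] abelian_FactGroup [OF assms] is_group
  by (simp add: group_hom_def group_hom_axioms_def comm_group_def)

lemma coset_map_surj: "(#>) H ` carrier G = carrier (G Mod H)"
  by (auto simp: carrier_FactGroup)

lemma coset_map_eq_one_iff:
  assumes "subgroup H G" "x \<in> carrier G"
  shows "H #> x = \<one>\<^bsub>G Mod H\<^esub> \<longleftrightarrow> x \<in> H"
  using assms coset_join1 [OF _ _ assms(1)] coset_join2 [OF _ assms(1)] subgroup.subset [OF assms(1)]
  by (auto simp: FactGroup_def)

lemma coset_pow_representative_in_kernel:
  assumes I: "subgroup I G" and \<phi>: "group_hom G H \<phi>" and y: "y \<in> carrier G"
    and image: "\<phi> y [^]\<^bsub>H\<^esub> (c::nat) \<in> \<phi> ` I"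
  shows "\<exists>l\<in>carrier G. \<phi> l = \<one>\<^bsub>H\<^esub> \<and> I #> l = (I #> y) [^]\<^bsub>G Mod I\<^esub> c"
proof -
  interpret \<phi>: group_hom G H \<phi> by (rule \<phi>)
  interpret coset: group_hom G "G Mod I" "(#>) I"
    by (rule coset_map_hom [OF I])
  obtain z where z: "z \<in> I" "\<phi> y [^]\<^bsub>H\<^esub> c = \<phi> z"
    using image by blast
  have z_closed: "z \<in> carrier G"
    using subgroup.mem_carrier [OF I z(1)] .
  have "\<phi> (inv z \<otimes> y [^] c) = \<one>\<^bsub>H\<^esub>"
    by (simp add: y z_closed z(2) \<phi>.hom_nat_pow)
  moreover have "I #> (inv z \<otimes> y [^] c) = (I #> y) [^]\<^bsub>G Mod I\<^esub> c"
    using coset_map_eq_one_iff [OF I z_closed] z(1)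
    by (simp add: y z_closed coset.hom_nat_pow del: mult_FactGroup one_FactGroup)
  ultimately show ?thesis
    using y z_closed by blast
qed

end

lemma mem_inv_limit:
  "x \<in> carrier (inv_limit A p) \<longleftrightarrow> (\<forall>i. x i \<in> carrier (A i)) \<and> (\<forall>i. p i (x (Suc i)) = x i)"
  by (auto simp: inv_limit_def)

lemma mult_inv_limit [simp]: "x \<otimes>\<^bsub>inv_limit A p\<^esub> y = (\<lambda>i. x i \<otimes>\<^bsub>A i\<^esub> y i)"
  and one_inv_limit [simp]: "\<one>\<^bsub>inv_limit A p\<^esub> = (\<lambda>i. \<one>\<^bsub>A i\<^esub>)"
  by (simp_all add: inv_limit_def restrict_UNIV)

lemma pow_inv_limit: "(x [^]\<^bsub>inv_limit A p\<^esub> (n::nat)) i = x i [^]\<^bsub>A i\<^esub> n"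
  by (induction n) auto

lemma abelian_towerD:
  assumes "abelian_tower A p"
  shows "comm_group (A i)" "group (A i)" "p i \<in> hom (A (Suc i)) (A i)" "group_hom (A (Suc i)) (A i) (p i)"
  using assms by (auto simp: abelian_tower_def comm_group_def group_hom_def group_hom_axioms_def)

lemma comm_group_inv_limit:
  assumes "abelian_tower A p"
  shows "comm_group (inv_limit A p)"
  unfolding inv_limit_def
proof (rule comm_group_subgroup)
  note A = abelian_towerD [OF assms]
  show "comm_group (product_group UNIV A)"
    by (rule comm_group_product_group) (rule A)
  then interpret comm_group "product_group UNIV A" .
  show "subgroup {x \<in> carrier (product_group UNIV A). \<forall>i. p i (x (Suc i)) = x i} (product_group UNIV A)"
  proof (rule subgroupI)
    show "{x \<in> carrier (product_group UNIV A). \<forall>i. p i (x (Suc i)) = x i} \<noteq> {}"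
      using A(4) [THEN group_hom.hom_one]
      by (auto intro!: exI [of _ "\<lambda>i. \<one>\<^bsub>A i\<^esub>"] group.is_monoid A(2) monoid.one_closed)
  qed (use A(4) [THEN group_hom.hom_inv] A(4) [THEN group_hom.hom_mult] A(2) in
      \<open>auto simp: restrict_UNIV PiE_iff group.is_monoid monoid.m_closed\<close>)
qed

lemma proj_inv_limit_hom:
  "abelian_tower A p \<Longrightarrow> group_hom (inv_limit A p) (A i) (\<lambda>x. x i)"
  using comm_group_inv_limit [of A p] abelian_towerD(2) [of A p i]
  by (auto simp: group_hom_def group_hom_axioms_def comm_group_def hom_def mem_inv_limit)

lemma inv_limit_one_below:
  assumes "abelian_tower A p" "x \<in> carrier (inv_limit A p)" "x k = \<one>\<^bsub>A k\<^esub>" "i \<le> k"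
  shows "x i = \<one>\<^bsub>A i\<^esub>"
  using assms(4)
proof (induction rule: inc_induct)
  case (step n)
  have "x n = p n (x (Suc n))"
    using assms(2) by (simp add: mem_inv_limit)
  then show ?case
    using step.IH abelian_towerD(4) [OF assms(1), THEN group_hom.hom_one] by simp
qed (rule assms)

fun partial_series :: "('a, 'b) monoid_scheme \<Rightarrow> (nat \<Rightarrow> nat) \<Rightarrow> (nat \<Rightarrow> 'a) \<Rightarrow> nat \<Rightarrow> nat \<Rightarrow> 'a" where
  "partial_series G e l 0 k = \<one>\<^bsub>G\<^esub>"
| "partial_series G e l (Suc d) k = l k \<otimes>\<^bsub>G\<^esub> partial_series G e l d (Suc k) [^]\<^bsub>G\<^esub> e k"

lemma (in monoid) partial_series_closed:
  "(\<And>k. l k \<in> carrier G) \<Longrightarrow> partial_series G e l d k \<in> carrier G"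
  by (induction d arbitrary: k) auto

lemma partial_series_stable:
  assumes Y: "abelian_tower Y q" and l: "\<And>k. l k \<in> carrier (inv_limit Y q)" "\<And>k. l k k = \<one>\<^bsub>Y k\<^esub>"
    and "i \<le> k + d"
  shows "partial_series (inv_limit Y q) e l (Suc d) k i = partial_series (inv_limit Y q) e l d k i"
  using assms(4)
proof (induction d arbitrary: k)
  case 0
  interpret group "Y i" by (rule abelian_towerD [OF Y])
  show ?case
    using 0 inv_limit_one_below [OF Y l, of i k] by (simp add: pow_inv_limit)
next
  case (Suc d)
  then show ?case
    by (subst (1 2) partial_series.simps(2)) (simp add: pow_inv_limit del: partial_series.simps)
qed

lemma inv_limit_series:
  assumes Y: "abelian_tower Y q" and l: "\<And>k. l k \<in> carrier (inv_limit Y q)" "\<And>k. l k k = \<one>\<^bsub>Y k\<^esub>"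
  obtains s where "\<And>k. s k \<in> carrier (inv_limit Y q)"
    "\<And>k. s k = l k \<otimes>\<^bsub>inv_limit Y q\<^esub> s (Suc k) [^]\<^bsub>inv_limit Y q\<^esub> (e k :: nat)"
proof -
  define L where "L = inv_limit Y q"
  interpret L: comm_group L
    unfolding L_def by (rule comm_group_inv_limit [OF Y])
  note stable = partial_series_stable [OF Y l, folded L_def]
  have closed: "partial_series L e l d k \<in> carrier L" for d k
    using l(1) by (intro L.partial_series_closed) (simp add: L_def)
  define s where "s k i = partial_series L e l i k i" for k i
  have "s k \<in> carrier L" for k
  proof -
    have "s k i \<in> carrier (Y i)" for i
      using closed [of i k] by (simp add: s_def L_def mem_inv_limit)
    moreover have "q i (s k (Suc i)) = s k i" for i
      using closed [of "Suc i" k] stable [of i k i] unfolding s_def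
      by (simp add: L_def mem_inv_limit del: partial_series.simps)
    ultimately show ?thesis
      by (simp add: L_def mem_inv_limit)
  qed
  moreover have "s k = l k \<otimes>\<^bsub>L\<^esub> s (Suc k) [^]\<^bsub>L\<^esub> e k" for k
  proof
    fix i
    have "s k i = partial_series L e l (Suc i) k i"
      using stable [of i k i] by (simp only: s_def le_add2)
    then show "s k i = (l k \<otimes>\<^bsub>L\<^esub> s (Suc k) [^]\<^bsub>L\<^esub> e k) i"
      by (simp add: L_def pow_inv_limit s_def)
  qed
  ultimately show thesis
    using that unfolding L_def by blast
qed

lemma image_inv_limit_solves_tower:
  assumes Y: "abelian_tower Y q" and \<pi>: "group_hom (inv_limit Y q) M \<pi>" and M: "comm_group M"
    and g: "\<And>k. g k \<in> carrier M"
    and l: "\<And>k. l k \<in> carrier (inv_limit Y q)" "\<And>k. l k k = \<one>\<^bsub>Y k\<^esub>"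
    and \<pi>_l: "\<And>k. \<pi> (l k) = g (Suc k) [^]\<^bsub>M\<^esub> (e k :: nat)"
  shows "\<exists>x. (\<forall>k. x k \<in> carrier M) \<and> (\<forall>k. x k = g k \<otimes>\<^bsub>M\<^esub> x (Suc k) [^]\<^bsub>M\<^esub> e k)"
proof -
  interpret M: comm_group M by (rule M)
  interpret \<pi>: group_hom "inv_limit Y q" M \<pi> by (rule \<pi>)
  obtain s where s: "\<And>k. s k \<in> carrier (inv_limit Y q)"
    "\<And>k. s k = l k \<otimes>\<^bsub>inv_limit Y q\<^esub> s (Suc k) [^]\<^bsub>inv_limit Y q\<^esub> e k"
    using inv_limit_series [OF Y l] by metis
  have \<pi>_s: "(g (Suc k) \<otimes>\<^bsub>M\<^esub> \<pi> (s (Suc k))) [^]\<^bsub>M\<^esub> e k = \<pi> (s k)" for k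
  proof -
    have "(g (Suc k) \<otimes>\<^bsub>M\<^esub> \<pi> (s (Suc k))) [^]\<^bsub>M\<^esub> e k = \<pi> (l k) \<otimes>\<^bsub>M\<^esub> \<pi> (s (Suc k)) [^]\<^bsub>M\<^esub> e k"
      unfolding \<pi>_l by (rule M.nat_pow_distrib) (simp_all add: g s(1))
    also have "\<dots> = \<pi> (l k \<otimes>\<^bsub>inv_limit Y q\<^esub> s (Suc k) [^]\<^bsub>inv_limit Y q\<^esub> e k)"
      using \<pi>.hom_mult [OF l(1) \<pi>.G.nat_pow_closed [OF s(1)]] by (simp only: \<pi>.hom_nat_pow [OF s(1)])
    finally show ?thesis
      unfolding s(2) [of k, symmetric] .
  qed
  show ?thesis
    by (rule exI [of _ "\<lambda>k. g k \<otimes>\<^bsub>M\<^esub> \<pi> (s k)"]) (simp add: g s(1) \<pi>_s)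
qed

text \<open>
  Writing groups additively, let \<open>e\<^sub>k g\<^sub>k\<^sub>+\<^sub>1\<close> be the image of some \<open>l\<^sub>k\<close> that vanishes up to level \<open>k\<close>.
  Then \<open>x\<^sub>k = g\<^sub>k + \<pi> (l\<^sub>k + e\<^sub>k l\<^sub>k\<^sub>+\<^sub>1 + e\<^sub>k e\<^sub>k\<^sub>+\<^sub>1 l\<^sub>k\<^sub>+\<^sub>2 + \<dots>)\<close> solves \<open>x\<^sub>k = g\<^sub>k + e\<^sub>k x\<^sub>k\<^sub>+\<^sub>1\<close>.
\<close>

lemma solvable_towers_image_inv_limit:
  assumes Y: "abelian_tower Y q" and \<pi>: "group_hom (inv_limit Y q) M \<pi>" and M: "comm_group M"
    and bounded: "\<And>i. \<exists>c>0. \<forall>m\<in>carrier M. \<exists>l\<in>carrier (inv_limit Y q). l i = \<one>\<^bsub>Y i\<^esub> \<and> \<pi> l = m [^]\<^bsub>M\<^esub> (c::nat)"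
  shows "solvable_towers M"
proof -
  interpret M: comm_group M by (rule M)
  obtain c :: "nat \<Rightarrow> nat" where c: "\<And>i. c i > 0"
    "\<And>i m. m \<in> carrier M \<Longrightarrow> \<exists>l\<in>carrier (inv_limit Y q). l i = \<one>\<^bsub>Y i\<^esub> \<and> \<pi> l = m [^]\<^bsub>M\<^esub> c i"
    using bounded by metis
  define e where "e i = c i * Suc i" for i
  have "\<exists>x. (\<forall>n. x n \<in> carrier M) \<and> (\<forall>n. x n = g n \<otimes>\<^bsub>M\<^esub> x (Suc n) [^]\<^bsub>M\<^esub> e n)"
    if g: "\<And>n. g n \<in> carrier M" for g
  proof -
    have "\<exists>l\<in>carrier (inv_limit Y q). l k = \<one>\<^bsub>Y k\<^esub> \<and> \<pi> l = g (Suc k) [^]\<^bsub>M\<^esub> e k" for k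
    proof -
      have "g (Suc k) [^]\<^bsub>M\<^esub> e k = (g (Suc k) [^]\<^bsub>M\<^esub> Suc k) [^]\<^bsub>M\<^esub> c k"
        unfolding e_def by (subst mult.commute) (rule M.nat_pow_pow [OF g, symmetric])
      then show ?thesis
        using c(2) [OF M.nat_pow_closed [OF g]] by metis
    qed
    then obtain l where "\<And>k. l k \<in> carrier (inv_limit Y q)" "\<And>k. l k k = \<one>\<^bsub>Y k\<^esub>"
      "\<And>k. \<pi> (l k) = g (Suc k) [^]\<^bsub>M\<^esub> e k"
      by metis
    then show ?thesis
      by (intro image_inv_limit_solves_tower [OF Y \<pi> M g])
  qed
  moreover have "0 < e n" "Suc n dvd e n" for n
    using c(1) by (auto simp: e_def simp del: mult_Suc_right)
  ultimately show ?thesis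
    unfolding solvable_towers_def by blast
qed

theorem cotorsion_group_cokernel_inv_limit:
  assumes Y: "abelian_tower Y q" and X: "group X" and h: "h \<in> hom X (inv_limit Y q)"
    and bounded: "\<And>i. \<exists>c>0. \<forall>y\<in>carrier (inv_limit Y q). y i [^]\<^bsub>Y i\<^esub> (c::nat) \<in> (\<lambda>x. h x i) ` carrier X"
  shows "cotorsion_group (cokernel X (inv_limit Y q) h)"
proof -
  define L where "L = inv_limit Y q"
  define I where "I = h ` carrier X"
  interpret L: comm_group L
    unfolding L_def by (rule comm_group_inv_limit [OF Y])
  interpret h: group_hom X L h
    using X h by (simp add: group_hom_def group_hom_axioms_def L_def L.group_axioms [unfolded L_def])
  have I: "subgroup I L"
    unfolding I_def by (rule h.img_is_subgroup)
  have quotient: "comm_group (L Mod I)"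
    by (rule L.abelian_FactGroup [OF I])
  have "solvable_towers (L Mod I)"
  proof (rule solvable_towers_image_inv_limit [OF Y L.coset_map_hom [OF I, unfolded L_def], folded L_def, OF quotient])
    fix i
    obtain c :: nat where c: "c > 0" "\<forall>y\<in>carrier L. y i [^]\<^bsub>Y i\<^esub> c \<in> (\<lambda>x. h x i) ` carrier X"
      using bounded [of i] unfolding L_def by (elim exE conjE)
    have "\<exists>l\<in>carrier L. l i = \<one>\<^bsub>Y i\<^esub> \<and> I #>\<^bsub>L\<^esub> l = (I #>\<^bsub>L\<^esub> y) [^]\<^bsub>L Mod I\<^esub> c" if "y \<in> carrier L" for y
      using that bspec [OF c(2) that] by (intro L.coset_pow_representative_in_kernel
          [OF I proj_inv_limit_hom [OF Y, folded L_def]]) (auto simp: I_def)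
    then show "\<exists>c>0. \<forall>m\<in>carrier (L Mod I). \<exists>l\<in>carrier L. l i = \<one>\<^bsub>Y i\<^esub> \<and> I #>\<^bsub>L\<^esub> l = m [^]\<^bsub>L Mod I\<^esub> (c::nat)"
      using c(1) unfolding L.coset_map_surj [symmetric] by blast
  qed
  then have "cotorsion_group (L Mod I)"
    by (rule cotorsion_group_if_solvable_towers [OF quotient])
  then show ?thesis
    by (simp add: cokernel_def I_def L_def)
qed

section \<open>Simplices with a constant coordinate\<close>

abbreviation tuple_chains :: "nat \<Rightarrow> 'v chain set" where
  "tuple_chains n \<equiv> supported_on {vs. length vs = n}"

definition cone :: "'v \<Rightarrow> 'v chain \<Rightarrow> 'v chain" where
  "cone v = frag_extend (\<lambda>vs. frag_of (v # vs))"

lemma cone_of [simp]: "cone v (frag_of vs) = frag_of (v # vs)"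
  and cone_0 [simp]: "cone v 0 = 0"
  and cone_diff: "cone v (a - b) = cone v a - cone v b"
  and cone_add: "cone v (a + b) = cone v a + cone v b"
  by (simp_all add: cone_def frag_extend_diff frag_extend_add)

lemma cone_supported_on: "c \<in> supported_on A \<Longrightarrow> (\<And>vs. vs \<in> A \<Longrightarrow> v # vs \<in> B) \<Longrightarrow> cone v c \<in> supported_on B"
  unfolding cone_def by (rule frag_extend_supported_on) auto

lemma bar_map_cone: "bar_map f (cone v c) = cone (f v) (bar_map f c)"
  by (induction c rule: frag_induct) (auto simp: bar_map_diff cone_diff)

subsection \<open>The simplicial boundary\<close>

fun face_sum :: "'v list \<Rightarrow> 'v chain" where
  "face_sum [] = 0"
| "face_sum (v # vs) = frag_of vs - cone v (face_sum vs)"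

definition simplicial_boundary :: "'v chain \<Rightarrow> 'v chain" where
  "simplicial_boundary = frag_extend face_sum"

abbreviation bdy :: "'v chain \<Rightarrow> 'v chain" where
  "bdy \<equiv> simplicial_boundary"

lemma bdy_of [simp]: "bdy (frag_of vs) = face_sum vs"
  and bdy_0 [simp]: "bdy 0 = 0"
  and bdy_diff: "bdy (a - b) = bdy a - bdy b"
  and bdy_uminus: "bdy (- a) = - bdy a"
  and bdy_add: "bdy (a + b) = bdy a + bdy b"
  by (simp_all add: simplicial_boundary_def frag_extend_diff frag_extend_minus frag_extend_add)

lemma bdy_sum: "bdy (sum f I) = (\<Sum>i\<in>I. bdy (f i))"
  by (induction I rule: infinite_finite_induct) (auto simp: bdy_add)

lemma bdy_cone: "bdy (cone v c) = c - cone v (bdy c)"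
  by (induction c rule: frag_induct) (auto simp: bdy_diff cone_diff)

lemma bdy_face_sum: "bdy (face_sum vs) = 0"
  by (induction vs) (auto simp: bdy_diff bdy_cone)

lemma bdy_bdy: "bdy (bdy c) = 0"
  by (induction c rule: frag_induct) (auto simp: bdy_diff bdy_face_sum)

lemma bar_map_face_sum: "bar_map f (face_sum vs) = face_sum (map f vs)"
  by (induction vs) (auto simp: bar_map_diff bar_map_cone)

lemma bdy_bar_map: "bdy (bar_map f c) = bar_map f (bdy c)"
  by (induction c rule: frag_induct) (auto simp: bar_map_diff bdy_diff bar_map_face_sum)

lemma face_sum_supported_on:
  "face_sum vs \<in> supported_on {ws. length vs = Suc (length ws) \<and> set ws \<subseteq> set vs}"
proof (induction vs)
  case (Cons v vs)
  have "cone v (face_sum vs) \<in> supported_on {ws. length (v # vs) = Suc (length ws) \<and> set ws \<subseteq> set (v # vs)}"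
    by (rule cone_supported_on [OF Cons.IH]) auto
  then show ?case
    by (simp add: add_subgroup_diff [OF add_subgroup_supported_on] subset_insertI)
qed (simp add: add_subgroup_zero [OF add_subgroup_supported_on])

lemma supp_face_sum:
  assumes "ws \<in> supp (face_sum vs)"
  shows "length vs = Suc (length ws)" "set ws \<subseteq> set vs"
  using supported_onD [OF face_sum_supported_on assms] by auto

lemma bdy_supported_on:
  assumes "c \<in> supported_on A"
    and "\<And>vs ws. vs \<in> A \<Longrightarrow> length vs = Suc (length ws) \<Longrightarrow> set ws \<subseteq> set vs \<Longrightarrow> ws \<in> B"
  shows "bdy c \<in> supported_on B"
  unfolding simplicial_boundary_def using assms(1)
proof (rule frag_extend_supported_on)
  fix vs assume "vs \<in> A"
  then show "face_sum vs \<in> supported_on B"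
    using assms(2) by (intro supported_on_weaken [OF face_sum_supported_on]) auto
qed

lemma bdy_tuple_chains: "c \<in> tuple_chains (Suc n) \<Longrightarrow> bdy c \<in> tuple_chains n"
  by (rule bdy_supported_on) auto

subsection \<open>The prism operator\<close>

fun prism_simplex :: "('v \<Rightarrow> 'v) \<Rightarrow> 'v list \<Rightarrow> 'v chain" where
  "prism_simplex f [] = 0"
| "prism_simplex f (v # vs) = frag_of (v # f v # map f vs) - cone v (prism_simplex f vs)"

definition prism :: "('v \<Rightarrow> 'v) \<Rightarrow> 'v chain \<Rightarrow> 'v chain" where
  "prism f = frag_extend (prism_simplex f)"

lemma prism_of [simp]: "prism f (frag_of vs) = prism_simplex f vs"
  and prism_0 [simp]: "prism f 0 = 0"
  and prism_diff: "prism f (a - b) = prism f a - prism f b"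
  by (simp_all add: prism_def frag_extend_diff)

lemma prism_cone: "prism f (cone v c) = cone v (cone (f v) (bar_map f c)) - cone v (prism f c)"
  by (induction c rule: frag_induct) (auto simp: prism_diff cone_diff bar_map_diff)

lemma prism_homotopy_simplex:
  "bdy (prism_simplex f vs) + prism f (face_sum vs) = frag_of (map f vs) - frag_of vs"
proof (induction vs)
  case (Cons v vs)
  have "bdy (prism_simplex f vs) = frag_of (map f vs) - frag_of vs - prism f (face_sum vs)"
    using Cons.IH by (simp add: algebra_simps)
  then show ?case
    by (simp add: bdy_diff bdy_cone prism_diff prism_cone cone_diff bar_map_face_sum)
qed simp

lemma prism_homotopy: "bdy (prism f c) + prism f (bdy c) = bar_map f c - c"
proof (induction c rule: frag_induct)
  case (diff a b)
  have "bdy (prism f (a - b)) + prism f (bdy (a - b)) =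
      (bdy (prism f a) + prism f (bdy a)) - (bdy (prism f b) + prism f (bdy b))"
    by (simp add: prism_diff bdy_diff)
  then show ?case
    unfolding diff by (simp add: bar_map_diff)
qed (auto simp: prism_homotopy_simplex)

lemma prism_simplex_supported_on:
  "prism_simplex f vs \<in> supported_on {ws. length ws = Suc (length vs) \<and> set ws \<subseteq> set vs \<union> f ` set vs}"
proof (induction vs)
  case (Cons v vs)
  have "cone v (prism_simplex f vs) \<in>
      supported_on {ws. length ws = Suc (length (v # vs)) \<and> set ws \<subseteq> set (v # vs) \<union> f ` set (v # vs)}"
    by (rule cone_supported_on [OF Cons.IH]) auto
  then show ?case
    unfolding prism_simplex.simps by (intro add_subgroup_diff [OF add_subgroup_supported_on]) auto
qed (simp add: add_subgroup_zero [OF add_subgroup_supported_on])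

lemma prism_supported_on:
  assumes "c \<in> supported_on A"
    and "\<And>vs ws. vs \<in> A \<Longrightarrow> length ws = Suc (length vs) \<Longrightarrow> set ws \<subseteq> set vs \<union> f ` set vs \<Longrightarrow> ws \<in> B"
  shows "prism f c \<in> supported_on B"
  unfolding prism_def using assms(1)
proof (rule frag_extend_supported_on)
  fix vs assume "vs \<in> A"
  then show "prism_simplex f vs \<in> supported_on B"
    using assms(2) by (intro supported_on_weaken [OF prism_simplex_supported_on]) auto
qed

lemma prism_tuple_chains: "c \<in> tuple_chains n \<Longrightarrow> prism f c \<in> tuple_chains (Suc n)"
  by (rule prism_supported_on) auto

subsection \<open>Degenerate chains\<close>

definition constant_coord :: "nat \<Rightarrow> (nat \<Rightarrow> 'v) list \<Rightarrow> bool" where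
  "constant_coord j vs \<longleftrightarrow> (\<exists>a. \<forall>v\<in>set vs. v j = a)"

definition degenerate :: "nat \<Rightarrow> (nat \<Rightarrow> 'v) chain set" where
  "degenerate k = supported_on {vs. \<exists>j<k. constant_coord j vs}"

lemma add_subgroup_degenerate: "add_subgroup (degenerate k)"
  unfolding degenerate_def by (rule add_subgroup_supported_on)

lemma degenerate_Suc: "c \<in> degenerate k \<Longrightarrow> c \<in> degenerate (Suc k)"
  unfolding degenerate_def by (erule supported_on_weaken) (use less_SucI in blast)

lemma constant_coord_mono: "constant_coord j vs \<Longrightarrow> set ws \<subseteq> set vs \<Longrightarrow> constant_coord j ws"
  by (auto simp: constant_coord_def)

lemma constant_coordE:
  assumes "constant_coord j vs"
  obtains a where "\<And>v. v \<in> set vs \<Longrightarrow> v j = a"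
  using assms by (auto simp: constant_coord_def)

lemma bdy_degenerate: "c \<in> degenerate k \<Longrightarrow> bdy c \<in> degenerate k"
  unfolding degenerate_def by (rule bdy_supported_on) (auto intro: constant_coord_mono)

lemma tuple_chains_degenerate:
  assumes "c \<in> tuple_chains n" "n \<le> 1" "0 < k"
  shows "c \<in> degenerate k"
proof -
  have "\<exists>j<k. constant_coord j vs" if "length vs = n" for vs :: "(nat \<Rightarrow> 'a) list"
    using that assms(2,3) by (cases vs) (auto simp: constant_coord_def)
  then show ?thesis
    unfolding degenerate_def by (intro supported_on_weaken [OF assms(1)]) simp
qed

lemma bar_map_degenerate:
  assumes "c \<in> degenerate k" "\<And>j v w. j < k \<Longrightarrow> v j = w j \<Longrightarrow> f v j = f w j"
  shows "bar_map f c \<in> degenerate k"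
  unfolding degenerate_def
proof (rule bar_map_supported_on [OF assms(1) [unfolded degenerate_def]])
  fix vs :: "(nat \<Rightarrow> 'a) list" assume "vs \<in> {vs. \<exists>j<k. constant_coord j vs}"
  then obtain j where j: "j < k" "constant_coord j vs"
    by auto
  have "constant_coord j (map f vs)"
  proof (cases vs)
    case (Cons w ws)
    then have "f v j = f w j" if "v \<in> set vs" for v
      using that j(2) by (intro assms(2) j(1)) (auto elim!: constant_coordE)
    then show ?thesis by (auto simp: constant_coord_def)
  qed (simp add: constant_coord_def)
  then show "map f vs \<in> {vs. \<exists>j<k. constant_coord j vs}"
    using j(1) by auto
qed

lemma prism_degenerate:
  assumes "c \<in> degenerate k" "\<And>j v. j < k \<Longrightarrow> f v j = v j"
  shows "prism f c \<in> degenerate k"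
  unfolding degenerate_def
proof (rule prism_supported_on [OF assms(1) [unfolded degenerate_def]])
  fix vs ws assume "vs \<in> {vs. \<exists>j<k. constant_coord j vs}" and ws: "set ws \<subseteq> set vs \<union> f ` set vs"
  then obtain j a where j: "j < k" "\<forall>v\<in>set vs. v j = a"
    by (auto simp: constant_coord_def)
  have "v j = a" if "v \<in> set ws" for v
    using that ws j(2) assms(2) [OF j(1)] by auto
  then show "ws \<in> {vs. \<exists>j<k. constant_coord j vs}"
    using j(1) unfolding constant_coord_def by blast
qed

lemma bar_map_fun_upd_degenerate: "bar_map (\<lambda>v. v(k := a)) c \<in> degenerate (Suc k)"
  unfolding degenerate_def
  by (rule bar_map_supported_on [OF supported_on_supp]) (auto simp: constant_coord_def)

subsection \<open>Acyclicity modulo degenerate chains\<close>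

definition chain_filter :: "('i \<Rightarrow> bool) \<Rightarrow> ('i \<Rightarrow>\<^sub>0 int) \<Rightarrow> 'i \<Rightarrow>\<^sub>0 int" where
  "chain_filter P = frag_extend (\<lambda>x. if P x then frag_of x else 0)"

lemma chain_filter_of: "chain_filter P (frag_of x) = (if P x then frag_of x else 0)"
  and chain_filter_0 [simp]: "chain_filter P 0 = 0"
  and chain_filter_diff: "chain_filter P (c - d) = chain_filter P c - chain_filter P d"
  by (simp_all add: chain_filter_def frag_extend_diff)

lemma chain_filter_supported_on: "c \<in> supported_on A \<Longrightarrow> chain_filter P c \<in> supported_on {x \<in> A. P x}"
  unfolding chain_filter_def
  by (rule frag_extend_supported_on) (auto simp: add_subgroup_zero [OF add_subgroup_supported_on])

lemma chain_filter_degenerate: "c \<in> degenerate k \<Longrightarrow> chain_filter P c \<in> degenerate k"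
  unfolding degenerate_def
  by (rule supported_on_weaken [OF chain_filter_supported_on]) auto

lemma chain_filter_cong:
  assumes "c \<in> supported_on A" "\<And>x. x \<in> A \<Longrightarrow> P x \<longleftrightarrow> Q"
  shows "chain_filter P c = (if Q then c else 0)"
  using assms by (induction rule: supported_on_induct) (auto simp: chain_filter_of chain_filter_diff)

lemma sum_chain_filter_fibres:
  assumes "finite I" "\<And>x. x \<in> supp c \<Longrightarrow> g x \<in> I"
  shows "(\<Sum>a\<in>I. chain_filter (\<lambda>x. g x = a) c) = c"
  by (induction c rule: frag_induct)
    (use assms in \<open>auto simp: chain_filter_of chain_filter_diff sum_subtractf\<close>)

lemma bdy_chain_filter_fibre:
  assumes "r \<in> supported_on {vs. length vs = Suc (Suc m) \<and> constant_coord k vs}"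
  shows "bdy (chain_filter (\<lambda>vs. hd vs k = a) r) = chain_filter (\<lambda>vs. hd vs k = a) (bdy r)"
  using assms
proof (induction rule: supported_on_induct)
  case (one vs)
  have "hd ws k = a \<longleftrightarrow> hd vs k = a" if "ws \<in> {ws. length vs = Suc (length ws) \<and> set ws \<subseteq> set vs}" for ws
  proof -
    have "ws \<noteq> []" "vs \<noteq> []" "set ws \<subseteq> set vs"
      using one that by auto
    then have "hd ws \<in> set vs" "hd vs \<in> set vs" by auto
    then show ?thesis
      using one by (auto elim!: constant_coordE)
  qed
  then show ?case
    using chain_filter_cong [OF face_sum_supported_on, of vs "\<lambda>ws. hd ws k = a" "hd vs k = a"]
    by (simp add: chain_filter_of)
qed (simp_all add: bdy_diff chain_filter_diff)

definition fillable :: "nat \<Rightarrow> nat \<Rightarrow> (nat \<Rightarrow> 'v) chain \<Rightarrow> bool" where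
  "fillable k n z \<longleftrightarrow> (\<exists>w\<in>tuple_chains (Suc (Suc n)). z - bdy w \<in> degenerate k)"

lemma fillable_fibre:
  assumes "r \<in> supported_on {vs. length vs = Suc m \<and> (\<forall>v\<in>set vs. v k = a)}" "fillable k m r"
  shows "\<exists>s\<in>tuple_chains (Suc (Suc m)) \<inter> degenerate (Suc k). r - bdy s \<in> degenerate k"
proof -
  obtain w where w: "w \<in> tuple_chains (Suc (Suc m))" "r - bdy w \<in> degenerate k"
    using assms(2) by (auto simp: fillable_def)
  define s where "s = bar_map (\<lambda>v. v(k := a)) w"
  have "map (\<lambda>v. v(k := a)) vs = vs" if "vs \<in> supp r" for vs
    using supported_onD [OF assms(1) that] by (auto intro!: map_idI)
  then have "bar_map (\<lambda>v. v(k := a)) r = r"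
    by (rule bar_map_ident)
  then have "r - bdy s = bar_map (\<lambda>v. v(k := a)) (r - bdy w)"
    by (simp add: s_def bar_map_diff bdy_bar_map)
  also have "\<dots> \<in> degenerate k"
    by (rule bar_map_degenerate [OF w(2)]) auto
  finally have "r - bdy s \<in> degenerate k" .
  moreover have "s \<in> tuple_chains (Suc (Suc m)) \<inter> degenerate (Suc k)"
    unfolding s_def by (intro IntI bar_map_fun_upd_degenerate bar_map_supported_on [OF w(1)]) simp
  ultimately show ?thesis by blast
qed

lemma fillable_constant_coord:
  fixes r :: "(nat \<Rightarrow> 'v) chain"
  assumes fill: "\<And>z :: (nat \<Rightarrow> 'v) chain. z \<in> tuple_chains (Suc m) \<Longrightarrow> bdy z \<in> degenerate k \<Longrightarrow> fillable k m z"
    and r: "r \<in> supported_on {vs. length vs = Suc m \<and> constant_coord k vs}" "bdy r \<in> degenerate k" and k: "0 < k"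
  obtains s where "s \<in> tuple_chains (Suc (Suc m))" "s \<in> degenerate (Suc k)" "r - bdy s \<in> degenerate k"
proof -
  define fibre where "fibre a = chain_filter (\<lambda>vs. hd vs k = a) r" for a
  define I where "I = (\<lambda>vs. hd vs k) ` supp r"
  have "finite I" and r_sum: "(\<Sum>a\<in>I. fibre a) = r"
    unfolding fibre_def I_def by (auto intro: sum_chain_filter_fibres)
  have "\<exists>s\<in>tuple_chains (Suc (Suc m)) \<inter> degenerate (Suc k). fibre a - bdy s \<in> degenerate k" for a
  proof (rule fillable_fibre)
    show fibre: "fibre a \<in> supported_on {vs. length vs = Suc m \<and> (\<forall>v\<in>set vs. v k = a)}"
      unfolding fibre_def
      by (rule supported_on_weaken [OF chain_filter_supported_on [OF r(1)]]) (auto simp: constant_coord_def length_Suc_conv)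
    have tuple: "fibre a \<in> tuple_chains (Suc m)"
      by (rule supported_on_weaken [OF fibre]) auto
    have "bdy (fibre a) \<in> degenerate k"
    proof (cases m)
      case 0
      then show ?thesis
        using tuple_chains_degenerate [OF bdy_tuple_chains [OF tuple]] k by simp
    next
      case (Suc m')
      then show ?thesis
        using r bdy_chain_filter_fibre [of r m' k a] by (simp add: fibre_def chain_filter_degenerate)
    qed
    then show "fillable k m (fibre a)"
      by (rule fill [OF tuple])
  qed
  then obtain s where s: "\<And>a. s a \<in> tuple_chains (Suc (Suc m))" "\<And>a. s a \<in> degenerate (Suc k)"
    "\<And>a. fibre a - bdy (s a) \<in> degenerate k"
    by (metis IntE)
  show thesis
  proof (rule that [of "sum s I"])
    have "r - bdy (sum s I) = (\<Sum>a\<in>I. fibre a - bdy (s a))"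
      by (simp add: bdy_sum sum_subtractf r_sum)
    then show "r - bdy (sum s I) \<in> degenerate k"
      by (simp add: add_subgroup_sum [OF add_subgroup_degenerate] s(3))
  qed (auto intro: add_subgroup_sum add_subgroup_supported_on add_subgroup_degenerate s(1,2))
qed

lemma fillable_Suc:
  assumes "z \<in> tuple_chains (Suc n)" "bdy z \<in> degenerate k"
  shows "fillable (Suc k) n z"
proof -
  define f where "f = (\<lambda>v :: nat \<Rightarrow> 'a. v(k := undefined))"
  have "prism f (bdy z) \<in> degenerate k"
    by (rule prism_degenerate [OF assms(2)]) (simp add: f_def)
  moreover have "z - bdy (- prism f z) = bar_map f z - prism f (bdy z)"
    using prism_homotopy [of f z] by (simp add: bdy_uminus algebra_simps)
  ultimately have "z - bdy (- prism f z) \<in> degenerate (Suc k)"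
    using bar_map_fun_upd_degenerate [of k undefined z]
    by (simp add: f_def add_subgroup_diff [OF add_subgroup_degenerate] degenerate_Suc)
  moreover have "- prism f z \<in> tuple_chains (Suc (Suc n))"
    by (intro add_subgroup_uminus add_subgroup_supported_on prism_tuple_chains assms(1))
  ultimately show ?thesis
    unfolding fillable_def by blast
qed

lemma degenerate_boundary_correction:
  fixes z :: "(nat \<Rightarrow> 'v) chain"
  assumes fill: "\<And>z :: (nat \<Rightarrow> 'v) chain. z \<in> tuple_chains (Suc m) \<Longrightarrow> bdy z \<in> degenerate k \<Longrightarrow> fillable k m z"
    and z: "z \<in> tuple_chains (Suc (Suc m))" "bdy z \<in> degenerate (Suc k)" and k: "0 < k"
  obtains s where "s \<in> tuple_chains (Suc (Suc m))" "s \<in> degenerate (Suc k)" "bdy (z - s) \<in> degenerate k"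
proof -
  have "supp (bdy z) \<subseteq> {vs. \<exists>j<k. constant_coord j vs} \<union> {vs. length vs = Suc m \<and> constant_coord k vs}"
    using z(2) bdy_tuple_chains [OF z(1)] by (auto simp: degenerate_def supported_on_def less_Suc_eq)
  then obtain r' r where r': "r' \<in> degenerate k"
    and r: "r \<in> supported_on {vs. length vs = Suc m \<and> constant_coord k vs}" and sum: "r' + r = bdy z"
    unfolding degenerate_def supported_on_def by (elim frag_split) auto
  have "bdy r = - bdy r'"
    using bdy_bdy [of z] unfolding sum [symmetric] bdy_add by (simp add: eq_neg_iff_add_eq_0 add.commute)
  then have "bdy r \<in> degenerate k"
    using bdy_degenerate [OF r'] add_subgroup_uminus [OF add_subgroup_degenerate] by simp
  then obtain s where s: "s \<in> tuple_chains (Suc (Suc m))" "s \<in> degenerate (Suc k)" "r - bdy s \<in> degenerate k"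
    using fillable_constant_coord [OF fill r _ k] by blast
  have "bdy (z - s) = r' + (r - bdy s)"
    by (simp add: bdy_diff sum [symmetric])
  then have "bdy (z - s) \<in> degenerate k"
    using add_subgroup_add [OF add_subgroup_degenerate r' s(3)] by simp
  then show thesis
    by (rule that [OF s(1,2)])
qed

text \<open>
  The tuples of vertices of \<open>V\<^sup>k\<close> modulo those with a constant coordinate form the \<open>k\<close>-fold
  levelwise tensor power of a complex that starts in degree 1, hence are acyclic below degree \<open>k\<close>.
\<close>

theorem degenerate_acyclic:
  assumes "z \<in> tuple_chains (Suc n)" "bdy z \<in> degenerate k" "n < k"
  shows "fillable k n z"
  using assms
proof (induction k arbitrary: z n)
  case (Suc k)
  show ?case
  proof (cases n)
    case 0
    then have "z - bdy 0 \<in> degenerate (Suc k)"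
      using tuple_chains_degenerate [OF Suc.prems(1)] by simp
    then show ?thesis
      unfolding fillable_def using add_subgroup_zero [OF add_subgroup_supported_on] by blast
  next
    case (Suc m)
    then have z: "z \<in> tuple_chains (Suc (Suc m))" "m < k" "0 < k"
      using Suc.prems(1,3) by auto
    obtain s where s: "s \<in> tuple_chains (Suc (Suc m))" "s \<in> degenerate (Suc k)" "bdy (z - s) \<in> degenerate k"
      using degenerate_boundary_correction [OF Suc.IH [OF _ _ z(2)] z(1) Suc.prems(2) z(3)] by blast
    obtain w where w: "w \<in> tuple_chains (Suc (Suc n))" "(z - s) - bdy w \<in> degenerate (Suc k)"
      using fillable_Suc [OF add_subgroup_diff [OF add_subgroup_supported_on z(1) s(1)] s(3)]
      unfolding fillable_def Suc by blast
    have "z - bdy w = ((z - s) - bdy w) + s"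
      by simp
    then have "z - bdy w \<in> degenerate (Suc k)"
      using add_subgroup_add [OF add_subgroup_degenerate w(2) s(2)] by simp
    then show ?thesis
      using w(1) unfolding fillable_def by blast
  qed
qed simp

subsection \<open>Contracting the diagonal\<close>

definition vertex :: "'v list \<Rightarrow> nat \<Rightarrow> 'v" where
  "vertex u i = u ! min i (length u - 1)"

lemma vertex_index: "u \<noteq> [] \<Longrightarrow> min i (length u - 1) < length u"
  by (cases u) auto

lemma vertex_map: "u \<noteq> [] \<Longrightarrow> vertex (map f u) i = f (vertex u i)"
  using nth_map [OF vertex_index] by (simp add: vertex_def)

lemma vertex_in_set: "u \<noteq> [] \<Longrightarrow> vertex u i \<in> set u"
  using nth_mem [OF vertex_index] by (simp add: vertex_def)

lemma map_vertex_upt: "map (vertex u) [0..<length u] = u"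
  by (rule nth_equalityI) (auto simp: vertex_def min_def intro!: arg_cong [of _ _ "(!) u"])

text \<open>
  A sequence of chains on \<open>\<nat>\<^sup>k\<close> induces an operator that is natural in the simplex \<open>u\<close>. Indices beyond
  the end of \<open>u\<close> refer to its last vertex, so that no bound on the entries is needed.
\<close>

definition transport :: "(nat \<Rightarrow> (nat \<Rightarrow> nat) chain) \<Rightarrow> 'v list \<Rightarrow> (nat \<Rightarrow> 'v) chain" where
  "transport H u = (if u = [] then 0 else bar_map (\<lambda>v j. vertex u (v j)) (H (length u - 1)))"

definition diagonal :: "'v list \<Rightarrow> (nat \<Rightarrow> 'v) list" where
  "diagonal u = map (\<lambda>x j. x) u"

definition contraction_defect :: "(nat \<Rightarrow> (nat \<Rightarrow> nat) chain) \<Rightarrow> 'v list \<Rightarrow> (nat \<Rightarrow> 'v) chain" where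
  "contraction_defect H u =
     bdy (transport H u) + frag_extend (transport H) (face_sum u) - frag_of (diagonal u)"

lemma transport_map: "transport H (map f u) = bar_map (\<lambda>v j. f (v j)) (transport H u)"
  by (simp add: transport_def bar_map_bar_map vertex_map)

lemma transport_tuple_chains:
  assumes "H m \<in> tuple_chains l" "length u = Suc m"
  shows "transport H u \<in> tuple_chains l"
proof -
  have "bar_map (\<lambda>v j. vertex u (v j)) (H m) \<in> tuple_chains l"
    by (rule bar_map_supported_on [OF assms(1)]) simp
  then show ?thesis
    using assms(2) by (auto simp: transport_def)
qed

lemma frag_extend_transport_map:
  "frag_extend (transport H) (bar_map f c) = bar_map (\<lambda>v j. f (v j)) (frag_extend (transport H) c)"
  by (induction c rule: frag_induct) (auto simp: transport_map frag_extend_diff bar_map_diff)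

lemma contraction_defect_map:
  "contraction_defect H (map f u) = bar_map (\<lambda>v j. f (v j)) (contraction_defect H u)"
proof -
  have "frag_extend (transport H) (face_sum (map f u)) =
      bar_map (\<lambda>v j. f (v j)) (frag_extend (transport H) (face_sum u))"
    by (metis bar_map_face_sum frag_extend_transport_map)
  then show ?thesis
    by (simp add: contraction_defect_def transport_map bdy_bar_map bar_map_add bar_map_diff diagonal_def comp_def)
qed

lemma contraction_defect_transfer:
  assumes "contraction_defect H [0..<Suc m] \<in> degenerate k" "length u = Suc m"
  shows "contraction_defect H u \<in> degenerate k"
proof -
  have "contraction_defect H u = bar_map (\<lambda>v j. vertex u (v j)) (contraction_defect H [0..<Suc m])"
    using contraction_defect_map [of H "vertex u" "[0..<Suc m]"] map_vertex_upt [of u] assms(2) by simp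
  also have "\<dots> \<in> degenerate k"
    by (rule bar_map_degenerate [OF assms(1)]) simp
  finally show ?thesis .
qed

lemma frag_extend_transport_face_sum_cong:
  assumes "\<And>m. Suc m < length u \<Longrightarrow> H m = H' m"
  shows "frag_extend (transport H) (face_sum u) = frag_extend (transport H') (face_sum u)"
proof (rule frag_extend_eq)
  fix ws assume "ws \<in> supp (face_sum u)"
  then show "transport H ws = transport H' ws"
    using assms [of "length ws - 1"] supp_face_sum(1) [of ws u] by (cases ws) (auto simp: transport_def)
qed

lemma contraction_defect_cong:
  assumes "\<And>m. m < length u \<Longrightarrow> H m = H' m"
  shows "contraction_defect H u = contraction_defect H' u"
proof -
  have "transport H u = transport H' u"
    using assms [of "length u - 1"] by (cases u) (auto simp: transport_def)
  then show ?thesis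
    using frag_extend_transport_face_sum_cong [of u H H'] assms by (simp add: contraction_defect_def)
qed

definition partial_contraction :: "nat \<Rightarrow> nat \<Rightarrow> (nat \<Rightarrow> (nat \<Rightarrow> nat) chain) \<Rightarrow> bool" where
  "partial_contraction k M H \<longleftrightarrow>
     (\<forall>m<M. H m \<in> tuple_chains (Suc (Suc m)) \<and> contraction_defect H [0..<Suc m] \<in> degenerate k)"

text \<open>The chain that the contraction of an \<open>M\<close>-simplex has to fill, given that of its faces.\<close>

definition contraction_cycle :: "(nat \<Rightarrow> (nat \<Rightarrow> nat) chain) \<Rightarrow> 'v list \<Rightarrow> (nat \<Rightarrow> 'v) chain" where
  "contraction_cycle H u = frag_of (diagonal u) - frag_extend (transport H) (face_sum u)"

lemma contraction_cycle_map:
  "contraction_cycle H (map f u) = bar_map (\<lambda>v j. f (v j)) (contraction_cycle H u)"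
  by (simp add: contraction_cycle_def bar_map_face_sum [symmetric] frag_extend_transport_map bar_map_diff
      diagonal_def comp_def)

lemma contraction_cycle_tuple_chains:
  assumes H: "partial_contraction k M H" and u: "length u = Suc M"
  shows "contraction_cycle H u \<in> tuple_chains (Suc M)"
proof -
  have "transport H ws \<in> tuple_chains (Suc M)" if "ws \<in> supp (face_sum u)" for ws
  proof (cases M)
    case 0
    then show ?thesis
      using supp_face_sum(1) [OF that] u by (simp add: transport_def add_subgroup_zero [OF add_subgroup_supported_on])
  next
    case (Suc m)
    then have "H m \<in> tuple_chains (Suc M)"
      using H by (simp add: partial_contraction_def)
    then show ?thesis
      by (rule transport_tuple_chains) (use supp_face_sum(1) [OF that] u Suc in simp)
  qed
  then have "frag_extend (transport H) (face_sum u) \<in> tuple_chains (Suc M)"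
    by (rule frag_extend_in_add_subgroup [OF add_subgroup_supported_on])
  then show ?thesis
    unfolding contraction_cycle_def using u
    by (intro add_subgroup_diff [OF add_subgroup_supported_on]) (auto simp: diagonal_def)
qed

lemma frag_extend_contraction_defect:
  "frag_extend (contraction_defect H) c =
     bdy (frag_extend (transport H) c) + frag_extend (transport H) (bdy c) - bar_map (\<lambda>x j. x) c"
  by (induction c rule: frag_induct)
    (auto simp: contraction_defect_def frag_extend_diff bdy_diff bar_map_diff diagonal_def)

lemma bdy_contraction_cycle:
  assumes H: "partial_contraction k M H" and u: "length u = Suc M" and "M < k"
  shows "bdy (contraction_cycle H u) \<in> degenerate k"
proof (cases M)
  case 0
  then show ?thesis
    using \<open>M < k\<close> by (intro tuple_chains_degenerate [OF bdy_tuple_chains [OF contraction_cycle_tuple_chains [OF H u]]]) auto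
next
  case (Suc m)
  then have "contraction_defect H [0..<Suc m] \<in> degenerate k"
    using H by (simp add: partial_contraction_def)
  then have "contraction_defect H ws \<in> degenerate k" if "ws \<in> supp (face_sum u)" for ws
    by (rule contraction_defect_transfer) (use supp_face_sum(1) [OF that] u Suc in simp)
  then have "frag_extend (contraction_defect H) (face_sum u) \<in> degenerate k"
    by (rule frag_extend_in_add_subgroup [OF add_subgroup_degenerate])
  moreover have "bdy (contraction_cycle H u) = - frag_extend (contraction_defect H) (face_sum u)"
    by (simp add: contraction_cycle_def frag_extend_contraction_defect bdy_diff bdy_face_sum bar_map_face_sum diagonal_def)
  ultimately show ?thesis
    using add_subgroup_uminus [OF add_subgroup_degenerate] by simp
qed

lemma partial_contraction_extend:
  assumes H: "partial_contraction k M H" and "M < k"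
  obtains w where "partial_contraction k (Suc M) (H(M := w))"
proof -
  define e where "e = [0..<Suc M]"
  have len: "length e = Suc M" and vertex_e: "map (vertex e) e = e"
    using map_vertex_upt [of e] by (simp_all add: e_def)
  let ?v = "\<lambda>v j. vertex e (v j)"
  obtain w where w: "w \<in> tuple_chains (Suc (Suc M))" "contraction_cycle H e - bdy w \<in> degenerate k"
    using degenerate_acyclic [OF contraction_cycle_tuple_chains [OF H len] bdy_contraction_cycle [OF H len \<open>M < k\<close>] \<open>M < k\<close>]
    by (auto simp: fillable_def)
  define H' where "H' = H(M := w)"
  have "transport H' e = bar_map ?v w"
    using len by (auto simp: transport_def H'_def)
  moreover have "frag_extend (transport H') (face_sum e) = frag_extend (transport H) (face_sum e)"
    by (rule frag_extend_transport_face_sum_cong) (simp add: H'_def len)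
  ultimately have "contraction_defect H' e = bdy (bar_map ?v w) - contraction_cycle H e"
    by (simp add: contraction_defect_def contraction_cycle_def)
  also have "\<dots> = - bar_map ?v (contraction_cycle H e - bdy w)"
    using contraction_cycle_map [of H "vertex e" e] by (simp add: vertex_e bar_map_diff bdy_bar_map)
  also have "\<dots> \<in> degenerate k"
    by (intro add_subgroup_uminus [OF add_subgroup_degenerate] bar_map_degenerate [OF w(2)]) simp
  finally have "contraction_defect H' [0..<Suc M] \<in> degenerate k"
    by (simp add: e_def)
  moreover have "contraction_defect H' [0..<Suc m] = contraction_defect H [0..<Suc m]" if "m < M" for m
    by (rule contraction_defect_cong) (use that in \<open>auto simp: H'_def\<close>)
  ultimately have "partial_contraction k (Suc M) H'"
    using H w(1) by (auto simp: partial_contraction_def H'_def less_Suc_eq)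
  then show thesis
    using that unfolding H'_def by blast
qed

lemma partial_contraction_exists: "M \<le> k \<Longrightarrow> \<exists>H. partial_contraction k M H"
proof (induction M)
  case (Suc M)
  then obtain H where "partial_contraction k M H" by auto
  then show ?case
    using partial_contraction_extend [of k M H] Suc.prems by (metis Suc_le_lessD)
qed (auto simp: partial_contraction_def)

theorem universal_contraction:
  fixes k :: nat
  obtains H where "\<And>m. m < k \<Longrightarrow> H m \<in> tuple_chains (Suc (Suc m))"
    and "\<And>u :: 'v list. u \<noteq> [] \<Longrightarrow> length u \<le> k \<Longrightarrow> contraction_defect H u \<in> degenerate k"
proof -
  obtain H where H: "partial_contraction k k H"
    using partial_contraction_exists by blast
  show thesis
  proof
    show "H m \<in> tuple_chains (Suc (Suc m))" if "m < k" for m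
      using H that by (simp add: partial_contraction_def)
    show "contraction_defect H u \<in> degenerate k" if "u \<noteq> []" "length u \<le> k" for u :: "'v list"
    proof -
      obtain m where m: "length u = Suc m"
        using \<open>u \<noteq> []\<close> by (cases u) auto
      then have "contraction_defect H [0..<Suc m] \<in> degenerate k"
        using H that(2) by (simp add: partial_contraction_def)
      then show ?thesis
        using m by (rule contraction_defect_transfer)
    qed
  qed
qed

section \<open>The bar complex\<close>

abbreviation bar_simplices :: "nat \<Rightarrow> 'a monoid \<Rightarrow> 'a list set" where
  "bar_simplices n G \<equiv> {xs. length xs = n \<and> set xs \<subseteq> carrier G}"

lemma bar_chains_eq: "bar_chains n G = additive_monoid (supported_on (bar_simplices n G))"
  by (simp add: bar_chains_def free_Abelian_group_supported_on)

lemma carrier_bar_chains: "carrier (bar_chains n G) = supported_on (bar_simplices n G)"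
  by (simp add: bar_chains_eq)

lemma add_subgroup_bar_chains: "add_subgroup (carrier (bar_chains n G))"
  unfolding carrier_bar_chains by (rule add_subgroup_supported_on)

lemma bar_boundary_0 [simp]: "bar_boundary n G 0 = 0"
  and bar_boundary_diff: "bar_boundary n G (a - b) = bar_boundary n G a - bar_boundary n G b"
  and bar_boundary_add: "bar_boundary n G (a + b) = bar_boundary n G a + bar_boundary n G b"
  and bar_boundary_cmul: "bar_boundary n G (frag_cmul k a) = frag_cmul k (bar_boundary n G a)"
  by (auto simp: bar_boundary_def frag_extend_diff frag_extend_add frag_extend_cmul)

lemma bar_boundary_sum: "bar_boundary n G (sum f I) = (\<Sum>i\<in>I. bar_boundary n G (f i))"
  by (induction I rule: infinite_finite_induct) (auto simp: bar_boundary_add)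

lemma bar_cycles_eq: "bar_cycles n G = additive_monoid (carrier (bar_cycles n G))"
  by (simp add: bar_cycles_def bar_chains_eq additive_monoid_def)

lemma bar_cycles_carrier:
  "c \<in> carrier (bar_cycles n G) \<longleftrightarrow> c \<in> supported_on (bar_simplices n G) \<and> bar_boundary n G c = 0"
  by (simp add: bar_cycles_def carrier_bar_chains)

lemma bar_cycles_supp:
  assumes "c \<in> carrier (bar_cycles n G)" "xs \<in> supp c"
  shows "length xs = n" "set xs \<subseteq> carrier G"
  using assms(1) supported_onD [of c "bar_simplices n G" xs] assms(2) by (auto simp: bar_cycles_carrier)

lemma add_subgroup_bar_cycles: "add_subgroup (carrier (bar_cycles n G))"
  by (rule add_subgroupI)
    (auto simp: bar_cycles_carrier bar_boundary_diff add_subgroup_supported_on add_subgroup_zero add_subgroup_diff)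

lemma add_subgroup_bar_boundaries: "add_subgroup (bar_boundaries n G)"
proof (rule add_subgroupI)
  show "0 \<in> bar_boundaries n G"
    using add_subgroup_zero [OF add_subgroup_bar_chains] by (force simp: bar_boundaries_def)
  fix x y assume "x \<in> bar_boundaries n G" "y \<in> bar_boundaries n G"
  then obtain c d where "c \<in> carrier (bar_chains (Suc n) G)" "d \<in> carrier (bar_chains (Suc n) G)"
    "x = bar_boundary (Suc n) G c" "y = bar_boundary (Suc n) G d"
    by (auto simp: bar_boundaries_def)
  then show "x - y \<in> bar_boundaries n G"
    unfolding bar_boundaries_def
    by (intro image_eqI [of _ _ "c - d"]) (simp_all add: bar_boundary_diff add_subgroup_diff [OF add_subgroup_bar_chains])
qed

subsection \<open>Homogeneous and inhomogeneous simplices\<close>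

fun edges :: "'a monoid \<Rightarrow> 'a list \<Rightarrow> 'a list" where
  "edges G (x # y # xs) = (inv\<^bsub>G\<^esub> x \<otimes>\<^bsub>G\<^esub> y) # edges G (y # xs)"
| "edges G xs = []"

fun vertices :: "'a monoid \<Rightarrow> 'a list \<Rightarrow> 'a list" where
  "vertices G [] = [\<one>\<^bsub>G\<^esub>]"
| "vertices G (g # gs) = \<one>\<^bsub>G\<^esub> # map (\<lambda>x. g \<otimes>\<^bsub>G\<^esub> x) (vertices G gs)"

definition edge_chain :: "'a monoid \<Rightarrow> 'a chain \<Rightarrow> 'a chain" where
  "edge_chain G = frag_extend (\<lambda>xs. frag_of (edges G xs))"

definition vertex_chain :: "'a monoid \<Rightarrow> 'a chain \<Rightarrow> 'a chain" where
  "vertex_chain G = frag_extend (\<lambda>gs. frag_of (vertices G gs))"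

lemma edge_chain_of [simp]: "edge_chain G (frag_of xs) = frag_of (edges G xs)"
  and edge_chain_0 [simp]: "edge_chain G 0 = 0"
  and edge_chain_diff: "edge_chain G (a - b) = edge_chain G a - edge_chain G b"
  and vertex_chain_of [simp]: "vertex_chain G (frag_of gs) = frag_of (vertices G gs)"
  and vertex_chain_0 [simp]: "vertex_chain G 0 = 0"
  and vertex_chain_diff: "vertex_chain G (a - b) = vertex_chain G a - vertex_chain G b"
  by (simp_all add: edge_chain_def vertex_chain_def frag_extend_diff)

lemma length_edges [simp]: "length (edges G xs) = length xs - 1"
  by (induction G xs rule: edges.induct) auto

lemma length_vertices [simp]: "length (vertices G gs) = Suc (length gs)"
  by (induction gs) auto

lemma vertices_not_Nil [simp]: "vertices G gs \<noteq> []"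
  by (cases gs) auto

lemma face_sum_eq:
  "face_sum xs = (\<Sum>i<length xs. frag_cmul ((-1) ^ i) (frag_of (take i xs @ drop (Suc i) xs)))"
proof (induction xs)
  case (Cons x xs)
  have "cone x (sum f I) = (\<Sum>i\<in>I. cone x (f i))" for f and I :: "nat set"
    by (induction I rule: infinite_finite_induct) (auto simp: cone_add)
  moreover have "cone x (frag_cmul k c) = frag_cmul k (cone x c)" for k c
    by (simp add: cone_def frag_extend_cmul)
  ultimately show ?case
    by (simp add: Cons sum.lessThan_Suc_shift sum_negf [symmetric] del: sum.lessThan_Suc)
qed simp

lemma bar_face_Cons:
  "0 < j \<Longrightarrow> j \<le> length es \<Longrightarrow> bar_face G (Suc j) (e # es) = e # bar_face G j es"
  by (cases j) (auto simp: bar_face_def)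

text \<open>The bar complex is only defined for monoid records without further fields.\<close>

locale bar_group = group G for G :: "'a monoid" (structure)

locale bar_comm_group = comm_group G for G :: "'a monoid" (structure)

sublocale bar_comm_group \<subseteq> bar_group ..

context bar_group
begin

lemma set_edges: "set xs \<subseteq> carrier G \<Longrightarrow> set (edges G xs) \<subseteq> carrier G"
  by (induction xs rule: induct_list012) auto

lemma set_vertices: "set gs \<subseteq> carrier G \<Longrightarrow> set (vertices G gs) \<subseteq> carrier G"
  by (induction gs) auto

lemma edges_translate:
  "a \<in> carrier G \<Longrightarrow> set xs \<subseteq> carrier G \<Longrightarrow> edges G (map (\<lambda>x. a \<otimes> x) xs) = edges G xs"
  by (induction xs rule: induct_list012) (auto simp: inv_mult_group m_assoc, simp add: m_assoc [symmetric])

lemma edges_vertices: "set gs \<subseteq> carrier G \<Longrightarrow> edges G (vertices G gs) = gs"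
proof (induction gs)
  case (Cons g gs)
  obtain ys where ys: "vertices G gs = \<one> # ys" by (cases gs) auto
  then have "set ys \<subseteq> carrier G" using set_vertices [of gs] Cons.prems by auto
  moreover have "edges G (vertices G (g # gs)) = g # edges G (map (\<lambda>x. g \<otimes> x) (vertices G gs))"
    using Cons.prems by (simp add: ys)
  ultimately show ?case
    using Cons edges_translate [of g "vertices G gs"] ys by auto
qed simp

lemma vertices_edges:
  "xs \<noteq> [] \<Longrightarrow> set xs \<subseteq> carrier G \<Longrightarrow> map (\<lambda>x. hd xs \<otimes> x) (vertices G (edges G xs)) = xs"
proof (induction xs rule: induct_list012)
  case (3 x y zs)
  have "map (\<lambda>v. x \<otimes> (inv x \<otimes> y \<otimes> v)) (vertices G (edges G (y # zs))) =
      map (\<lambda>v. y \<otimes> v) (vertices G (edges G (y # zs)))"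
    using 3 set_vertices set_edges [of "y # zs"]
    by (intro map_cong) (auto simp: m_assoc [symmetric] subset_iff)
  also have "\<dots> = y # zs"
    using 3 by simp
  finally show ?case using 3 by (simp add: comp_def)
qed auto

lemma bar_face_edges:
  "set xs \<subseteq> carrier G \<Longrightarrow> i < length xs \<Longrightarrow> 2 \<le> length xs \<Longrightarrow>
   bar_face G i (edges G xs) = edges G (take i xs @ drop (Suc i) xs)"
proof (induction xs arbitrary: i rule: induct_list012)
  case (3 x y zs)
  consider (first) "i = 0" | (second_last) "i = 1" "zs = []" | (second) z zs' where "i = 1" "zs = z # zs'"
    | (later) j where "i = Suc (Suc j)"
    by (metis One_nat_def neq_Nil_conv not0_implies_Suc)
  then show ?case
  proof cases
    case second
    then show ?thesis
      using \<open>set (x # y # zs) \<subseteq> carrier G\<close>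
      by (auto simp: bar_face_def m_assoc inv_solve_left' [symmetric]) (metis inv_closed l_one m_assoc m_closed r_inv)
  next
    case later
    with 3 have "zs \<noteq> []" by auto
    with 3 later have "bar_face G (Suc j) (edges G (y # zs)) = edges G (take (Suc j) (y # zs) @ drop (Suc (Suc j)) (y # zs))"
      by (cases zs) auto
    with 3 later show ?thesis
      by (simp add: bar_face_Cons)
  qed (auto simp: bar_face_def)
qed auto

lemma bar_boundary_edge_chain:
  assumes "c \<in> supported_on (bar_simplices (Suc n) G)" "n \<noteq> 0"
  shows "bar_boundary n G (edge_chain G c) = edge_chain G (bdy c)"
  using assms(1)
proof (induction rule: supported_on_induct)
  case (one xs)
  then have "bar_boundary n G (frag_of (edges G xs)) =
      (\<Sum>i<length xs. frag_cmul ((-1) ^ i) (frag_of (edges G (take i xs @ drop (Suc i) xs))))"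
    using assms(2) by (simp add: bar_boundary_def bar_face_edges lessThan_Suc_atMost)
  then show ?case
    by (simp add: edge_chain_def face_sum_eq frag_extend_sum frag_extend_cmul comp_def)
qed (simp_all add: edge_chain_diff bar_boundary_diff bdy_diff)

lemma edge_chain_supported_on:
  "c \<in> supported_on (bar_simplices (Suc n) G) \<Longrightarrow> edge_chain G c \<in> supported_on (bar_simplices n G)"
  unfolding edge_chain_def by (rule frag_extend_supported_on) (auto dest: subsetD [OF set_edges])

lemma vertex_chain_supported_on:
  "c \<in> supported_on (bar_simplices n G) \<Longrightarrow> vertex_chain G c \<in> supported_on (bar_simplices (Suc n) G)"
  unfolding vertex_chain_def by (rule frag_extend_supported_on) (auto dest: subsetD [OF set_vertices])

lemma edge_chain_vertex_chain: "c \<in> supported_on (bar_simplices n G) \<Longrightarrow> edge_chain G (vertex_chain G c) = c"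
  by (induction rule: supported_on_induct) (simp_all add: edges_vertices edge_chain_diff vertex_chain_diff)

lemma bar_boundary_eq_edge_chain:
  assumes "c \<in> supported_on (bar_simplices n G)" "n \<noteq> 0"
  shows "bar_boundary n G c = edge_chain G (bdy (vertex_chain G c))"
  using bar_boundary_edge_chain [OF vertex_chain_supported_on [OF assms(1)] assms(2)]
  by (simp add: edge_chain_vertex_chain [OF assms(1)])

lemma bdy_bar_simplices:
  "c \<in> supported_on (bar_simplices (Suc n) G) \<Longrightarrow> bdy c \<in> supported_on (bar_simplices n G)"
  by (rule bdy_supported_on) auto

lemma bar_boundary_supported_on:
  assumes "c \<in> supported_on (bar_simplices (Suc n) G)"
  shows "bar_boundary (Suc n) G c \<in> supported_on (bar_simplices n G)"
  unfolding bar_boundary_eq_edge_chain [OF assms nat.simps(3)]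
  by (intro edge_chain_supported_on bdy_bar_simplices vertex_chain_supported_on assms)

lemma bar_boundary_bar_boundary:
  assumes "c \<in> supported_on (bar_simplices (Suc n) G)"
  shows "bar_boundary n G (bar_boundary (Suc n) G c) = 0"
proof (cases "n = 0")
  case False
  then show ?thesis
    unfolding bar_boundary_eq_edge_chain [OF assms nat.simps(3)]
    using bar_boundary_edge_chain [OF bdy_bar_simplices [OF vertex_chain_supported_on [OF assms]]]
    by (simp add: bdy_bdy)
qed (simp add: bar_boundary_def)

lemma bar_boundaries_subset: "bar_boundaries n G \<subseteq> carrier (bar_cycles n G)"
  using bar_boundary_supported_on bar_boundary_bar_boundary
  by (auto simp: bar_boundaries_def bar_cycles_carrier carrier_bar_chains)

end

subsection \<open>Functoriality\<close>

lemma bar_map_bar_chains: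
  assumes "h \<in> hom G H" "c \<in> supported_on (bar_simplices n G)"
  shows "bar_map h c \<in> supported_on (bar_simplices n H)"
  by (rule bar_map_supported_on [OF assms(2)]) (use hom_in_carrier [OF assms(1)] in auto)

lemma bar_face_map:
  assumes "h \<in> hom G H" "set xs \<subseteq> carrier G" "i \<le> length xs"
  shows "bar_face H i (map h xs) = map h (bar_face G i xs)"
proof -
  have "h (xs ! (i - 1) \<otimes>\<^bsub>G\<^esub> xs ! i) = h (xs ! (i - 1)) \<otimes>\<^bsub>H\<^esub> h (xs ! i)" if "i \<noteq> 0" "i \<noteq> length xs"
    using that assms by (intro hom_mult) (auto simp: subset_iff)
  then show ?thesis
    using assms(3) by (auto simp: bar_face_def map_tl map_butlast take_map drop_map)
qed

lemma bar_boundary_bar_map: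
  assumes h: "h \<in> hom G H" and "c \<in> supported_on (bar_simplices n G)"
  shows "bar_boundary n H (bar_map h c) = bar_map h (bar_boundary n G c)"
proof (cases "n = 0")
  case False
  have sum: "bar_map h (sum f I) = (\<Sum>i\<in>I. bar_map h (f i))" for f and I :: "nat set"
    unfolding bar_map_def by (induction I rule: infinite_finite_induct) (auto simp: frag_extend_add)
  have cmul: "bar_map h (frag_cmul k c) = frag_cmul k (bar_map h c)" for k c
    by (simp add: bar_map_def frag_extend_cmul)
  show ?thesis
    using assms(2)
  proof (induction rule: supported_on_induct)
    case (one xs)
    then show ?case
      using False by (simp add: bar_boundary_def sum cmul bar_face_map [OF h])
  qed (simp_all add: bar_boundary_diff bar_map_diff)
qed (simp add: bar_boundary_def)

lemma bar_map_bar_cycles: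
  "h \<in> hom G H \<Longrightarrow> c \<in> carrier (bar_cycles n G) \<Longrightarrow> bar_map h c \<in> carrier (bar_cycles n H)"
  by (simp add: bar_cycles_carrier bar_map_bar_chains bar_boundary_bar_map)

lemma bar_map_bar_boundaries:
  assumes "h \<in> hom G H" "c \<in> bar_boundaries n G"
  shows "bar_map h c \<in> bar_boundaries n H"
proof -
  obtain d where d: "d \<in> supported_on (bar_simplices (Suc n) G)" "c = bar_boundary (Suc n) G d"
    using assms(2) by (auto simp: bar_boundaries_def carrier_bar_chains)
  have "bar_map h c = bar_boundary (Suc n) H (bar_map h d)"
    unfolding d(2) by (rule bar_boundary_bar_map [OF assms(1) d(1), symmetric])
  then show ?thesis
    using bar_map_bar_chains [OF assms(1) d(1)] by (auto simp: bar_boundaries_def carrier_bar_chains)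
qed

subsection \<open>Homology classes\<close>

definition homology_class :: "nat \<Rightarrow> 'a monoid \<Rightarrow> 'a chain \<Rightarrow> 'a chain set" where
  "homology_class n G c = bar_boundaries n G #>\<^bsub>bar_cycles n G\<^esub> c"

lemma homology_class_eq: "homology_class n G c = {b + c | b. b \<in> bar_boundaries n G}"
  unfolding homology_class_def r_coset_def by (subst bar_cycles_eq) auto

context bar_group
begin

lemma comm_group_bar_cycles: "comm_group (bar_cycles n G)"
  by (subst bar_cycles_eq) (rule comm_group_additive_monoid [OF add_subgroup_bar_cycles])

lemma subgroup_bar_boundaries: "subgroup (bar_boundaries n G) (bar_cycles n G)"
  by (subst bar_cycles_eq)
    (rule subgroup_additive_monoid [OF add_subgroup_bar_boundaries add_subgroup_bar_cycles bar_boundaries_subset])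

lemma comm_group_homology: "comm_group (group_homology n G)"
  unfolding group_homology_def by (rule comm_group.abelian_FactGroup [OF comm_group_bar_cycles subgroup_bar_boundaries])

lemma homology_class_hom: "additive_hom (carrier (bar_cycles n G)) (group_homology n G) (homology_class n G)"
proof -
  have "homology_class n G \<in> hom (bar_cycles n G) (group_homology n G)"
    using comm_group.coset_map_hom [OF comm_group_bar_cycles subgroup_bar_boundaries, of n]
    by (simp add: group_homology_def homology_class_def [abs_def] group_hom_def group_hom_axioms_def)
  then show ?thesis
    using comm_group_homology [of n] add_subgroup_bar_cycles [of n G]
    by (simp add: additive_hom_def additive_hom_axioms_def comm_group_def bar_cycles_eq [symmetric])
qed

lemma carrier_homology: "carrier (group_homology n G) = homology_class n G ` carrier (bar_cycles n G)"
  using comm_group.coset_map_surj [OF comm_group_bar_cycles, of n "bar_boundaries n G"]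
  by (simp add: group_homology_def homology_class_def [abs_def])

lemmas homology_class_add = additive_hom.add [OF homology_class_hom]

lemma homology_class_pow:
  assumes c: "c \<in> carrier (bar_cycles n G)"
  shows "homology_class n G c [^]\<^bsub>group_homology n G\<^esub> (k::nat) = homology_class n G (frag_cmul (int k) c)"
proof (induction k)
  case (Suc k)
  have "frag_cmul (int k) c \<in> carrier (bar_cycles n G)"
    by (rule add_subgroup_frag_cmul [OF add_subgroup_bar_cycles c])
  then show ?case
    using Suc homology_class_add [OF _ c] by (simp add: frag_cmul_Suc del: of_nat_Suc)
qed (simp add: additive_hom.zero [OF homology_class_hom])

lemma homology_class_cong:
  assumes "c \<in> carrier (bar_cycles n G)" "d - c \<in> bar_boundaries n G"
  shows "homology_class n G d = homology_class n G c"
proof -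
  interpret H: additive_hom "carrier (bar_cycles n G)" "group_homology n G" "homology_class n G"
    by (rule homology_class_hom)
  have "d - c \<in> carrier (bar_cycles n G)"
    using assms(2) bar_boundaries_subset by blast
  then have "homology_class n G (d - c) = \<one>\<^bsub>group_homology n G\<^esub>"
    using comm_group.coset_map_eq_one_iff [OF comm_group_bar_cycles subgroup_bar_boundaries] assms(2)
    by (simp add: homology_class_def group_homology_def)
  then show ?thesis
    using H.add [OF \<open>d - c \<in> carrier _\<close> assms(1)] H.closed [OF assms(1)] by simp
qed

lemma homology_map_class:
  assumes H: "bar_group H" and h: "h \<in> hom G H" and c: "c \<in> carrier (bar_cycles n G)"
  shows "homology_map n H h (homology_class n G c) = homology_class n H (bar_map h c)"
proof -
  have const: "homology_class n H (bar_map h d) = homology_class n H (bar_map h c)"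
    if "d \<in> homology_class n G c" for d
  proof (rule bar_group.homology_class_cong [OF H bar_map_bar_cycles [OF h c]])
    show "bar_map h d - bar_map h c \<in> bar_boundaries n H"
      unfolding bar_map_diff [symmetric]
      using that by (intro bar_map_bar_boundaries [OF h]) (auto simp: homology_class_eq)
  qed
  have "c \<in> homology_class n G c"
    using add_subgroup_zero [OF add_subgroup_bar_boundaries, of n G] by (force simp: homology_class_eq)
  then have "(\<Union>d\<in>homology_class n G c. homology_class n H (bar_map h d)) = homology_class n H (bar_map h c)"
    using const by blast
  then show ?thesis
    by (simp only: homology_map_def homology_class_def [symmetric])
qed

lemma homology_map_hom:
  assumes "bar_group H" "h \<in> hom G H"
  shows "homology_map n H h \<in> hom (group_homology n G) (group_homology n H)"
proof (rule homI)
  interpret H: bar_group H by (rule assms)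
  note bar_map_bar_cycles [OF assms(2), simp]
  show "homology_map n H h x \<in> carrier (group_homology n H)" if "x \<in> carrier (group_homology n G)" for x
    using that by (auto simp: carrier_homology H.carrier_homology homology_map_class [OF assms])
  show "homology_map n H h (x \<otimes>\<^bsub>group_homology n G\<^esub> y) =
      homology_map n H h x \<otimes>\<^bsub>group_homology n H\<^esub> homology_map n H h y"
    if "x \<in> carrier (group_homology n G)" "y \<in> carrier (group_homology n G)" for x y
    using that
    by (auto simp: carrier_homology homology_class_add [symmetric] homology_map_class [OF assms]
        add_subgroup_add [OF add_subgroup_bar_cycles] bar_map_add H.homology_class_add)
qed

end

section \<open>Homology of inverse limits\<close>

definition liftable_cycles ::
  "nat \<Rightarrow> 'b monoid \<Rightarrow> 'a monoid \<Rightarrow> ('b \<Rightarrow> 'a) \<Rightarrow> 'a chain set" where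
  "liftable_cycles n L G h = {c. \<exists>d\<in>carrier (bar_cycles n L). c - bar_map h d \<in> bar_boundaries n G}"

lemma bar_map_liftable: "d \<in> carrier (bar_cycles n L) \<Longrightarrow> bar_map h d \<in> liftable_cycles n L G h"
  using add_subgroup_zero [OF add_subgroup_bar_boundaries] by (force simp: liftable_cycles_def)

lemma bar_boundaries_liftable: "bar_boundaries n G \<subseteq> liftable_cycles n L G h"
  using add_subgroup_zero [OF add_subgroup_bar_cycles, of n L] by (force simp: liftable_cycles_def)

lemma add_subgroup_liftable: "add_subgroup (liftable_cycles n L G h)"
proof (rule add_subgroupI)
  show "0 \<in> liftable_cycles n L G h"
    using bar_boundaries_liftable add_subgroup_zero [OF add_subgroup_bar_boundaries] by blast
  fix x y assume "x \<in> liftable_cycles n L G h" "y \<in> liftable_cycles n L G h"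
  then obtain d e where de: "d \<in> carrier (bar_cycles n L)" "x - bar_map h d \<in> bar_boundaries n G"
    "e \<in> carrier (bar_cycles n L)" "y - bar_map h e \<in> bar_boundaries n G"
    unfolding liftable_cycles_def by blast
  have "(x - y) - bar_map h (d - e) = (x - bar_map h d) - (y - bar_map h e)"
    by (simp add: bar_map_diff)
  also have "\<dots> \<in> bar_boundaries n G"
    by (rule add_subgroup_diff [OF add_subgroup_bar_boundaries de(2,4)])
  finally show "x - y \<in> liftable_cycles n L G h"
    using add_subgroup_diff [OF add_subgroup_bar_cycles de(1,3)] unfolding liftable_cycles_def by blast
qed

lemma (in bar_group) liftable_cycles_subset:
  assumes "h \<in> hom L G"
  shows "liftable_cycles n L G h \<subseteq> carrier (bar_cycles n G)"
proof
  fix c assume "c \<in> liftable_cycles n L G h"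
  then obtain d where d: "d \<in> carrier (bar_cycles n L)" "c - bar_map h d \<in> bar_boundaries n G"
    unfolding liftable_cycles_def by blast
  have "(c - bar_map h d) + bar_map h d \<in> carrier (bar_cycles n G)"
    using d bar_boundaries_subset bar_map_bar_cycles [OF assms d(1)]
    by (intro add_subgroup_add [OF add_subgroup_bar_cycles]) auto
  then show "c \<in> carrier (bar_cycles n G)"
    by simp
qed

lemma bar_group_tower: "abelian_tower A p \<Longrightarrow> bar_group (A i)"
  using abelian_towerD(2) by (simp add: bar_group_def)

lemma abelian_tower_homology:
  assumes "abelian_tower A p"
  shows "abelian_tower (\<lambda>i. group_homology n (A i)) (\<lambda>i. homology_map n (A i) (p i))"
  using bar_group.comm_group_homology [OF bar_group_tower [OF assms]] bar_group.homology_map_hom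
    [OF bar_group_tower [OF assms] bar_group_tower [OF assms] abelian_towerD(3) [OF assms]]
  by (simp add: abelian_tower_def)

lemma bar_group_inv_limit: "abelian_tower A p \<Longrightarrow> bar_group (inv_limit A p)"
  using comm_group_inv_limit [of A p] by (simp add: bar_group_def comm_group_def)

lemma proj_hom: "abelian_tower A p \<Longrightarrow> (\<lambda>x. x i) \<in> hom (inv_limit A p) (A i)"
  using proj_inv_limit_hom [of A p i] by (simp add: group_hom_def group_hom_axioms_def)

lemma homology_limit_map_class:
  assumes "abelian_tower A p" "c \<in> carrier (bar_cycles n (inv_limit A p))"
  shows "homology_limit_map n A (homology_class n (inv_limit A p) c) i = homology_class n (A i) (bar_map (\<lambda>x. x i) c)"
  unfolding homology_limit_map_def
  by (rule bar_group.homology_map_class [OF bar_group_inv_limit [OF assms(1)] bar_group_tower [OF assms(1)]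
        proj_hom [OF assms(1)] assms(2)])

lemma bar_map_proj_compatible:
  assumes "c \<in> carrier (bar_cycles n (inv_limit A p))"
  shows "bar_map (p i) (bar_map (\<lambda>x. x (Suc i)) c) = bar_map (\<lambda>x. x i) c"
  unfolding bar_map_bar_map
proof (rule bar_map_cong)
  fix xs assume "xs \<in> supp c"
  then show "map (\<lambda>x. p i (x (Suc i))) xs = map (\<lambda>x. x i) xs"
    using bar_cycles_supp(2) [OF assms] by (auto simp: mem_inv_limit subset_iff)
qed

lemma homology_limit_map_hom:
  assumes A: "abelian_tower A p"
  shows "homology_limit_map n A \<in> hom (group_homology n (inv_limit A p)) (homology_limit n A p)"
  unfolding homology_limit_def
proof (rule homI)
  interpret L: bar_group "inv_limit A p" by (rule bar_group_inv_limit [OF A])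
  note bar = bar_group_tower [OF A]
  fix x assume x: "x \<in> carrier (group_homology n (inv_limit A p))"
  then obtain c where c: "c \<in> carrier (bar_cycles n (inv_limit A p))" "x = homology_class n (inv_limit A p) c"
    unfolding L.carrier_homology by blast
  note cycles = bar_map_bar_cycles [OF proj_hom [OF A] c(1)]
  show "homology_limit_map n A x \<in> carrier (inv_limit (\<lambda>i. group_homology n (A i)) (\<lambda>i. homology_map n (A i) (p i)))"
    unfolding mem_inv_limit c(2) homology_limit_map_class [OF A c(1)]
    by (simp add: additive_hom.closed [OF bar_group.homology_class_hom [OF bar]] cycles
        bar_group.homology_map_class [OF bar bar abelian_towerD(3) [OF A]] bar_map_proj_compatible [OF c(1)])
  fix y assume y: "y \<in> carrier (group_homology n (inv_limit A p))"
  show "homology_limit_map n A (x \<otimes>\<^bsub>group_homology n (inv_limit A p)\<^esub> y) =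
      homology_limit_map n A x \<otimes>\<^bsub>inv_limit (\<lambda>i. group_homology n (A i)) (\<lambda>i. homology_map n (A i) (p i))\<^esub> homology_limit_map n A y"
    using hom_mult [OF L.homology_map_hom [OF bar proj_hom [OF A]] x y]
    by (simp add: homology_limit_map_def)
qed

lemma homology_class_pow_in_projection_image:
  assumes A: "abelian_tower A p" and c: "c \<in> carrier (bar_cycles n (A i))"
    and liftable: "frag_cmul (int k) c \<in> liftable_cycles n (inv_limit A p) (A i) (\<lambda>x. x i)"
  shows "homology_class n (A i) c [^]\<^bsub>group_homology n (A i)\<^esub> k
    \<in> (\<lambda>x. homology_limit_map n A x i) ` carrier (group_homology n (inv_limit A p))"
proof -
  interpret Ai: bar_group "A i" by (rule bar_group_tower [OF A])
  obtain d where d: "d \<in> carrier (bar_cycles n (inv_limit A p))"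
    "frag_cmul (int k) c - bar_map (\<lambda>x. x i) d \<in> bar_boundaries n (A i)"
    using liftable unfolding liftable_cycles_def by blast
  have "homology_class n (A i) c [^]\<^bsub>group_homology n (A i)\<^esub> k = homology_class n (A i) (frag_cmul (int k) c)"
    by (rule Ai.homology_class_pow [OF c])
  also have "\<dots> = homology_class n (A i) (bar_map (\<lambda>x. x i) d)"
    by (rule Ai.homology_class_cong [OF bar_map_bar_cycles [OF proj_hom [OF A] d(1)] d(2)])
  also have "\<dots> = homology_limit_map n A (homology_class n (inv_limit A p) d) i"
    by (rule homology_limit_map_class [OF A d(1), symmetric])
  finally show ?thesis
    using d(1) unfolding bar_group.carrier_homology [OF bar_group_inv_limit [OF A]] by blast
qed

theorem cotorsion_group_homology_cokernel:
  assumes A: "abelian_tower A p"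
    and bounded: "\<And>i. \<exists>k>0. \<forall>c\<in>carrier (bar_cycles n (A i)).
      frag_cmul (int k) c \<in> liftable_cycles n (inv_limit A p) (A i) (\<lambda>x. x i)"
  shows "cotorsion_group (cokernel (group_homology n (inv_limit A p)) (homology_limit n A p) (homology_limit_map n A))"
  unfolding homology_limit_def
proof (rule cotorsion_group_cokernel_inv_limit [OF abelian_tower_homology [OF A]])
  show "group (group_homology n (inv_limit A p))"
    using bar_group.comm_group_homology [OF bar_group_inv_limit [OF A]] by (simp add: comm_group_def)
  show "homology_limit_map n A \<in> hom (group_homology n (inv_limit A p))
      (inv_limit (\<lambda>i. group_homology n (A i)) (\<lambda>i. homology_map n (A i) (p i)))"
    using homology_limit_map_hom [OF A] by (simp add: homology_limit_def)
  fix i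
  obtain k where k: "0 < k" "\<And>c. c \<in> carrier (bar_cycles n (A i)) \<Longrightarrow>
      frag_cmul (int k) c \<in> liftable_cycles n (inv_limit A p) (A i) (\<lambda>x. x i)"
    using bounded by metis
  have "z [^]\<^bsub>group_homology n (A i)\<^esub> k \<in> (\<lambda>x. homology_limit_map n A x i) ` carrier (group_homology n (inv_limit A p))"
    if "z \<in> carrier (group_homology n (A i))" for z
    using that homology_class_pow_in_projection_image [OF A _ k(2)]
    unfolding bar_group.carrier_homology [OF bar_group_tower [OF A]] by blast
  then show "\<exists>k>0. \<forall>y\<in>carrier (inv_limit (\<lambda>i. group_homology n (A i)) (\<lambda>i. homology_map n (A i) (p i))).
      y i [^]\<^bsub>group_homology n (A i)\<^esub> (k::nat) \<in> (\<lambda>x. homology_limit_map n A x i) ` carrier (group_homology n (inv_limit A p))"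
    using k(1) by (intro exI [of _ k]) (simp add: mem_inv_limit)
qed

section \<open>Homology of abelian groups as a polynomial functor\<close>

lemma sum_Pow_insert:
  assumes "finite A" "a \<notin> A"
  shows "sum F (Pow (insert a A)) = (\<Sum>T\<in>Pow A. F T + F (insert a T))"
proof -
  have "inj_on (insert a) (Pow A)"
    using assms(2) by (auto simp: inj_on_def)
  moreover have "Pow A \<inter> insert a ` Pow A = {}"
    using assms(2) by auto
  ultimately show ?thesis
    using assms(1) by (simp add: Pow_insert sum.union_disjoint sum.reindex sum.distrib)
qed

abbreviation alternating :: "(nat set \<Rightarrow> 'b \<Rightarrow>\<^sub>0 int) \<Rightarrow> nat set \<Rightarrow> 'b \<Rightarrow>\<^sub>0 int" where
  "alternating F A \<equiv> \<Sum>T\<in>Pow A. frag_cmul ((-1) ^ card T) (F T)"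

lemma alternating_insert:
  assumes "finite A" "a \<notin> A"
  shows "alternating F (insert a A) = alternating (\<lambda>T. F T - F (insert a T)) A"
proof -
  have "card (insert a T) = Suc (card T)" if "T \<in> Pow A" for T
    using that assms finite_subset by (metis PowD card_insert_disjoint subsetD)
  then show ?thesis
    unfolding sum_Pow_insert [OF assms]
    by (intro sum.cong) (auto simp: frag_cmul_diff simp flip: minus_frag_cmul)
qed

lemma alternating_eq_0:
  assumes "finite A" "a \<in> A" "\<And>T. F (insert a T) = F T"
  shows "alternating F A = 0"
proof -
  have "alternating F (insert a (A - {a})) = 0"
    by (subst alternating_insert) (use assms in auto)
  then show ?thesis
    using assms(2) by (simp add: insert_absorb)
qed

text \<open>
  The alternating sum over \<open>T\<close> below cancels all simplices with a constant coordinate \<open>j < k\<close>, because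
  inserting \<open>j\<close> into \<open>T\<close> translates their image. The coordinate \<open>k\<close> is not crossed; it moves the base
  point of the resulting finite difference to \<open>x\<close>.
\<close>

definition weighted :: "'a monoid \<Rightarrow> nat \<Rightarrow> nat \<Rightarrow> nat set \<Rightarrow> (nat \<Rightarrow> 'a) \<Rightarrow> 'a" where
  "weighted G k x T v = finprod G v T \<otimes>\<^bsub>G\<^esub> v k [^]\<^bsub>G\<^esub> x"

definition cross_effect :: "'a monoid \<Rightarrow> nat \<Rightarrow> nat \<Rightarrow> (nat \<Rightarrow> 'a) chain \<Rightarrow> 'a chain" where
  "cross_effect G k x c = alternating (\<lambda>T. edge_chain G (bar_map (weighted G k x T) c)) {..<k}"

definition carrier_simplices :: "'a monoid \<Rightarrow> (nat \<Rightarrow> 'a) list set" where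
  "carrier_simplices G = {vs. \<forall>v\<in>set vs. \<forall>j. v j \<in> carrier G}"

lemma alternating_diff: "alternating (\<lambda>T. F T - F' T) A = alternating F A - alternating F' A"
  by (simp add: frag_cmul_diff sum_subtractf)

lemma cross_effect_0 [simp]: "cross_effect G k x 0 = 0"
  and cross_effect_diff: "cross_effect G k x (a - b) = cross_effect G k x a - cross_effect G k x b"
  by (simp_all add: cross_effect_def bar_map_diff edge_chain_diff alternating_diff)

lemma cross_effect_add: "cross_effect G k x (a + b) = cross_effect G k x a + cross_effect G k x b"
  using cross_effect_diff [of G k x "a + b" b] by simp

context bar_comm_group
begin

lemma weighted_closed: "(\<And>j. v j \<in> carrier G) \<Longrightarrow> weighted G k x T v \<in> carrier G"
  by (simp add: weighted_def)

lemma map_weighted_carrier: "vs \<in> carrier_simplices G \<Longrightarrow> set (map (weighted G k x T) vs) \<subseteq> carrier G"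
  by (auto simp: carrier_simplices_def intro: weighted_closed)

lemma edges_weighted_insert:
  assumes vs: "vs \<in> carrier_simplices G" and "constant_coord j vs"
  shows "edges G (map (weighted G k x (insert j T)) vs) = edges G (map (weighted G k x T) vs)"
proof (cases "finite T \<and> j \<notin> T \<and> vs \<noteq> []")
  case True
  obtain a where a: "\<forall>v\<in>set vs. v j = a"
    using assms(2) by (auto simp: constant_coord_def)
  have "hd vs \<in> set vs"
    using True by simp
  then have "a \<in> carrier G"
    using vs a by (auto simp: carrier_simplices_def)
  then have "map (weighted G k x (insert j T)) vs = map (\<lambda>y. a \<otimes> y) (map (weighted G k x T) vs)"
    using True vs a unfolding map_map
    by (intro map_cong) (auto simp: weighted_def carrier_simplices_def m_assoc)
  then show ?thesis
    using edges_translate [OF \<open>a \<in> carrier G\<close> map_weighted_carrier [OF vs]] by metis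
next
  case False
  then show ?thesis
    by (auto simp: weighted_def [abs_def] insert_absorb finprod_infinite)
qed

lemma cross_effect_degenerate:
  assumes "c \<in> degenerate k" "c \<in> supported_on (carrier_simplices G)"
  shows "cross_effect G k x c = 0"
proof -
  have "c \<in> supported_on {vs \<in> carrier_simplices G. \<exists>j<k. constant_coord j vs}"
    using assms by (auto simp: degenerate_def supported_on_def)
  then show ?thesis
  proof (induction rule: supported_on_induct)
    case (one vs)
    then obtain j where "j < k" "constant_coord j vs" by auto
    then show ?case
      unfolding cross_effect_def
      by (intro alternating_eq_0 [of _ j]) (use edges_weighted_insert one in auto)
  qed (simp_all add: cross_effect_diff)
qed

lemma bar_map_weighted_supported_on:
  assumes "c \<in> tuple_chains n" "c \<in> supported_on (carrier_simplices G)"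
  shows "bar_map (weighted G k x T) c \<in> supported_on (bar_simplices n G)"
proof (rule bar_map_supported_on)
  show "c \<in> supported_on {vs \<in> carrier_simplices G. length vs = n}"
    using assms by (auto simp: supported_on_def)
qed (use map_weighted_carrier in auto)

lemma cross_effect_supported_on:
  assumes "c \<in> tuple_chains (Suc n)" "c \<in> supported_on (carrier_simplices G)"
  shows "cross_effect G k x c \<in> supported_on (bar_simplices n G)"
  unfolding cross_effect_def
  by (intro add_subgroup_sum add_subgroup_frag_cmul add_subgroup_supported_on edge_chain_supported_on
      bar_map_weighted_supported_on assms)

lemma bar_boundary_cross_effect:
  assumes "c \<in> tuple_chains (Suc n)" "c \<in> supported_on (carrier_simplices G)" "n \<noteq> 0"
  shows "bar_boundary n G (cross_effect G k x c) = cross_effect G k x (bdy c)"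
  by (simp add: cross_effect_def bar_boundary_sum bar_boundary_cmul bdy_bar_map
      bar_boundary_edge_chain [OF bar_map_weighted_supported_on [OF assms(1,2)] assms(3)])

lemma edges_pow:
  "set xs \<subseteq> carrier G \<Longrightarrow> edges G (map (\<lambda>a. a [^] (r::nat)) xs) = map (\<lambda>a. a [^] r) (edges G xs)"
  by (induction xs rule: induct_list012) (auto simp: nat_pow_inv nat_pow_distrib)

lemma cross_effect_diagonal:
  assumes "set u \<subseteq> carrier G"
  shows "cross_effect G k x (frag_of (diagonal u)) =
    alternating (\<lambda>T. frag_of (map (\<lambda>a. a [^] (card T + x)) (edges G u))) {..<k}"
proof -
  have "map (weighted G k x T) (diagonal u) = map (\<lambda>a. a [^] (card T + x)) u" for T
    using assms by (auto simp: diagonal_def weighted_def finprod_const nat_pow_mult)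
  then show ?thesis
    by (simp add: cross_effect_def edges_pow assms)
qed

lemma edges_weighted_translate:
  assumes a: "a \<in> carrier G" and vs: "vs \<in> carrier_simplices G"
  shows "edges G (map (weighted G k x T) (map (\<lambda>v j. a \<otimes> v j) vs)) = edges G (map (weighted G k x T) vs)"
proof -
  define b where "b = weighted G k x T (\<lambda>j. a)"
  have "weighted G k x T (\<lambda>j. a \<otimes> v j) = b \<otimes> weighted G k x T v" if "v \<in> set vs" for v
    using that vs a
    by (simp add: b_def weighted_def carrier_simplices_def finprod_multf nat_pow_distrib m_ac)
  then have "map (weighted G k x T) (map (\<lambda>v j. a \<otimes> v j) vs) = map (\<lambda>y. b \<otimes> y) (map (weighted G k x T) vs)"
    by simp
  moreover have "b \<in> carrier G"
    using a by (simp add: b_def weighted_closed)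
  ultimately show ?thesis
    using edges_translate map_weighted_carrier [OF vs] by metis
qed

lemma cross_effect_translate:
  assumes "a \<in> carrier G" "c \<in> supported_on (carrier_simplices G)"
  shows "cross_effect G k x (bar_map (\<lambda>v j. a \<otimes> v j) c) = cross_effect G k x c"
  using assms(2)
proof (induction rule: supported_on_induct)
  case (one vs)
  then show ?case
    using edges_weighted_translate [OF assms(1) one] by (simp add: cross_effect_def del: map_map)
qed (simp_all add: cross_effect_diff bar_map_diff)

lemma transport_carrier:
  assumes "set u \<subseteq> carrier G"
  shows "transport H u \<in> supported_on (carrier_simplices G)"
proof (cases "u = []")
  case False
  then have "vertex u i \<in> carrier G" for i
    using vertex_in_set assms by blast
  then have "bar_map (\<lambda>v j. vertex u (v j)) (H (length u - 1)) \<in> supported_on (carrier_simplices G)"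
    by (intro bar_map_supported_on [OF supported_on_supp]) (auto simp: carrier_simplices_def)
  then show ?thesis
    using False by (simp add: transport_def)
qed (simp add: transport_def add_subgroup_zero [OF add_subgroup_supported_on])

lemma frag_extend_transport_carrier:
  "c \<in> supported_on {u. set u \<subseteq> carrier G} \<Longrightarrow> frag_extend (transport H) c \<in> supported_on (carrier_simplices G)"
  by (rule frag_extend_supported_on) (auto intro: transport_carrier)

lemma cross_effect_transport:
  assumes "contraction_defect H u \<in> degenerate k" and u: "set u \<subseteq> carrier G"
  shows "cross_effect G k x (bdy (transport H u)) + cross_effect G k x (frag_extend (transport H) (face_sum u)) =
    cross_effect G k x (frag_of (diagonal u))"
proof -
  have "bdy (transport H u) \<in> supported_on (carrier_simplices G)"
    by (rule bdy_supported_on [OF transport_carrier [OF u]]) (auto simp: carrier_simplices_def)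
  moreover have "frag_extend (transport H) (face_sum u) \<in> supported_on (carrier_simplices G)"
    by (rule frag_extend_transport_carrier, rule supported_on_weaken [OF face_sum_supported_on]) (use u in auto)
  moreover have "frag_of (diagonal u) \<in> supported_on (carrier_simplices G)"
    using u by (auto simp: diagonal_def carrier_simplices_def)
  ultimately have "contraction_defect H u \<in> supported_on (carrier_simplices G)"
    unfolding contraction_defect_def
    by (intro add_subgroup_diff [OF add_subgroup_supported_on] add_subgroup_add [OF add_subgroup_supported_on])
  then have "cross_effect G k x (contraction_defect H u) = 0"
    by (rule cross_effect_degenerate [OF assms(1)])
  then show ?thesis
    by (simp add: contraction_defect_def cross_effect_diff cross_effect_add)
qed

definition cross_homotopy :: "(nat \<Rightarrow> (nat \<Rightarrow> nat) chain) \<Rightarrow> nat \<Rightarrow> nat \<Rightarrow> 'a list \<Rightarrow> 'a chain" where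
  "cross_homotopy H k x gs = cross_effect G k x (transport H (vertices G gs))"

lemma cross_homotopy_edges:
  assumes u: "u \<noteq> []" "set u \<subseteq> carrier G"
  shows "cross_homotopy H k x (edges G u) = cross_effect G k x (transport H u)"
proof -
  have "transport H u = bar_map (\<lambda>v j. hd u \<otimes> v j) (transport H (vertices G (edges G u)))"
    using vertices_edges [OF u] transport_map [of H "\<lambda>y. hd u \<otimes> y" "vertices G (edges G u)"] by simp
  moreover have "hd u \<in> carrier G"
    using u by auto
  ultimately show ?thesis
    unfolding cross_homotopy_def
    using cross_effect_translate transport_carrier [OF set_vertices [OF set_edges [OF u(2)]]] by metis
qed

lemma frag_extend_cross_homotopy_edge_chain:
  assumes "c \<in> supported_on {u. u \<noteq> [] \<and> set u \<subseteq> carrier G}"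
  shows "frag_extend (cross_homotopy H k x) (edge_chain G c) = cross_effect G k x (frag_extend (transport H) c)"
  using assms
  by (induction rule: supported_on_induct)
    (simp_all add: cross_homotopy_edges edge_chain_diff frag_extend_diff cross_effect_diff)

lemma cross_homotopy_supported_on:
  assumes "H n \<in> tuple_chains (Suc (Suc n))" "gs \<in> bar_simplices n G"
  shows "cross_homotopy H k x gs \<in> supported_on (bar_simplices (Suc n) G)"
  unfolding cross_homotopy_def using assms set_vertices [of gs]
  by (intro cross_effect_supported_on transport_tuple_chains [of H n, OF assms(1)] transport_carrier) auto

lemma cross_homotopy_simplex:
  assumes H: "H n \<in> tuple_chains (Suc (Suc n))" and gs: "gs \<in> bar_simplices n G" and n: "n \<noteq> 0"
    and defect: "contraction_defect H (vertices G gs) \<in> degenerate k"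
  shows "bar_boundary (Suc n) G (cross_homotopy H k x gs) + frag_extend (cross_homotopy H k x) (bar_boundary n G (frag_of gs)) =
    alternating (\<lambda>T. frag_of (map (\<lambda>a. a [^] (card T + x)) gs)) {..<k}"
proof -
  define u where "u = vertices G gs"
  have u: "set u \<subseteq> carrier G" "length u = Suc n" "edges G u = gs"
    using gs set_vertices [of gs] by (auto simp: u_def edges_vertices)
  have "bar_boundary (Suc n) G (cross_homotopy H k x gs) = cross_effect G k x (bdy (transport H u))"
    unfolding cross_homotopy_def u_def [symmetric]
    by (intro bar_boundary_cross_effect transport_tuple_chains [of H n] H transport_carrier u) simp
  moreover have "frag_extend (cross_homotopy H k x) (bar_boundary n G (frag_of gs)) =
      cross_effect G k x (frag_extend (transport H) (face_sum u))"
  proof -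
    have "bar_boundary n G (frag_of gs) = edge_chain G (face_sum u)"
      using bar_boundary_eq_edge_chain [of "frag_of gs" n] gs n by (simp add: u_def)
    moreover have "face_sum u \<in> supported_on {ws. ws \<noteq> [] \<and> set ws \<subseteq> carrier G}"
      by (rule supported_on_weaken [OF face_sum_supported_on]) (use u n in auto)
    ultimately show ?thesis
      by (simp add: frag_extend_cross_homotopy_edge_chain)
  qed
  ultimately show ?thesis
    using cross_effect_transport [OF defect, of x] u by (simp add: u_def [symmetric] cross_effect_diagonal)
qed

theorem alternating_power_map_boundary:
  assumes c: "c \<in> carrier (bar_cycles n G)" and n: "n \<noteq> 0"
  shows "alternating (\<lambda>T. bar_map (\<lambda>a. a [^] (card T + x)) c) {..<Suc n} \<in> bar_boundaries n G"
proof -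
  obtain H where H: "\<And>m. m < Suc n \<Longrightarrow> H m \<in> tuple_chains (Suc (Suc m))"
    and defect: "\<And>u :: 'a list. u \<noteq> [] \<Longrightarrow> length u \<le> Suc n \<Longrightarrow> contraction_defect H u \<in> degenerate (Suc n)"
    using universal_contraction by blast
  define h where "h = cross_homotopy H (Suc n) x"
  have supp: "c \<in> supported_on (bar_simplices n G)" and cycle: "bar_boundary n G c = 0"
    using c by (simp_all add: bar_cycles_carrier)
  have "bar_boundary (Suc n) G (frag_extend h c) + frag_extend h (bar_boundary n G c) =
      alternating (\<lambda>T. bar_map (\<lambda>a. a [^] (card T + x)) c) {..<Suc n}"
    using supp
  proof (induction rule: supported_on_induct)
    case (one gs)
    then show ?case
      using cross_homotopy_simplex [OF H one n defect, of x] by (simp add: h_def del: sum.lessThan_Suc)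
  next
    case (diff a b)
    have "bar_boundary (Suc n) G (frag_extend h (a - b)) + frag_extend h (bar_boundary n G (a - b)) =
      (bar_boundary (Suc n) G (frag_extend h a) + frag_extend h (bar_boundary n G a)) -
      (bar_boundary (Suc n) G (frag_extend h b) + frag_extend h (bar_boundary n G b))"
      by (simp add: frag_extend_diff bar_boundary_diff)
    then show ?case
      unfolding diff bar_map_diff alternating_diff .
  qed simp
  then have "alternating (\<lambda>T. bar_map (\<lambda>a. a [^] (card T + x)) c) {..<Suc n} = bar_boundary (Suc n) G (frag_extend h c)"
    unfolding cycle by simp
  moreover have "frag_extend h c \<in> carrier (bar_chains (Suc n) G)"
    unfolding carrier_bar_chains h_def
    by (rule frag_extend_supported_on [OF supp]) (rule cross_homotopy_supported_on [OF H], auto)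
  ultimately show ?thesis
    unfolding bar_boundaries_def by (rule image_eqI)
qed

end

subsection \<open>Finite differences\<close>

definition step_diff :: "nat \<Rightarrow> (nat \<Rightarrow> 'b::ab_group_add) \<Rightarrow> nat \<Rightarrow> 'b" where
  "step_diff m f x = f (x + m) - f x"

lemma step_diff_commute: "step_diff m (step_diff l f) = step_diff l (step_diff m f)"
  by (rule ext) (simp add: step_diff_def add_ac)

lemma step_diff_funpow_commute: "step_diff m ((step_diff l ^^ k) f) = (step_diff l ^^ k) (step_diff m f)"
  by (induction k) (auto simp: step_diff_commute [of m l])

lemma alternating_step_diff:
  fixes f :: "nat \<Rightarrow> 'b \<Rightarrow>\<^sub>0 int"
  shows "alternating (\<lambda>T. f (card T + x)) {..<k} = frag_cmul ((-1) ^ k) ((step_diff 1 ^^ k) f x)"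
proof (induction k arbitrary: f)
  case (Suc k)
  have card: "card (insert k T) = Suc (card T)" if "T \<in> Pow {..<k}" for T
    using that by (subst card_insert_disjoint) (auto intro: finite_subset)
  have "alternating (\<lambda>T. f (card T + x)) {..<Suc k} =
      alternating (\<lambda>T. f (card T + x) - f (card (insert k T) + x)) {..<k}"
    unfolding lessThan_Suc by (subst alternating_insert) auto
  also have "\<dots> = alternating (\<lambda>T. - step_diff 1 f (card T + x)) {..<k}"
    by (intro sum.cong) (auto simp: card step_diff_def)
  also have "\<dots> = - alternating (\<lambda>T. step_diff 1 f (card T + x)) {..<k}"
  proof -
    have neg: "frag_cmul i (- b) = - frag_cmul i b" for i and b :: "'b \<Rightarrow>\<^sub>0 int"
      using frag_cmul_diff [of i 0 b] by simp
    show ?thesis by (simp only: neg sum_negf)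
  qed
  also have "\<dots> = frag_cmul ((-1) ^ Suc k) ((step_diff 1 ^^ Suc k) f x)"
    by (subst Suc.IH) (simp add: funpow_swap1)
  finally show ?case .
qed simp

context
  fixes S :: "('b \<Rightarrow>\<^sub>0 int) set"
  assumes S: "add_subgroup S"
begin

lemma step_diff_sum_mem: "(\<And>x. step_diff 1 g x \<in> S) \<Longrightarrow> step_diff m g x \<in> S"
proof (induction m)
  case (Suc m)
  have "step_diff (Suc m) g x = step_diff m g x + step_diff 1 g (x + m)"
    by (simp add: step_diff_def)
  then show ?case
    using Suc add_subgroup_add [OF S] by simp
qed (simp add: step_diff_def add_subgroup_zero [OF S])

lemma step_diff_linear:
  assumes "\<And>x. (step_diff 1 ^^ 2) g x \<in> S"
  shows "step_diff m g x - frag_cmul (int m) (step_diff 1 g x) \<in> S"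
proof (induction m)
  case (Suc m)
  have "step_diff m (step_diff 1 g) x \<in> S"
    by (rule step_diff_sum_mem) (use assms in \<open>simp add: numeral_2_eq_2\<close>)
  moreover have "step_diff (Suc m) g x - frag_cmul (int (Suc m)) (step_diff 1 g x) =
      (step_diff m g x - frag_cmul (int m) (step_diff 1 g x)) + step_diff m (step_diff 1 g) x"
  proof -
    have "step_diff (Suc m) g x = step_diff m g x + step_diff 1 g x + step_diff m (step_diff 1 g) x"
      by (simp add: step_diff_def)
    then show ?thesis
      by (simp add: frag_cmul_Suc del: of_nat_Suc)
  qed
  ultimately show ?case
    using Suc add_subgroup_add [OF S] by simp
qed (simp add: step_diff_def add_subgroup_zero [OF S])

lemma step_diff_power:
  assumes "\<And>x. (step_diff 1 ^^ Suc e) g x \<in> S"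
  shows "(step_diff m ^^ e) g x - frag_cmul (int m ^ e) ((step_diff 1 ^^ e) g x) \<in> S"
  using assms
proof (induction e arbitrary: g)
  case (Suc e)
  have "(step_diff 1 ^^ Suc e) (step_diff m g) y \<in> S" for y
    unfolding step_diff_funpow_commute [symmetric]
    by (rule step_diff_sum_mem) (use Suc.prems in simp)
  then have inner: "(step_diff m ^^ e) (step_diff m g) x - frag_cmul (int m ^ e) ((step_diff 1 ^^ e) (step_diff m g) x) \<in> S"
    by (rule Suc.IH)
  have "step_diff m ((step_diff 1 ^^ e) g) x - frag_cmul (int m) (step_diff 1 ((step_diff 1 ^^ e) g) x) \<in> S"
    by (rule step_diff_linear) (use Suc.prems in \<open>simp add: numeral_2_eq_2\<close>)
  then have "frag_cmul (int m ^ e) (step_diff m ((step_diff 1 ^^ e) g) x - frag_cmul (int m) (step_diff 1 ((step_diff 1 ^^ e) g) x)) \<in> S"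
    by (rule add_subgroup_frag_cmul [OF S])
  then have outer: "frag_cmul (int m ^ e) ((step_diff 1 ^^ e) (step_diff m g) x)
      - frag_cmul (int m ^ Suc e) ((step_diff 1 ^^ Suc e) g x) \<in> S"
    by (simp add: frag_cmul_diff step_diff_funpow_commute mult.commute)
  show ?case
    using add_subgroup_add [OF S inner outer] by (simp add: funpow_swap1 del: minus_frag_cmul)
qed (simp add: add_subgroup_zero [OF S])

lemma scaled_leading_difference_mem:
  assumes "\<And>x. (step_diff 1 ^^ Suc e) f x \<in> S" "\<And>j. f (j * m) \<in> S"
  shows "frag_cmul (int m ^ e) ((step_diff 1 ^^ e) f x) \<in> S"
proof -
  have "(step_diff m ^^ i) f (j * m) \<in> S" for i j
  proof (induction i arbitrary: j)
    case (Suc i)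
    then show ?case
      using Suc [of "Suc j"] Suc [of j] add_subgroup_diff [OF S]
      by (simp add: step_diff_def add.commute)
  qed (simp add: assms(2))
  from add_subgroup_diff [OF S this [of e 0] step_diff_power [of e f m "0 * m"]]
  have start: "frag_cmul (int m ^ e) ((step_diff 1 ^^ e) f 0) \<in> S"
    using assms(1) by simp
  have "step_diff x ((step_diff 1 ^^ e) f) 0 \<in> S"
    by (rule step_diff_sum_mem) (use assms(1) in simp)
  then have "frag_cmul (int m ^ e) (step_diff x ((step_diff 1 ^^ e) f) 0) \<in> S"
    by (rule add_subgroup_frag_cmul [OF S])
  from add_subgroup_add [OF S this start] show ?thesis
    by (simp add: step_diff_def [of x] frag_cmul_diff)
qed

text \<open>Scaling by \<open>m ^ (d + 1)\<close> kills the leading difference modulo \<open>S\<close>, so that the degree drops.\<close>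

lemma polynomial_mem_if_multiples_mem:
  assumes "\<And>x. (step_diff 1 ^^ Suc d) f x \<in> S" "\<And>j. f (j * m) \<in> S"
  shows "frag_cmul (int m ^ (\<Sum>i\<le>d. i)) (f x) \<in> S"
  using assms
proof (induction d arbitrary: f x)
  case 0
  then show ?case
    using scaled_leading_difference_mem [of 0 f m x] by simp
next
  case (Suc d)
  define F where "F = (\<lambda>x. frag_cmul (int m ^ Suc d) (f x))"
  have "(step_diff 1 ^^ e) F y = frag_cmul (int m ^ Suc d) ((step_diff 1 ^^ e) f y)" for e y
    by (induction e arbitrary: y) (auto simp: F_def step_diff_def frag_cmul_diff)
  then have "(step_diff 1 ^^ Suc d) F y \<in> S" for y
    using scaled_leading_difference_mem [OF Suc.prems] by metis
  moreover have "F (j * m) \<in> S" for j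
    unfolding F_def by (rule add_subgroup_frag_cmul [OF S]) (rule Suc.prems)
  ultimately have "frag_cmul (int m ^ (\<Sum>i\<le>d. i)) (F x) \<in> S"
    by (rule Suc.IH)
  then show ?case
    by (simp add: F_def power_add mult_ac)
qed

end

section \<open>Lifting multiples of cycles along epimorphisms\<close>

subsection \<open>Finitely generated abelian groups\<close>

definition independent_family :: "('a, 'b) monoid_scheme \<Rightarrow> 'i set \<Rightarrow> ('i \<Rightarrow> 'a) \<Rightarrow> bool" where
  "independent_family G I a \<longleftrightarrow> (\<forall>c\<in>supported_on I. frag_eval G a c = \<one>\<^bsub>G\<^esub> \<longrightarrow> c = 0)"

definition l1_norm :: "('i \<Rightarrow>\<^sub>0 int) \<Rightarrow> nat" where
  "l1_norm c = (\<Sum>i\<in>supp c. nat \<bar>Poly_Mapping.lookup c i\<bar>)"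

lemma l1_norm_superset:
  "finite I \<Longrightarrow> supp c \<subseteq> I \<Longrightarrow> l1_norm c = (\<Sum>i\<in>I. nat \<bar>Poly_Mapping.lookup c i\<bar>)"
  unfolding l1_norm_def by (rule sum.mono_neutral_left) (auto simp: in_keys_iff)

definition torsion_exponent :: "('a, 'b) monoid_scheme \<Rightarrow> nat \<Rightarrow> bool" where
  "torsion_exponent G m \<longleftrightarrow> 0 < m \<and> (\<forall>x\<in>carrier G. \<forall>k>0. x [^]\<^bsub>G\<^esub> (k::nat) = \<one>\<^bsub>G\<^esub> \<longrightarrow> x [^]\<^bsub>G\<^esub> m = \<one>\<^bsub>G\<^esub>)"

context comm_group
begin

lemma generate_eq_frag_eval_image:
  assumes "a \<in> I \<rightarrow> carrier G"
  shows "generate G (a ` I) = frag_eval G a ` supported_on I"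
proof
  interpret a: additive_hom "supported_on I" G "frag_eval G a"
    by (rule frag_eval_additive_hom [OF assms])
  have carrier: "a ` I \<subseteq> carrier G"
    using assms by auto
  have "a ` I \<subseteq> frag_eval G a ` supported_on I"
  proof
    fix x assume "x \<in> a ` I"
    then obtain i where "i \<in> I" "x = a i" by auto
    then show "x \<in> frag_eval G a ` supported_on I"
      using frag_eval_of [of a i] funcset_mem [OF assms] by (intro image_eqI [of _ _ "frag_of i"]) auto
  qed
  then show "generate G (a ` I) \<subseteq> frag_eval G a ` supported_on I"
    using a.additive.img_is_subgroup by (intro generate_subgroup_incl) simp_all
  have "frag_eval G a c \<in> generate G (a ` I)" if "c \<in> supported_on I" for c
    using that
  proof (induction rule: supported_on_induct)
    case (one i)
    then show ?case
      using frag_eval_of [of a i] funcset_mem [OF assms] by (auto intro: generate.incl)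
  next
    case (diff c d)
    then show ?case
      using generate_is_subgroup [OF carrier] a.diff by (simp add: subgroup.m_closed subgroup.m_inv_closed)
  qed (simp add: a.zero generate.one)
  then show "frag_eval G a ` supported_on I \<subseteq> generate G (a ` I)"
    by auto
qed

lemma frag_eval_cmul:
  assumes "a \<in> I \<rightarrow> carrier G" "c \<in> supported_on I"
  shows "frag_eval G a (frag_cmul (int k) c) = frag_eval G a c [^] k"
proof (induction k)
  interpret a: additive_hom "supported_on I" G "frag_eval G a"
    by (rule frag_eval_additive_hom [OF assms(1)])
  case 0
  then show ?case by (simp add: a.zero)
  case (Suc k)
  then show ?case
    using a.add [OF add_subgroup_frag_cmul [OF add_subgroup_supported_on assms(2)] assms(2)]
    by (simp add: frag_cmul_Suc del: of_nat_Suc)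
qed

lemma frag_eval_cmul_of:
  assumes "a i \<in> carrier G"
  shows "frag_eval G a (frag_cmul n (frag_of i)) = a i [^] n"
  using frag_eval_superset [of "{i}" "frag_cmul n (frag_of i)" a] keys_cmul [of n "frag_of i"] assms by simp

lemma frag_eval_transvection:
  assumes a: "a \<in> I \<rightarrow> carrier G" and ij: "i \<in> I" "j \<in> I" and c: "c \<in> supported_on I"
  shows "frag_eval G (a(j := a j \<otimes> a i [^] (e::int))) c =
    frag_eval G a (c + frag_cmul (e * Poly_Mapping.lookup c j) (frag_of i))"
proof (rule additive_hom_eq_on_supported_on [OF _ _ _ c])
  let ?b = "a(j := a j \<otimes> a i [^] e)"
  let ?\<phi> = "\<lambda>c. c + frag_cmul (e * Poly_Mapping.lookup c j) (frag_of i)"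
  interpret a: additive_hom "supported_on I" G "frag_eval G a"
    by (rule frag_eval_additive_hom [OF a])
  have ij_closed: "a i \<in> carrier G" "a j \<in> carrier G"
    using a ij by auto
  show "additive_hom (supported_on I) G (frag_eval G ?b)"
    using a ij_closed by (intro frag_eval_additive_hom) (auto simp: Pi_iff)
  have \<phi>: "?\<phi> c \<in> supported_on I" if "c \<in> supported_on I" for c
    using that ij(1) by (intro add_subgroup_add add_subgroup_frag_cmul add_subgroup_supported_on) auto
  have "?\<phi> (c + d) = ?\<phi> c + ?\<phi> d" for c d
    by (simp add: Poly_Mapping.lookup_add distrib_left frag_cmul_distrib algebra_simps)
  then show "additive_hom (supported_on I) G (\<lambda>c. frag_eval G a (?\<phi> c))"
    using \<phi> a.add [OF \<phi> \<phi>] by (intro additive_homI is_group add_subgroup_supported_on a.closed) (simp_all only:)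
  fix l assume l: "l \<in> I"
  show "frag_eval G ?b (frag_of l) = frag_eval G a (?\<phi> (frag_of l))"
  proof (cases "l = j")
    case True
    have "frag_eval G a (?\<phi> (frag_of j)) = a j \<otimes> a i [^] e"
      using ij ij_closed
      by (subst a.add) (auto simp: frag_eval_of frag_eval_cmul_of intro!: add_subgroup_frag_cmul add_subgroup_supported_on)
    then show ?thesis
      using True ij_closed by (simp add: frag_eval_of)
  next
    case False
    then show ?thesis
      using l a by (auto simp: frag_eval_of lookup_single Pi_iff)
  qed
qed

lemma generate_transvection_subset:
  assumes a: "a \<in> I \<rightarrow> carrier G" and ij: "i \<in> I" "j \<in> I"
  shows "generate G (a(j := a j \<otimes> a i [^] (e::int)) ` I) \<subseteq> generate G (a ` I)"
proof -
  have "a ` I \<subseteq> carrier G"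
    using a by auto
  note sub = generate_is_subgroup [OF this]
  have "a l \<in> generate G (a ` I)" if "l \<in> I" for l
    using that by (auto intro: generate.incl)
  then have "a(j := a j \<otimes> a i [^] e) ` I \<subseteq> generate G (a ` I)"
    using ij subgroup.m_closed [OF sub] subgroup_int_pow_closed [OF sub] by auto
  then show ?thesis
    by (rule generate_subgroup_incl [OF _ sub])
qed

lemma generate_transvection:
  assumes a: "a \<in> I \<rightarrow> carrier G" and ij: "i \<in> I" "j \<in> I" "i \<noteq> j"
  shows "generate G (a(j := a j \<otimes> a i [^] (e::int)) ` I) = generate G (a ` I)"
proof
  define b where "b = a(j := a j \<otimes> a i [^] e)"
  have closed: "a i \<in> carrier G" "a j \<in> carrier G"
    using a ij by auto
  then have "b \<in> I \<rightarrow> carrier G"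
    using a by (auto simp: b_def Pi_iff)
  moreover have "b(j := b j \<otimes> b i [^] (- e)) = a"
    using closed ij(3) by (auto simp: b_def int_pow_neg m_assoc fun_eq_iff)
  ultimately show "generate G (a ` I) \<subseteq> generate G (a(j := a j \<otimes> a i [^] e) ` I)"
    using generate_transvection_subset [of b I i j "- e"] ij by (simp add: b_def)
qed (rule generate_transvection_subset [OF a ij(1,2)])

lemma smaller_relation:
  assumes a: "a \<in> I \<rightarrow> carrier G" and c: "c \<in> supported_on I" "frag_eval G a c = \<one>"
    and "i \<in> supp c" "j \<in> supp c" "i \<noteq> j"
  obtains b d where "b \<in> I \<rightarrow> carrier G" "generate G (b ` I) = generate G (a ` I)"
    "d \<in> supported_on I" "frag_eval G b d = \<one>" "d \<noteq> 0" "l1_norm d < l1_norm c"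
proof -
  obtain i j where ij: "i \<in> supp c" "j \<in> supp c" "i \<noteq> j"
    and le: "\<bar>Poly_Mapping.lookup c j\<bar> \<le> \<bar>Poly_Mapping.lookup c i\<bar>"
    using assms(4-6) by (metis linear)
  then have ijI: "i \<in> I" "j \<in> I"
    using c(1) by (auto simp: supported_on_def)
  define e where "e = sgn (Poly_Mapping.lookup c i) * sgn (Poly_Mapping.lookup c j)"
  define b where "b = a(j := a j \<otimes> a i [^] e)"
  define d where "d = c - frag_cmul (e * Poly_Mapping.lookup c j) (frag_of i)"
  have lookup_d: "Poly_Mapping.lookup d l =
      (if l = i then Poly_Mapping.lookup c i - e * Poly_Mapping.lookup c j else Poly_Mapping.lookup c l)" for l
    by (simp add: d_def Poly_Mapping.lookup_minus lookup_single when_def)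
  have d: "d \<in> supported_on I"
    unfolding d_def using ijI
    by (intro add_subgroup_diff add_subgroup_frag_cmul add_subgroup_supported_on c(1)) simp
  have smaller: "\<bar>Poly_Mapping.lookup d i\<bar> < \<bar>Poly_Mapping.lookup c i\<bar>"
    using ij le by (auto simp: lookup_d e_def in_keys_iff sgn_if abs_if split: if_splits)
  show thesis
  proof (rule that [OF _ _ d])
    show "b \<in> I \<rightarrow> carrier G"
      using a ijI by (auto simp: b_def Pi_iff)
    show "generate G (b ` I) = generate G (a ` I)"
      unfolding b_def by (rule generate_transvection [OF a ijI ij(3)])
    show "frag_eval G b d = \<one>"
      using frag_eval_transvection [OF a ijI d, of e] lookup_d [of j] ij(3) c(2) by (simp add: b_def d_def)
    show "d \<noteq> 0"
      using lookup_d [of j] ij by (auto simp: in_keys_iff)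
    have "l1_norm d = (\<Sum>l\<in>supp c. nat \<bar>Poly_Mapping.lookup d l\<bar>)"
      using lookup_d ij(1) by (intro l1_norm_superset) (auto simp: in_keys_iff split: if_splits)
    also have "\<dots> < l1_norm c"
      unfolding l1_norm_def using smaller lookup_d ij(1)
      by (intro sum_strict_mono_ex1) (auto intro!: bexI [of _ i])
    finally show "l1_norm d < l1_norm c" .
  qed
qed

lemma torsion_if_singleton_relation:
  assumes "a i \<in> carrier G" "supp c = {i}" "frag_eval G a c = \<one>"
  obtains k :: nat where "0 < k" "a i [^] k = \<one>"
proof -
  define n where "n = Poly_Mapping.lookup c i"
  have "a i [^] n = \<one>"
    using assms frag_eval_superset [of "{i}" c a] by (simp add: n_def)
  then have "a i [^] nat \<bar>n\<bar> = \<one>"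
    using assms(1) by (cases n rule: int_cases2) (auto simp: int_pow_int int_pow_neg)
  moreover have "0 < nat \<bar>n\<bar>"
    using assms(2) in_keys_iff [of i c] by (simp add: n_def)
  ultimately show thesis
    using that by blast
qed

text \<open>The Euclidean algorithm, applied to the coefficients of the relation.\<close>

lemma torsion_member_if_relation:
  assumes "a \<in> I \<rightarrow> carrier G" "c \<in> supported_on I" "frag_eval G a c = \<one>" "c \<noteq> 0"
  shows "\<exists>b i k. b \<in> I \<rightarrow> carrier G \<and> generate G (b ` I) = generate G (a ` I) \<and>
           i \<in> I \<and> (0::nat) < k \<and> b i [^] k = \<one>"
  using assms
proof (induction "l1_norm c" arbitrary: a c rule: less_induct)
  case less
  show ?case
  proof (cases "\<exists>i\<in>supp c. \<exists>j\<in>supp c. i \<noteq> j")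
    case True
    then obtain b d where b: "b \<in> I \<rightarrow> carrier G" "generate G (b ` I) = generate G (a ` I)"
      and d: "d \<in> supported_on I" "frag_eval G b d = \<one>" "d \<noteq> 0" "l1_norm d < l1_norm c"
      using smaller_relation [OF less.prems(1-3)] by metis
    show ?thesis
      using less.hyps [OF d(4) b(1) d(1-3)] unfolding b(2) .
  next
    case False
    moreover have "supp c \<noteq> {}"
      using less.prems(4) by simp
    ultimately obtain i where i: "supp c = {i}"
      by blast
    then have "i \<in> I"
      using supported_onD [OF less.prems(2)] by simp
    then obtain k where "0 < k" "a i [^] (k::nat) = \<one>"
      using torsion_if_singleton_relation [OF funcset_mem [OF less.prems(1)] i less.prems(3)] by blast
    then show ?thesis
      using less.prems(1) \<open>i \<in> I\<close> by blast
  qed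
qed

lemma generate_Un_cong:
  assumes "A \<subseteq> carrier G" "A' \<subseteq> carrier G" "B \<subseteq> carrier G" "generate G A = generate G A'"
  shows "generate G (A \<union> B) = generate G (A' \<union> B)"
proof -
  have incl: "generate G (A \<union> B) \<subseteq> generate G (A' \<union> B)"
    if "A \<subseteq> carrier G" "A' \<subseteq> carrier G" "generate G A = generate G A'" for A A'
  proof (rule generate_subgroup_incl)
    show "subgroup (generate G (A' \<union> B)) G"
      using that assms(3) by (intro generate_is_subgroup) auto
    have "A \<subseteq> generate G A'"
      unfolding that(3) [symmetric] by (auto intro: generate.incl)
    also have "\<dots> \<subseteq> generate G (A' \<union> B)"
      by (rule mono_generate) auto
    finally show "A \<union> B \<subseteq> generate G (A' \<union> B)"
      by (auto intro: generate.incl)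
  qed
  show ?thesis
    by (intro equalityI incl) (simp_all add: assms)
qed

lemma split_off_torsion_generator:
  assumes a: "a \<in> I \<rightarrow> carrier G" and J: "J \<subseteq> I" "\<not> independent_family G J a"
    and k: "0 < (k::nat)" "\<And>i. i \<in> I - J \<Longrightarrow> a i [^] k = \<one>"
  obtains b i l where "b \<in> I \<rightarrow> carrier G" "generate G (b ` I) = generate G (a ` I)" "i \<in> J"
    "0 < (l::nat)" "\<And>j. j \<in> I - (J - {i}) \<Longrightarrow> b j [^] l = \<one>"
proof -
  have aJ: "a \<in> J \<rightarrow> carrier G"
    using a J(1) by auto
  obtain c where "c \<in> supported_on J" "frag_eval G a c = \<one>" "c \<noteq> 0"
    using J(2) by (auto simp: independent_family_def)
  then obtain b' i l where b': "b' \<in> J \<rightarrow> carrier G" "generate G (b' ` J) = generate G (a ` J)"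
    "i \<in> J" "0 < l" "b' i [^] (l::nat) = \<one>"
    using torsion_member_if_relation [OF aJ] by blast
  define b where "b j = (if j \<in> J then b' j else a j)" for j
  have b: "b \<in> I \<rightarrow> carrier G"
    using b'(1) a by (auto simp: b_def)
  have "b ` I = b' ` J \<union> a ` (I - J)" "a ` I = a ` J \<union> a ` (I - J)"
    using J(1) by (auto simp: b_def)
  then have gen: "generate G (b ` I) = generate G (a ` I)"
    using generate_Un_cong [OF _ _ _ b'(2), of "a ` (I - J)"] b'(1) aJ a by (auto simp: Pi_iff image_subset_iff)
  have torsion: "b j [^] (l * k) = \<one>" if "j \<in> I - (J - {i})" for j
  proof (cases "j = i")
    case True
    then have "b j [^] (l * k) = (b' i [^] l) [^] k"
      using b'(1,3) by (subst nat_pow_pow) (auto simp: b_def)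
    then show ?thesis using b'(5) by simp
  next
    case False
    then have "b j [^] (l * k) = (a j [^] k) [^] l"
      using that a by (subst nat_pow_pow) (auto simp: b_def mult.commute)
    then show ?thesis using k(2) that False by simp
  qed
  show thesis
    by (rule that [OF b gen b'(3) _ torsion]) (use k(1) b'(4) in auto)
qed

lemma ex_generators_free_or_torsion:
  assumes "finite J" "a \<in> I \<rightarrow> carrier G" "J \<subseteq> I" "0 < (k::nat)" "\<And>i. i \<in> I - J \<Longrightarrow> a i [^] k = \<one>"
  shows "\<exists>b J k. b \<in> I \<rightarrow> carrier G \<and> generate G (b ` I) = generate G (a ` I) \<and> J \<subseteq> I \<and>
           independent_family G J b \<and> (0::nat) < k \<and> (\<forall>i\<in>I - J. b i [^] k = \<one>)"
  using assms
proof (induction "card J" arbitrary: J a k rule: less_induct)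
  case less
  show ?case
  proof (cases "independent_family G J a")
    case True
    then show ?thesis
      using less.prems by blast
  next
    case False
    obtain b i l where b: "b \<in> I \<rightarrow> carrier G" "generate G (b ` I) = generate G (a ` I)" "i \<in> J"
      "0 < (l::nat)" "\<And>j. j \<in> I - (J - {i}) \<Longrightarrow> b j [^] l = \<one>"
      using split_off_torsion_generator [OF less.prems(2,3) False less.prems(4,5)] by blast
    have "card (J - {i}) < card J"
      using less.prems(1) b(3) by (rule card_Diff1_less)
    then show ?thesis
      unfolding b(2) [symmetric]
      by (rule less.hyps [OF _ _ b(1) _ b(4,5)]) (use less.prems(1,3) in auto)
  qed
qed

lemma generators_free_or_torsion:
  assumes "finite S" "S \<subseteq> carrier G"
  obtains b J k where "b \<in> S \<rightarrow> carrier G" "generate G (b ` S) = generate G S" "J \<subseteq> S"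
    "independent_family G J b" "0 < (k::nat)" "\<And>i. i \<in> S - J \<Longrightarrow> b i [^] k = \<one>"
  using ex_generators_free_or_torsion [OF assms(1), of "\<lambda>s. s" S 1] assms(2) by auto blast

lemma independent_family_torsion_free:
  assumes "independent_family G J b" "b \<in> J \<rightarrow> carrier G" "c \<in> supported_on J"
    and "0 < (l::nat)" "frag_eval G b c [^] l = \<one>"
  shows "c = 0"
proof -
  have "frag_cmul (int l) c \<in> supported_on J"
    by (rule add_subgroup_frag_cmul [OF add_subgroup_supported_on assms(3)])
  moreover have "frag_eval G b (frag_cmul (int l) c) = \<one>"
    using assms(5) frag_eval_cmul [OF assms(2,3)] by simp
  ultimately have "frag_cmul (int l) c = 0"
    using assms(1) unfolding independent_family_def by blast
  then show ?thesis
    using assms(4) by simp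
qed

lemma frag_eval_pow_eq_one:
  assumes a: "a \<in> I \<rightarrow> carrier G" and k: "\<And>i. i \<in> I \<Longrightarrow> a i [^] (k::nat) = \<one>" and "c \<in> supported_on I"
  shows "frag_eval G a c [^] k = \<one>"
  using assms(3)
proof (induction rule: supported_on_induct)
  case zero
  then show ?case
    using additive_hom.zero [OF frag_eval_additive_hom [OF a]] by simp
next
  case (one i)
  then show ?case
    using k funcset_mem [OF a] by (simp add: frag_eval_of)
next
  interpret a: additive_hom "supported_on I" G "frag_eval G a"
    by (rule frag_eval_additive_hom [OF a])
  case (diff c d)
  then show ?case
    by (simp add: a.diff a.closed nat_pow_distrib nat_pow_inv)
qed

lemma torsion_exponent_if_finitely_generated:
  assumes "finite S" "S \<subseteq> carrier G" "generate G S = carrier G"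
  obtains k where "torsion_exponent G k"
proof -
  obtain b J k where b: "b \<in> S \<rightarrow> carrier G" "generate G (b ` S) = generate G S" "J \<subseteq> S"
    "independent_family G J b" "0 < (k::nat)" "\<And>i. i \<in> S - J \<Longrightarrow> b i [^] k = \<one>"
    using generators_free_or_torsion [OF assms(1,2)] by blast
  interpret b: additive_hom "supported_on S" G "frag_eval G b"
    by (rule frag_eval_additive_hom [OF b(1)])
  have "x [^] k = \<one>" if x: "x \<in> carrier G" and l: "0 < l" "x [^] l = \<one>" for x and l :: nat
  proof -
    obtain c where c: "c \<in> supported_on S" "x = frag_eval G b c"
      using x unfolding assms(3) [symmetric] b(2) [symmetric] generate_eq_frag_eval_image [OF b(1)] by blast
    have "supp c \<subseteq> J \<union> (S - J)"
      using c(1) by (auto simp: supported_on_def)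
    then obtain d e where de: "d \<in> supported_on J" "e \<in> supported_on (S - J)" "d + e = c"
      unfolding supported_on_def by (elim frag_split) auto
    then have deS: "d \<in> supported_on S" "e \<in> supported_on S"
      using b(3) by (auto elim!: supported_on_weaken)
    have "frag_eval G b e [^] k = \<one>"
      using b(1,6) by (intro frag_eval_pow_eq_one [OF _ _ de(2)]) auto
    then have pow_k: "x [^] k = frag_eval G b d [^] k"
      using deS by (simp add: c(2) de(3) [symmetric] b.add b.closed nat_pow_distrib)
    have "(x [^] k) [^] l = (x [^] l) [^] k"
      using x by (simp add: nat_pow_pow mult.commute)
    then have "frag_eval G b d [^] (k * l) = \<one>"
      using l(2) b.closed [OF deS(1)] by (simp add: pow_k nat_pow_pow)
    then have "d = 0"
      using b(1,3,5) l(1) by (intro independent_family_torsion_free [OF b(4) _ de(1), of "k * l"]) auto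
    then show ?thesis
      by (simp add: pow_k b.zero)
  qed
  then have "torsion_exponent G k"
    using b(5) by (simp add: torsion_exponent_def)
  then show thesis
    by (rule that)
qed

lemma basis_if_torsion_free:
  assumes "finite S" "S \<subseteq> carrier G"
    and torsion_free: "\<And>x k. x \<in> generate G S \<Longrightarrow> 0 < k \<Longrightarrow> x [^] (k::nat) = \<one> \<Longrightarrow> x = \<one>"
  obtains J and b :: "'a \<Rightarrow> 'a"
    where "b \<in> J \<rightarrow> carrier G" "independent_family G J b" "generate G (b ` J) = generate G S"
proof -
  obtain b J k where b: "b \<in> S \<rightarrow> carrier G" "generate G (b ` S) = generate G S" "J \<subseteq> S"
    "independent_family G J b" "0 < (k::nat)" "\<And>i. i \<in> S - J \<Longrightarrow> b i [^] k = \<one>"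
    using generators_free_or_torsion [OF assms(1,2)] by blast
  have "b i = \<one>" if i: "i \<in> S - J" for i
  proof (rule torsion_free [OF _ b(5) b(6) [OF i]])
    show "b i \<in> generate G S"
      unfolding b(2) [symmetric] using i by (intro generate.incl) auto
  qed
  then have "b i \<in> generate G (b ` J)" if "i \<in> S" for i
    using that by (cases "i \<in> J") (auto intro: generate.incl generate.one)
  then have "b ` S \<subseteq> generate G (b ` J)"
    by auto
  moreover have bJ: "b \<in> J \<rightarrow> carrier G"
    using b(1,3) by auto
  ultimately have "generate G (b ` S) \<subseteq> generate G (b ` J)"
    by (intro generate_subgroup_incl generate_is_subgroup) auto
  moreover have "generate G (b ` J) \<subseteq> generate G (b ` S)"
    using b(3) by (intro mono_generate) auto
  ultimately show thesis
    by (intro that [OF bJ b(4)]) (simp add: b(2))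
qed

lemma independent_family_inj_on:
  assumes "b \<in> J \<rightarrow> carrier G" "independent_family G J b"
  shows "inj_on (frag_eval G b) (supported_on J)"
proof
  interpret b: additive_hom "supported_on J" G "frag_eval G b"
    by (rule frag_eval_additive_hom [OF assms(1)])
  fix n m assume nm: "n \<in> supported_on J" "m \<in> supported_on J" "frag_eval G b n = frag_eval G b m"
  then have "frag_eval G b (n - m) = \<one>"
    using b.closed by (simp add: b.diff)
  then have "n - m = 0"
    using assms(2) add_subgroup_diff [OF add_subgroup_supported_on nm(1,2)] unfolding independent_family_def by blast
  then show "n = m" by simp
qed

lemma independent_family_lift:
  assumes b: "b \<in> J \<rightarrow> carrier G" "independent_family G J b"
    and L: "comm_group L" and \<pi>: "\<pi> \<in> hom L G" "\<pi> ` carrier L = carrier G"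
  obtains f where "f \<in> hom (G\<lparr>carrier := generate G (b ` J)\<rparr>) L" "\<And>x. x \<in> generate G (b ` J) \<Longrightarrow> \<pi> (f x) = x"
proof -
  interpret L: comm_group L by (rule L)
  have "\<forall>j\<in>J. \<exists>y. y \<in> carrier L \<and> \<pi> y = b j"
    using b(1) \<pi>(2) by (metis Pi_iff imageE)
  then obtain c where c: "\<And>j. j \<in> J \<Longrightarrow> c j \<in> carrier L" "\<And>j. j \<in> J \<Longrightarrow> \<pi> (c j) = b j"
    by metis
  interpret b: additive_hom "supported_on J" G "frag_eval G b"
    by (rule frag_eval_additive_hom [OF b(1)])
  interpret c: additive_hom "supported_on J" L "frag_eval L c"
    using c(1) by (intro L.frag_eval_additive_hom) auto
  have lift: "\<pi> (frag_eval L c n) = frag_eval G b n" if "n \<in> supported_on J" for n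
  proof (rule additive_hom_eq_on_supported_on [OF c.compose b.additive_hom_axioms _ that])
    show "group_hom L G \<pi>"
      using \<pi>(1) by unfold_locales
    show "\<pi> (frag_eval L c (frag_of j)) = frag_eval G b (frag_of j)" if "j \<in> J" for j
      using that c funcset_mem [OF b(1)] by (simp add: frag_eval_of L.frag_eval_of)
  qed
  define \<nu> where "\<nu> = inv_into (supported_on J) (frag_eval G b)"
  have \<nu>: "\<nu> x \<in> supported_on J" "frag_eval G b (\<nu> x) = x" if "x \<in> generate G (b ` J)" for x
    using that unfolding \<nu>_def generate_eq_frag_eval_image [OF b(1)] by (rule inv_into_into, rule f_inv_into_f)
  have "\<nu> (x \<otimes> y) = \<nu> x + \<nu> y" if xy: "x \<in> generate G (b ` J)" "y \<in> generate G (b ` J)" for x y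
  proof (rule inj_onD [OF independent_family_inj_on [OF b]])
    have "x \<otimes> y \<in> generate G (b ` J)"
      using xy by (rule generate.eng)
    then show "\<nu> (x \<otimes> y) \<in> supported_on J" "frag_eval G b (\<nu> (x \<otimes> y)) = frag_eval G b (\<nu> x + \<nu> y)"
      using \<nu> xy by (auto simp: b.add)
    show "\<nu> x + \<nu> y \<in> supported_on J"
      using \<nu>(1) xy by (intro add_subgroup_add add_subgroup_supported_on)
  qed
  then have "(\<lambda>x. frag_eval L c (\<nu> x)) \<in> hom (G\<lparr>carrier := generate G (b ` J)\<rparr>) L"
    by (intro homI) (auto simp: c.closed c.add \<nu>(1))
  then show thesis
    using that lift \<nu> by simp
qed

lemma power_map_lift:
  assumes S: "finite S" "S \<subseteq> carrier G"
    and L: "comm_group L" and \<pi>: "\<pi> \<in> hom L G" "\<pi> ` carrier L = carrier G"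
    and m: "torsion_exponent G m"
  obtains \<psi> where "\<psi> \<in> hom (G\<lparr>carrier := generate G S\<rparr>) L" "\<And>y. y \<in> generate G S \<Longrightarrow> \<pi> (\<psi> y) = y [^] m"
proof -
  define H where "H = generate G S"
  define P where "P = generate G ((\<lambda>s. s [^] m) ` S)"
  have H: "H \<subseteq> carrier G"
    unfolding H_def by (rule generate_incl [OF S(2)])
  have "group_hom G G (\<lambda>x. x [^] m)"
    by unfold_locales (auto simp: hom_def nat_pow_distrib)
  then have P_eq: "P = (\<lambda>x. x [^] m) ` H"
    unfolding P_def H_def by (rule group_hom.generate_img [OF _ S(2)])
  have "x = \<one>" if x: "x \<in> P" and k: "0 < k" "x [^] (k::nat) = \<one>" for x k
  proof -
    obtain y where y: "y \<in> carrier G" "x = y [^] m"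
      using x H unfolding P_eq by auto
    then have "y [^] (m * k) = \<one>"
      using k by (simp add: nat_pow_pow)
    then show ?thesis
      using m y k(1) unfolding torsion_exponent_def by (metis nat_0_less_mult_iff)
  qed
  moreover have "finite ((\<lambda>s. s [^] m) ` S)" "(\<lambda>s. s [^] m) ` S \<subseteq> carrier G"
    using S by auto
  ultimately obtain J and b :: "'a \<Rightarrow> 'a"
    where b: "b \<in> J \<rightarrow> carrier G" "independent_family G J b" "generate G (b ` J) = P"
    using basis_if_torsion_free unfolding P_def by metis
  obtain f where f: "f \<in> hom (G\<lparr>carrier := P\<rparr>) L" "\<And>x. x \<in> P \<Longrightarrow> \<pi> (f x) = x"
    using independent_family_lift [OF b(1,2) L \<pi>] unfolding b(3) by blast
  have "(\<lambda>y. y [^] m) \<in> hom (G\<lparr>carrier := H\<rparr>) (G\<lparr>carrier := P\<rparr>)"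
    using H by (intro homI) (auto simp: P_eq nat_pow_distrib subset_iff)
  from Group.hom_compose [OF this f(1)]
  have "f \<circ> (\<lambda>y. y [^] m) \<in> hom (G\<lparr>carrier := H\<rparr>) L" .
  then show thesis
    by (rule that [unfolded H_def [symmetric]]) (simp add: f(2) P_eq)
qed

end

subsection \<open>Lifting cycles\<close>

lemma bar_cycles_subgroup:
  assumes "c \<in> carrier (bar_cycles n G)" "\<And>xs. xs \<in> supp c \<Longrightarrow> set xs \<subseteq> H"
  shows "c \<in> carrier (bar_cycles n (G\<lparr>carrier := H\<rparr>))"
proof -
  have "bar_face (G\<lparr>carrier := H\<rparr>) i xs = bar_face G i xs" for i xs
    by (auto simp: bar_face_def)
  then have "bar_boundary n (G\<lparr>carrier := H\<rparr>) c = bar_boundary n G c"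
    by (simp add: bar_boundary_def)
  then show ?thesis
    using assms bar_cycles_supp(1) [OF assms(1)] by (auto simp: bar_cycles_carrier supported_on_def)
qed

context bar_comm_group
begin

lemma power_map_liftable:
  assumes L: "comm_group L" and \<pi>: "\<pi> \<in> hom L G" "\<pi> ` carrier L = carrier G"
    and m: "torsion_exponent G m" and c: "c \<in> carrier (bar_cycles n G)"
  shows "bar_map (\<lambda>a. a [^] (j * m)) c \<in> liftable_cycles n L G \<pi>"
proof -
  interpret L: comm_group L by (rule L)
  interpret \<pi>: group_hom L G \<pi>
    using \<pi>(1) by unfold_locales
  define S where "S = (\<Union>xs\<in>supp c. set xs)"
  have S: "finite S" "S \<subseteq> carrier G"
    using bar_cycles_supp(2) [OF c] by (auto simp: S_def)
  obtain \<psi> where \<psi>: "\<psi> \<in> hom (G\<lparr>carrier := generate G S\<rparr>) L" "\<And>y. y \<in> generate G S \<Longrightarrow> \<pi> (\<psi> y) = y [^] m"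
    using power_map_lift [OF S L \<pi> m] by blast
  have in_S: "y \<in> generate G S" if "xs \<in> supp c" "y \<in> set xs" for xs y
    using that by (auto simp: S_def intro: generate.incl)
  then have "c \<in> carrier (bar_cycles n (G\<lparr>carrier := generate G S\<rparr>))"
    by (intro bar_cycles_subgroup [OF c]) auto
  then have "bar_map \<psi> c \<in> carrier (bar_cycles n L)"
    by (rule bar_map_bar_cycles [OF \<psi>(1)])
  moreover have "(\<lambda>x. x [^]\<^bsub>L\<^esub> j) \<in> hom L L"
    by (auto simp: hom_def L.nat_pow_distrib)
  ultimately have "bar_map (\<lambda>x. x [^]\<^bsub>L\<^esub> j) (bar_map \<psi> c) \<in> carrier (bar_cycles n L)"
    using bar_map_bar_cycles by blast
  then have "bar_map \<pi> (bar_map (\<lambda>x. x [^]\<^bsub>L\<^esub> j) (bar_map \<psi> c)) \<in> liftable_cycles n L G \<pi>"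
    by (rule bar_map_liftable)
  also have "bar_map \<pi> (bar_map (\<lambda>x. x [^]\<^bsub>L\<^esub> j) (bar_map \<psi> c)) = bar_map (\<lambda>a. a [^] (j * m)) c"
    unfolding bar_map_bar_map
  proof (intro bar_map_cong map_cong refl)
    fix xs y assume y: "xs \<in> supp c" "y \<in> set xs"
    have "\<psi> y \<in> carrier L"
      using hom_in_carrier [OF \<psi>(1)] in_S [OF y] by simp
    then have "\<pi> (\<psi> y [^]\<^bsub>L\<^esub> j) = (y [^] m) [^] j"
      using \<psi>(2) [OF in_S [OF y]] by (simp add: \<pi>.hom_nat_pow)
    then show "\<pi> (\<psi> y [^]\<^bsub>L\<^esub> j) = y [^] (j * m)"
      using bar_cycles_supp(2) [OF c y(1)] y(2) by (auto simp: nat_pow_pow mult.commute)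
  qed
  finally show ?thesis .
qed

theorem bounded_torsion_liftable:
  assumes L: "comm_group L" and \<pi>: "\<pi> \<in> hom L G" "\<pi> ` carrier L = carrier G"
    and m: "torsion_exponent G m" and c: "c \<in> carrier (bar_cycles n G)" and n: "n \<noteq> 0"
  shows "frag_cmul (int m ^ (\<Sum>i\<le>n. i)) c \<in> liftable_cycles n L G \<pi>"
proof -
  define S where "S = liftable_cycles n L G \<pi>"
  define f where "f x = bar_map (\<lambda>a. a [^] (x::nat)) c" for x
  have S: "add_subgroup S"
    unfolding S_def by (rule add_subgroup_liftable)
  have "(step_diff 1 ^^ Suc n) f x \<in> S" for x
  proof -
    have "alternating (\<lambda>T. f (card T + x)) {..<Suc n} \<in> S"
      using alternating_power_map_boundary [OF c n, of x] bar_boundaries_liftable unfolding f_def S_def by blast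
    then have "frag_cmul ((-1) ^ Suc n) (frag_cmul ((-1) ^ Suc n) ((step_diff 1 ^^ Suc n) f x)) \<in> S"
      unfolding alternating_step_diff by (rule add_subgroup_frag_cmul [OF S])
    then show ?thesis
      by (simp flip: power_add del: funpow.simps)
  qed
  moreover have "f (j * m) \<in> S" for j
    unfolding f_def S_def by (rule power_map_liftable [OF L \<pi> m c])
  ultimately have "frag_cmul (int m ^ (\<Sum>i\<le>n. i)) (f 1) \<in> S"
    by (rule polynomial_mem_if_multiples_mem [OF S])
  moreover have "f 1 = c"
    unfolding f_def using bar_cycles_supp(2) [OF c] by (intro bar_map_ident map_idI) (auto simp: subset_iff)
  ultimately show ?thesis
    by (simp add: S_def)
qed

end

section \<open>The second homology group\<close>

text \<open>The cocycle \<open>u\<close> is not assumed to be normalised, hence the shifted unit.\<close>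

definition twisted_product :: "'q monoid \<Rightarrow> 'a monoid \<Rightarrow> ('a \<Rightarrow> 'a \<Rightarrow> 'q) \<Rightarrow> ('q \<times> 'a) monoid" where
  "twisted_product Q G u =
     \<lparr>carrier = carrier Q \<times> carrier G,
      monoid.mult = (\<lambda>x y. (fst x \<otimes>\<^bsub>Q\<^esub> fst y \<otimes>\<^bsub>Q\<^esub> u (snd x) (snd y), snd x \<otimes>\<^bsub>G\<^esub> snd y)),
      one = (inv\<^bsub>Q\<^esub> (u \<one>\<^bsub>G\<^esub> \<one>\<^bsub>G\<^esub>), \<one>\<^bsub>G\<^esub>)\<rparr>"

locale symmetric_cocycle = Q: comm_group Q + G: comm_group G for Q :: "'q monoid" (structure) and G :: "'a monoid" +
  fixes u :: "'a \<Rightarrow> 'a \<Rightarrow> 'q"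
  assumes u_closed: "a \<in> carrier G \<Longrightarrow> b \<in> carrier G \<Longrightarrow> u a b \<in> carrier Q"
    and u_commute: "a \<in> carrier G \<Longrightarrow> b \<in> carrier G \<Longrightarrow> u a b = u b a"
    and u_cocycle: "a \<in> carrier G \<Longrightarrow> b \<in> carrier G \<Longrightarrow> c \<in> carrier G \<Longrightarrow>
      u a b \<otimes> u (a \<otimes>\<^bsub>G\<^esub> b) c = u b c \<otimes> u a (b \<otimes>\<^bsub>G\<^esub> c)"
begin

abbreviation E :: "('q \<times> 'a) monoid" where
  "E \<equiv> twisted_product Q G u"

lemma u_one: "a \<in> carrier G \<Longrightarrow> u \<one>\<^bsub>G\<^esub> a = u \<one>\<^bsub>G\<^esub> \<one>\<^bsub>G\<^esub>"
  using u_cocycle [of "\<one>\<^bsub>G\<^esub>" "\<one>\<^bsub>G\<^esub>" a] u_closed by simp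

lemma carrier_E: "x \<in> carrier E \<longleftrightarrow> fst x \<in> carrier Q \<and> snd x \<in> carrier G"
  and mult_E: "x \<otimes>\<^bsub>E\<^esub> y = (fst x \<otimes> fst y \<otimes> u (snd x) (snd y), snd x \<otimes>\<^bsub>G\<^esub> snd y)"
  and one_E: "\<one>\<^bsub>E\<^esub> = (inv (u \<one>\<^bsub>G\<^esub> \<one>\<^bsub>G\<^esub>), \<one>\<^bsub>G\<^esub>)"
  by (simp_all add: twisted_product_def mem_Times_iff)

lemma E_assoc:
  assumes "x \<in> carrier E" "y \<in> carrier E" "z \<in> carrier E"
  shows "x \<otimes>\<^bsub>E\<^esub> y \<otimes>\<^bsub>E\<^esub> z = x \<otimes>\<^bsub>E\<^esub> (y \<otimes>\<^bsub>E\<^esub> z)"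
proof -
  note xyz = assms [unfolded carrier_E]
  have "fst x \<otimes> fst y \<otimes> u (snd x) (snd y) \<otimes> fst z \<otimes> u (snd x \<otimes>\<^bsub>G\<^esub> snd y) (snd z) =
      fst x \<otimes> fst y \<otimes> fst z \<otimes> (u (snd x) (snd y) \<otimes> u (snd x \<otimes>\<^bsub>G\<^esub> snd y) (snd z))"
    using xyz by (simp add: u_closed Q.m_ac)
  also have "\<dots> = fst x \<otimes> (fst y \<otimes> fst z \<otimes> u (snd y) (snd z)) \<otimes> u (snd x) (snd y \<otimes>\<^bsub>G\<^esub> snd z)"
    using xyz by (subst u_cocycle) (simp_all add: u_closed Q.m_ac)
  finally show ?thesis
    using xyz by (simp add: mult_E G.m_assoc)
qed

lemma comm_group_E: "comm_group E"
proof (rule comm_groupI)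
  fix x y z assume x: "x \<in> carrier E" and y: "y \<in> carrier E" and z: "z \<in> carrier E"
  note xyz = x [unfolded carrier_E] y [unfolded carrier_E] z [unfolded carrier_E]
  show "x \<otimes>\<^bsub>E\<^esub> y \<in> carrier E"
    using xyz by (simp add: carrier_E mult_E u_closed)
  show "x \<otimes>\<^bsub>E\<^esub> y = y \<otimes>\<^bsub>E\<^esub> x"
    using xyz u_commute [of "snd x" "snd y"] by (simp add: mult_E Q.m_comm G.m_comm)
  show "x \<otimes>\<^bsub>E\<^esub> y \<otimes>\<^bsub>E\<^esub> z = x \<otimes>\<^bsub>E\<^esub> (y \<otimes>\<^bsub>E\<^esub> z)"
    using x y z by (rule E_assoc)
next
  show "\<one>\<^bsub>E\<^esub> \<in> carrier E"
    by (simp add: carrier_E one_E u_closed)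
  fix x assume x: "x \<in> carrier E"
  note x = x [unfolded carrier_E]
  show "\<one>\<^bsub>E\<^esub> \<otimes>\<^bsub>E\<^esub> x = x"
    using x u_one [of "snd x"] Q.m_comm [of _ "fst x"] by (simp add: mult_E one_E u_closed Q.m_assoc)
  define v w where "v = u (inv\<^bsub>G\<^esub> (snd x)) (snd x)" and "w = u \<one>\<^bsub>G\<^esub> \<one>\<^bsub>G\<^esub>"
  define y where "y = (inv (fst x) \<otimes> inv v \<otimes> inv w, inv\<^bsub>G\<^esub> (snd x))"
  have vw: "v \<in> carrier Q" "w \<in> carrier Q" using x by (simp_all add: v_def w_def u_closed)
  have "inv (fst x) \<otimes> inv v \<otimes> inv w \<otimes> fst x \<otimes> v =
      (inv (fst x) \<otimes> fst x) \<otimes> (inv v \<otimes> v) \<otimes> inv w"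
    using x vw by (simp only: Q.m_ac Q.inv_closed Q.m_closed)
  then have "y \<otimes>\<^bsub>E\<^esub> x = \<one>\<^bsub>E\<^esub>"
    using x vw by (simp add: y_def mult_E one_E v_def [symmetric] w_def [symmetric])
  moreover have "y \<in> carrier E"
    using x vw by (simp add: y_def carrier_E v_def [symmetric] w_def [symmetric])
  ultimately show "\<exists>y\<in>carrier E. y \<otimes>\<^bsub>E\<^esub> x = \<one>\<^bsub>E\<^esub>" by blast
qed

definition inclusion :: "'q \<Rightarrow> 'q \<times> 'a" where
  "inclusion q = (q \<otimes> inv (u \<one>\<^bsub>G\<^esub> \<one>\<^bsub>G\<^esub>), \<one>\<^bsub>G\<^esub>)"

lemma inclusion_hom: "group_hom Q E inclusion"
proof (intro group_hom.intro group_hom_axioms.intro Q.is_group homI)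
  show "group E"
    using comm_group_E by (simp add: comm_group_def)
  define w where "w = u \<one>\<^bsub>G\<^esub> \<one>\<^bsub>G\<^esub>"
  have w: "w \<in> carrier Q" by (simp add: w_def u_closed)
  fix x assume x: "x \<in> carrier Q"
  then show "inclusion x \<in> carrier E"
    by (simp add: inclusion_def carrier_E u_closed)
  fix y assume y: "y \<in> carrier Q"
  have "x \<otimes> inv w \<otimes> (y \<otimes> inv w) \<otimes> w = x \<otimes> y \<otimes> inv w \<otimes> (inv w \<otimes> w)"
    using x y w by (simp only: Q.m_ac Q.inv_closed Q.m_closed)
  then show "inclusion (x \<otimes> y) = inclusion x \<otimes>\<^bsub>E\<^esub> inclusion y"
    using x y w by (simp add: inclusion_def mult_E w_def [symmetric])
qed

lemma inclusion_eq_one_iff: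
  assumes "q \<in> carrier Q"
  shows "inclusion q = \<one>\<^bsub>E\<^esub> \<longleftrightarrow> q = \<one>"
  using assms by (simp add: inclusion_def one_E u_closed)

lemma section_mult:
  assumes "a \<in> carrier G" "b \<in> carrier G"
  shows "(\<one>, a) \<otimes>\<^bsub>E\<^esub> (\<one>, b) = inclusion (u a b) \<otimes>\<^bsub>E\<^esub> (\<one>, a \<otimes>\<^bsub>G\<^esub> b)"
  using assms u_one [of "a \<otimes>\<^bsub>G\<^esub> b"] by (simp add: inclusion_def mult_E u_closed Q.m_assoc)

end

lemma bar_boundary_edge_pair:
  "bar_boundary 2 G (frag_of [a, b]) = (frag_of [a] + frag_of [b]) - frag_of [a \<otimes>\<^bsub>G\<^esub> b]"
  by (simp add: bar_boundary_def bar_face_def numeral_2_eq_2 atMost_Suc)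

lemma bar_boundary_triple:
  "bar_boundary 3 G (frag_of [a, b, c]) =
     (frag_of [b, c] + frag_of [a, b \<otimes>\<^bsub>G\<^esub> c]) - (frag_of [a, b] + frag_of [a \<otimes>\<^bsub>G\<^esub> b, c])"
  by (simp add: bar_boundary_def bar_face_def numeral_2_eq_2 numeral_3_eq_3 atMost_Suc)

context symmetric_cocycle
begin

definition section_hom :: "'a chain \<Rightarrow> 'q \<times> 'a" where
  "section_hom = frag_eval E (\<lambda>xs. (\<one>, hd xs))"

lemma section_hom_hom: "additive_hom (supported_on (bar_simplices 1 G)) E section_hom"
  unfolding section_hom_def
  by (rule comm_group.frag_eval_additive_hom [OF comm_group_E]) (auto simp: carrier_E length_Suc_conv)

lemma section_hom_of: "a \<in> carrier G \<Longrightarrow> section_hom (frag_of [a]) = (\<one>, a)"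
  using comm_group.frag_eval_of [OF comm_group_E, of "\<lambda>xs. (\<one>, hd xs)" "[a]"]
  by (simp add: section_hom_def carrier_E)

lemma section_hom_boundary:
  assumes ab: "a \<in> carrier G" "b \<in> carrier G"
  shows "section_hom (bar_boundary 2 G (frag_of [a, b])) = inclusion (u a b)"
proof -
  interpret E: comm_group E by (rule comm_group_E)
  interpret \<theta>: additive_hom "supported_on (bar_simplices 1 G)" E section_hom
    by (rule section_hom_hom)
  interpret \<iota>: group_hom Q E inclusion by (rule inclusion_hom)
  have edge: "frag_of [x] \<in> supported_on (bar_simplices 1 G)" if "x \<in> carrier G" for x
    using that by simp
  have "section_hom (frag_of [a] + frag_of [b]) = inclusion (u a b) \<otimes>\<^bsub>E\<^esub> section_hom (frag_of [a \<otimes>\<^bsub>G\<^esub> b])"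
    using ab section_mult [OF ab] by (simp only: \<theta>.add edge section_hom_of G.m_closed)
  moreover have "section_hom (bar_boundary 2 G (frag_of [a, b])) =
      section_hom (frag_of [a] + frag_of [b]) \<otimes>\<^bsub>E\<^esub> inv\<^bsub>E\<^esub> (section_hom (frag_of [a \<otimes>\<^bsub>G\<^esub> b]))"
    unfolding bar_boundary_edge_pair using ab
    by (intro \<theta>.diff add_subgroup_add add_subgroup_supported_on edge) auto
  ultimately show ?thesis
    using \<iota>.hom_closed [OF u_closed [OF ab]] \<theta>.closed [OF edge] ab by (simp add: E.m_assoc)
qed

end

context bar_comm_group
begin

lemma symmetric_cocycle_of_hom:
  fixes Q :: "'q monoid"
  assumes Q: "comm_group Q" and \<kappa>: "additive_hom (supported_on (bar_simplices 2 G)) Q \<kappa>"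
    and boundary: "\<And>b. b \<in> bar_boundaries 2 G \<Longrightarrow> \<kappa> b = \<one>\<^bsub>Q\<^esub>"
    and commute: "\<And>a b. a \<in> carrier G \<Longrightarrow> b \<in> carrier G \<Longrightarrow> \<kappa> (frag_of [a, b]) = \<kappa> (frag_of [b, a])"
  shows "symmetric_cocycle Q G (\<lambda>a b. \<kappa> (frag_of [a, b]))"
proof (intro symmetric_cocycle.intro symmetric_cocycle_axioms.intro Q comm_group_axioms commute)
  interpret Q: comm_group Q by (rule Q)
  interpret \<kappa>: additive_hom "supported_on (bar_simplices 2 G)" Q \<kappa> by (rule \<kappa>)
  have simplex: "frag_of [a, b] \<in> supported_on (bar_simplices 2 G)" if "a \<in> carrier G" "b \<in> carrier G" for a b
    using that by simp
  show "\<kappa> (frag_of [a, b]) \<in> carrier Q" if "a \<in> carrier G" "b \<in> carrier G" for a b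
    by (rule \<kappa>.closed [OF simplex [OF that]])
  fix a b c assume abc: "a \<in> carrier G" "b \<in> carrier G" "c \<in> carrier G"
  have sums: "frag_of [b, c] + frag_of [a, b \<otimes> c] \<in> supported_on (bar_simplices 2 G)"
    "frag_of [a, b] + frag_of [a \<otimes> b, c] \<in> supported_on (bar_simplices 2 G)"
    using abc by (auto intro!: add_subgroup_add [OF add_subgroup_supported_on])
  have "frag_of [a, b, c] \<in> carrier (bar_chains 3 G)"
    using abc by (simp add: carrier_bar_chains)
  then have "bar_boundary 3 G (frag_of [a, b, c]) \<in> bar_boundaries 2 G"
    unfolding bar_boundaries_def by (simp add: numeral_3_eq_3 numeral_2_eq_2)
  then have "\<kappa> (frag_of [b, c] + frag_of [a, b \<otimes> c]) \<otimes>\<^bsub>Q\<^esub> inv\<^bsub>Q\<^esub> \<kappa> (frag_of [a, b] + frag_of [a \<otimes> b, c]) = \<one>\<^bsub>Q\<^esub>"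
    using boundary sums by (simp add: bar_boundary_triple \<kappa>.diff [symmetric])
  then have "\<kappa> (frag_of [b, c] + frag_of [a, b \<otimes> c]) = \<kappa> (frag_of [a, b] + frag_of [a \<otimes> b, c])"
    using sums \<kappa>.closed Q.inv_solve_right' by fastforce
  then show "\<kappa> (frag_of [a, b]) \<otimes>\<^bsub>Q\<^esub> \<kappa> (frag_of [a \<otimes> b, c]) = \<kappa> (frag_of [b, c]) \<otimes>\<^bsub>Q\<^esub> \<kappa> (frag_of [a, b \<otimes> c])"
    using abc by (simp add: \<kappa>.add)
qed

text \<open>
  The symbols \<open>[a|b]\<close> are mapped to a symmetric cocycle, which defines an abelian extension \<open>E\<close> of \<open>G\<close>
  by \<open>Q\<close>. The homomorphism from the 1-chains to \<open>E\<close> given by the section extends the inclusion of \<open>Q\<close>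
  along the boundary map, so that \<open>\<kappa>\<close> is trivial on cycles.
\<close>

lemma hom_trivial_on_two_cycles:
  fixes Q :: "'q monoid"
  assumes Q: "comm_group Q" and \<kappa>: "additive_hom (supported_on (bar_simplices 2 G)) Q \<kappa>"
    and boundary: "\<And>b. b \<in> bar_boundaries 2 G \<Longrightarrow> \<kappa> b = \<one>\<^bsub>Q\<^esub>"
    and commute: "\<And>a b. a \<in> carrier G \<Longrightarrow> b \<in> carrier G \<Longrightarrow> \<kappa> (frag_of [a, b]) = \<kappa> (frag_of [b, a])"
    and c: "c \<in> carrier (bar_cycles 2 G)"
  shows "\<kappa> c = \<one>\<^bsub>Q\<^esub>"
proof -
  interpret \<kappa>: additive_hom "supported_on (bar_simplices 2 G)" Q \<kappa> by (rule \<kappa>)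
  interpret symmetric_cocycle Q G "\<lambda>a b. \<kappa> (frag_of [a, b])"
    by (rule symmetric_cocycle_of_hom [OF Q \<kappa> boundary commute])
  interpret \<theta>: additive_hom "supported_on (bar_simplices 1 G)" E section_hom
    by (rule section_hom_hom)
  have c_supp: "c \<in> supported_on (bar_simplices 2 G)"
    using c by (simp add: bar_cycles_carrier)
  have boundary_closed: "bar_boundary 2 G x \<in> supported_on (bar_simplices 1 G)"
    if "x \<in> supported_on (bar_simplices 2 G)" for x
    using bar_boundary_supported_on [of x 1] that by (simp add: numeral_2_eq_2)
  have "section_hom (bar_boundary 2 G c) = inclusion (\<kappa> c)"
  proof (rule additive_hom_eq_on_supported_on [OF _ \<kappa>.compose [OF inclusion_hom] _ c_supp])
    show "additive_hom (supported_on (bar_simplices 2 G)) E (\<lambda>x. section_hom (bar_boundary 2 G x))"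
      using comm_group_E boundary_closed
      by (intro additive_homI add_subgroup_supported_on) (auto simp: bar_boundary_add comm_group_def intro: \<theta>.closed \<theta>.add)
    show "section_hom (bar_boundary 2 G (frag_of xs)) = inclusion (\<kappa> (frag_of xs))"
      if "xs \<in> bar_simplices 2 G" for xs
      using that section_hom_boundary by (auto simp: numeral_2_eq_2 length_Suc_conv)
  qed
  then have "inclusion (\<kappa> c) = \<one>\<^bsub>E\<^esub>"
    using c \<theta>.zero by (simp add: bar_cycles_carrier)
  then show ?thesis
    using inclusion_eq_one_iff \<kappa>.closed [OF c_supp] by simp
qed

theorem two_cycles_generated:
  assumes S: "add_subgroup S" "S \<subseteq> supported_on (bar_simplices 2 G)"
    and boundaries: "bar_boundaries 2 G \<subseteq> S"
    and commutators: "\<And>a b. a \<in> carrier G \<Longrightarrow> b \<in> carrier G \<Longrightarrow> frag_of [a, b] - frag_of [b, a] \<in> S"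
    and c: "c \<in> carrier (bar_cycles 2 G)"
  shows "c \<in> S"
proof -
  define C where "C = (supported_on (bar_simplices 2 G) :: 'a chain set)"
  have C: "add_subgroup C"
    unfolding C_def by (rule add_subgroup_supported_on)
  interpret F: comm_group "additive_monoid C"
    by (rule comm_group_additive_monoid [OF C])
  have sub: "subgroup S (additive_monoid C)"
    using S by (intro subgroup_additive_monoid C) (simp_all add: C_def)
  define Q where "Q = additive_monoid C Mod S"
  define \<kappa> where "\<kappa> = (#>\<^bsub>additive_monoid C\<^esub>) S"
  have Q: "comm_group Q"
    unfolding Q_def by (rule F.abelian_FactGroup [OF sub])
  have \<kappa>: "additive_hom C Q \<kappa>"
    using F.coset_map_hom [OF sub] C Q
    by (simp add: additive_hom_def additive_hom_axioms_def group_hom_def group_hom_axioms_def Q_def \<kappa>_def comm_group_def)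
  have \<kappa>_one: "\<kappa> x = \<one>\<^bsub>Q\<^esub> \<longleftrightarrow> x \<in> S" if "x \<in> C" for x
    using F.coset_map_eq_one_iff [OF sub] that by (simp add: \<kappa>_def Q_def)
  have "\<kappa> c = \<one>\<^bsub>Q\<^esub>"
  proof (rule hom_trivial_on_two_cycles [OF Q \<kappa> [unfolded C_def] _ _ c])
    show "\<kappa> b = \<one>\<^bsub>Q\<^esub>" if "b \<in> bar_boundaries 2 G" for b
      using that boundaries S(2) \<kappa>_one by (auto simp: C_def)
    interpret Q: comm_group Q by (rule Q)
    interpret \<kappa>: additive_hom C Q \<kappa> by (rule \<kappa>)
    fix a b assume ab: "a \<in> carrier G" "b \<in> carrier G"
    then have simplices: "frag_of [a, b] \<in> C" "frag_of [b, a] \<in> C"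
      by (simp_all add: C_def)
    then have "\<kappa> (frag_of [a, b]) \<otimes>\<^bsub>Q\<^esub> inv\<^bsub>Q\<^esub> \<kappa> (frag_of [b, a]) = \<one>\<^bsub>Q\<^esub>"
      using \<kappa>_one [OF add_subgroup_diff [OF C simplices]] commutators [OF ab] by (simp add: \<kappa>.diff)
    then show "\<kappa> (frag_of [a, b]) = \<kappa> (frag_of [b, a])"
      using simplices \<kappa>.closed Q.inv_solve_right' by fastforce
  qed
  then show ?thesis
    using \<kappa>_one [of c] c by (simp add: C_def bar_cycles_carrier)
qed

lemma commutator_cycle:
  assumes "a \<in> carrier G" "b \<in> carrier G"
  shows "frag_of [a, b] - frag_of [b, a] \<in> carrier (bar_cycles 2 G)"
  using assms m_comm [OF assms]
  by (auto simp: bar_cycles_carrier bar_boundary_diff bar_boundary_edge_pair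
      intro!: add_subgroup_diff [OF add_subgroup_supported_on])

theorem two_cycles_liftable:
  assumes L: "comm_group L" and \<pi>: "\<pi> \<in> hom L G" "\<pi> ` carrier L = carrier G"
    and c: "c \<in> carrier (bar_cycles 2 G)"
  shows "c \<in> liftable_cycles 2 L G \<pi>"
proof (rule two_cycles_generated [OF add_subgroup_liftable _ bar_boundaries_liftable _ c])
  interpret L: bar_comm_group L using L by (simp add: bar_comm_group_def)
  show "liftable_cycles 2 L G \<pi> \<subseteq> supported_on (bar_simplices 2 G)"
    using liftable_cycles_subset [OF \<pi>(1), of 2] by (simp add: subset_iff bar_cycles_carrier)
  fix a b assume "a \<in> carrier G" "b \<in> carrier G"
  then obtain x y where xy: "x \<in> carrier L" "y \<in> carrier L" "\<pi> x = a" "\<pi> y = b"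
    unfolding \<pi>(2) [symmetric] by blast
  then have "bar_map \<pi> (frag_of [x, y] - frag_of [y, x]) = frag_of [a, b] - frag_of [b, a]"
    by (simp add: bar_map_diff)
  then show "frag_of [a, b] - frag_of [b, a] \<in> liftable_cycles 2 L G \<pi>"
    using bar_map_liftable [OF L.commutator_cycle [OF xy(1,2)], of \<pi> G] by simp
qed

end

section \<open>Towers of epimorphisms\<close>

lemma inv_limit_element_through:
  assumes "\<And>k. p k ` carrier (A (Suc k)) = carrier (A k)" "a \<in> carrier (A i)"
  shows "\<exists>x\<in>carrier (inv_limit A p). x i = a"
  using assms
proof (induction i arbitrary: A p)
  case 0
  have "\<exists>x. \<forall>k. (x k \<in> carrier (A k) \<and> (k = 0 \<longrightarrow> x k = a)) \<and> p k (x (Suc k)) = x k"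
  proof (rule dependent_nat_choice)
    show "\<exists>y. (y \<in> carrier (A (Suc k)) \<and> (Suc k = 0 \<longrightarrow> y = a)) \<and> p k y = z"
      if "z \<in> carrier (A k) \<and> (k = 0 \<longrightarrow> z = a)" for z k
      using that 0(1) [of k] by (metis imageE nat.simps(3))
  qed (use 0(2) in auto)
  then show ?case
    by (auto simp: mem_inv_limit)
next
  case (Suc i)
  have "\<exists>x\<in>carrier (inv_limit (\<lambda>k. A (Suc k)) (\<lambda>k. p (Suc k))). x i = a"
    by (rule Suc.IH) (rule Suc.prems)+
  then obtain x where x: "x \<in> carrier (inv_limit (\<lambda>k. A (Suc k)) (\<lambda>k. p (Suc k)))" "x i = a"
    by blast
  define y where "y = case_nat (p 0 (x 0)) x"
  have xk: "x k \<in> carrier (A (Suc k))" "p (Suc k) (x (Suc k)) = x k" for k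
    using x(1) by (auto simp: mem_inv_limit)
  have "p 0 (x 0) \<in> p 0 ` carrier (A (Suc 0))"
    by (rule imageI [OF xk(1)])
  then have "p 0 (x 0) \<in> carrier (A 0)"
    by (simp only: Suc.prems(1))
  then have "y k \<in> carrier (A k) \<and> p k (y (Suc k)) = y k" for k
    by (cases k) (simp_all add: y_def xk)
  then have "y \<in> carrier (inv_limit A p)"
    unfolding mem_inv_limit by blast
  then show ?case
    by (rule bexI [rotated]) (simp add: y_def x(2))
qed

lemma proj_inv_limit_surj:
  assumes "\<And>k. p k \<in> epi (A (Suc k)) (A k)"
  shows "(\<lambda>x. x i) ` carrier (inv_limit A p) = carrier (A i)"
proof (intro equalityI subsetI)
  fix a assume "a \<in> carrier (A i)"
  then obtain x where "x \<in> carrier (inv_limit A p)" "x i = a"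
    using inv_limit_element_through [of p A a i] assms by (auto simp: epi_def)
  then show "a \<in> (\<lambda>x. x i) ` carrier (inv_limit A p)"
    by blast
qed (auto simp: mem_inv_limit)

lemma bounded_exponent_torsion_subgroup_iff:
  "bounded_exponent (torsion_subgroup G) \<longleftrightarrow> (\<exists>m. torsion_exponent G m)"
proof -
  have "x [^]\<^bsub>torsion_subgroup G\<^esub> (n::nat) = x [^]\<^bsub>G\<^esub> n" for x n
    by (induction n) (simp_all add: torsion_subgroup_def)
  moreover have "\<one>\<^bsub>torsion_subgroup G\<^esub> = \<one>\<^bsub>G\<^esub>"
    and "carrier (torsion_subgroup G) = {x \<in> carrier G. \<exists>k>0. x [^]\<^bsub>G\<^esub> (k::nat) = \<one>\<^bsub>G\<^esub>}"
    by (simp_all add: torsion_subgroup_def)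
  ultimately show ?thesis
    unfolding bounded_exponent_def torsion_exponent_def by simp blast
qed

lemma finitely_generated_bounded_torsion:
  assumes "comm_group G" "finitely_generated_group G"
  shows "bounded_exponent (torsion_subgroup G)"
  using assms comm_group.torsion_exponent_if_finitely_generated
  unfolding finitely_generated_group_def bounded_exponent_torsion_subgroup_iff by metis

context
  fixes A :: "nat \<Rightarrow> 'a monoid" and p :: "nat \<Rightarrow> 'a \<Rightarrow> 'a"
  assumes tower: "abelian_tower A p" and epi: "\<And>i. p i \<in> epi (A (Suc i)) (A i)"
begin

lemma bar_comm_group_tower: "bar_comm_group (A i)"
  using abelian_towerD(1) [OF tower] by (simp add: bar_comm_group_def)

theorem cotorsion_group_second_homology_cokernel:
  "cotorsion_group (cokernel (group_homology 2 (inv_limit A p)) (homology_limit 2 A p) (homology_limit_map 2 A))"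
proof (rule cotorsion_group_homology_cokernel [OF tower], intro exI [of _ 1] conjI ballI)
  fix i c assume "c \<in> carrier (bar_cycles 2 (A i))"
  then show "frag_cmul (int 1) c \<in> liftable_cycles 2 (inv_limit A p) (A i) (\<lambda>x. x i)"
    using bar_comm_group.two_cycles_liftable [OF bar_comm_group_tower comm_group_inv_limit [OF tower]
        proj_hom [OF tower] proj_inv_limit_surj [of p A, OF epi]] by simp
qed simp

theorem cotorsion_group_homology_cokernel_if_bounded_torsion:
  assumes "\<And>i. bounded_exponent (torsion_subgroup (A i))" "n \<noteq> 0"
  shows "cotorsion_group (cokernel (group_homology n (inv_limit A p)) (homology_limit n A p) (homology_limit_map n A))"
proof (rule cotorsion_group_homology_cokernel [OF tower])
  fix i
  obtain m where m: "torsion_exponent (A i) m"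
    using assms(1) bounded_exponent_torsion_subgroup_iff by blast
  then have "frag_cmul (int (m ^ (\<Sum>j\<le>n. j))) c \<in> liftable_cycles n (inv_limit A p) (A i) (\<lambda>x. x i)"
    if "c \<in> carrier (bar_cycles n (A i))" for c
    using bar_comm_group.bounded_torsion_liftable [OF bar_comm_group_tower comm_group_inv_limit [OF tower]
        proj_hom [OF tower] proj_inv_limit_surj [of p A, OF epi] m that assms(2)] by simp
  moreover have "0 < m ^ (\<Sum>j\<le>n. j)"
    using m by (simp add: torsion_exponent_def)
  ultimately show "\<exists>k>0. \<forall>c\<in>carrier (bar_cycles n (A i)). frag_cmul (int k) c \<in> liftable_cycles n (inv_limit A p) (A i) (\<lambda>x. x i)"
    by blast
qed

end

theorem theorem3:
  fixes A :: "nat \<Rightarrow> 'a monoid" and p :: "nat \<Rightarrow> 'a \<Rightarrow> 'a"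
  assumes "abelian_tower A p"
    and "\<And>i. p i \<in> epi (A (Suc i)) (A i)"
  shows "cotorsion_group
           (cokernel (group_homology 2 (inv_limit A p)) (homology_limit 2 A p)
             (homology_limit_map 2 A)) \<and>
         ((\<forall>i. bounded_exponent (torsion_subgroup (A i))) \<longrightarrow>
         cotorsion_group
           (cokernel (group_homology 3 (inv_limit A p)) (homology_limit 3 A p)
             (homology_limit_map 3 A))) \<and>
         ((\<forall>i. finitely_generated_group (A i)) \<longrightarrow>
         cotorsion_group
           (cokernel (group_homology 3 (inv_limit A p)) (homology_limit 3 A p)
             (homology_limit_map 3 A)))"
proof (intro conjI impI)
  show "cotorsion_group
      (cokernel (group_homology 2 (inv_limit A p)) (homology_limit 2 A p) (homology_limit_map 2 A))"
    by (rule cotorsion_group_second_homology_cokernel [OF assms])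
  show third: "cotorsion_group
      (cokernel (group_homology 3 (inv_limit A p)) (homology_limit 3 A p) (homology_limit_map 3 A))"
    if "\<forall>i. bounded_exponent (torsion_subgroup (A i))"
    using that by (intro cotorsion_group_homology_cokernel_if_bounded_torsion [OF assms]) auto
  show "cotorsion_group
      (cokernel (group_homology 3 (inv_limit A p)) (homology_limit 3 A p) (homology_limit_map 3 A))"
    if "\<forall>i. finitely_generated_group (A i)"
    using that finitely_generated_bounded_torsion [OF abelian_towerD(1) [OF assms(1)]] by (intro third) auto
qed

end
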